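(* The quantum query complexity of mixedness testing is $\Omega\big(\frac{\sqrt{d}}{\varepsilon}\big)$.
   Context: Mixedness testing: given an unknown $d$-dimensional quantum state $\rho$, determine (with success probability at least $2/3$) whether $\rho = I/d$ or $\|\rho - I/d\|_1 \geq \varepsilon$. Query complexity is measured in the purified quantum query access model: the oracle is a unitary $U$ acting on subsystems $\mathsf{A}$ and $\mathsf{B}$ with $\rho = \tr_{\mathsf{B}}\big(U_{\mathsf{AB}}\, |0\rangle\langle 0|_{\mathsf{AB}}\, U_{\mathsf{AB}}^\dagger\big)$, and a query means one use of (controlled-)$U$ or (controlled-)$U^\dagger$. *)

theory Defs
  imports "Jordan_Normal_Form.Schur_Decomposition" "Jordan_Normal_Form.Char_Poly"
begin

definition unitary_mat :: "nat \<Rightarrow> complex mat \<Rightarrow> bool" where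
  "unitary_mat n U \<longleftrightarrow> U \<in> carrier_mat n n \<and> mat_adjoint U * U = 1\<^sub>m n \<and> U * mat_adjoint U = 1\<^sub>m n"

text \<open>Kronecker (tensor) product; index (i,k) of A (x) B is i * dim B + k.\<close>
definition kron :: "complex mat \<Rightarrow> complex mat \<Rightarrow> complex mat" where
  "kron A B = mat (dim_row A * dim_row B) (dim_col A * dim_col B)
     (\<lambda>(i,j). A $$ (i div dim_row B, j div dim_col B) * B $$ (i mod dim_row B, j mod dim_col B))"

definition ptrace_B :: "nat \<Rightarrow> nat \<Rightarrow> complex mat \<Rightarrow> complex mat" where
  "ptrace_B d m X = mat d d (\<lambda>(i,j). \<Sum>k<m. X $$ (i * m + k, j * m + k))"

definition proj0 :: "nat \<Rightarrow> complex mat" where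
  "proj0 n = mat n n (\<lambda>(i,j). if i = 0 \<and> j = 0 then 1 else 0)"

text \<open>Trace norm = sum of singular values, i.e. the sum of the square roots of the
  eigenvalues (with multiplicity) of X^dagger X.\<close>
definition trace_norm :: "complex mat \<Rightarrow> real" where
  "trace_norm X = (let as = (SOME as. char_poly (mat_adjoint X * X) = (\<Prod>a\<leftarrow>as. [:- a, 1:]))
                   in (\<Sum>a\<leftarrow>as. sqrt (Re a)))"

definition encoded_state :: "nat \<Rightarrow> nat \<Rightarrow> complex mat \<Rightarrow> complex mat" where
  "encoded_state d m U = ptrace_B d m (U * proj0 (d * m) * mat_adjoint U)"

definition maximally_mixed :: "nat \<Rightarrow> complex mat" where
  "maximally_mixed d = (1 / of_nat d) \<cdot>\<^sub>m 1\<^sub>m d"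

datatype query = Q_U | Q_Uadj | Q_ctrl_U | Q_ctrl_Uadj

text \<open>Controlled version of an n x n operator: |0><0| (x) I + |1><1| (x) V (control qubit first).\<close>
definition ctrl :: "nat \<Rightarrow> complex mat \<Rightarrow> complex mat" where
  "ctrl n V = four_block_mat (1\<^sub>m n) (0\<^sub>m n n) (0\<^sub>m n n) V"

text \<open>The whole register is  C (control qubit, dim 2) (x) AB (dim n) (x) W (workspace, dim w).
  A query acts on C (x) AB and trivially on the workspace.\<close>
fun query_op :: "nat \<Rightarrow> nat \<Rightarrow> complex mat \<Rightarrow> query \<Rightarrow> complex mat" where
  "query_op n w U Q_U = kron (kron (1\<^sub>m 2) U) (1\<^sub>m w)"
| "query_op n w U Q_Uadj = kron (kron (1\<^sub>m 2) (mat_adjoint U)) (1\<^sub>m w)"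
| "query_op n w U Q_ctrl_U = kron (ctrl n U) (1\<^sub>m w)"
| "query_op n w U Q_ctrl_Uadj = kron (ctrl n (mat_adjoint U)) (1\<^sub>m w)"

definition alg_final_state ::
  "nat \<Rightarrow> nat \<Rightarrow> complex mat list \<Rightarrow> query list \<Rightarrow> complex mat \<Rightarrow> complex vec" where
  "alg_final_state n w Vs qs U =
     foldl (\<lambda>\<psi> (q, V). V *\<^sub>v (query_op n w U q *\<^sub>v \<psi>)) (hd Vs *\<^sub>v unit_vec (2 * n * w) 0) (zip qs (tl Vs))"

definition accept_prob ::
  "nat \<Rightarrow> nat \<Rightarrow> complex mat list \<Rightarrow> query list \<Rightarrow> nat set \<Rightarrow> complex mat \<Rightarrow> real" where
  "accept_prob n w Vs qs S U =
     (\<Sum>i\<in>S \<inter> {..<2 * n * w}. (cmod (alg_final_state n w Vs qs U $ i))\<^sup>2)"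

definition valid_algorithm :: "nat \<Rightarrow> nat \<Rightarrow> nat \<Rightarrow> complex mat list \<Rightarrow> query list \<Rightarrow> bool" where
  "valid_algorithm n w T Vs qs \<longleftrightarrow> w \<ge> 1 \<and> length qs = T \<and> length Vs = T + 1 \<and>
     (\<forall>V \<in> set Vs. unitary_mat (2 * n * w) V)"

definition solves_mixedness :: "nat \<Rightarrow> nat \<Rightarrow> real \<Rightarrow> nat \<Rightarrow> complex mat list \<Rightarrow> query list \<Rightarrow> nat set \<Rightarrow> bool" where
  "solves_mixedness d m \<epsilon> w Vs qs S \<longleftrightarrow>
     (\<forall>U. unitary_mat (d * m) U \<longrightarrow>
        (encoded_state d m U = maximally_mixed d \<longrightarrow> accept_prob (d * m) w Vs qs S U \<ge> 2/3) \<and>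
        (trace_norm (encoded_state d m U - maximally_mixed d) \<ge> \<epsilon> \<longrightarrow> accept_prob (d * m) w Vs qs S U \<le> 1/3))"

end

theory Submission
  imports Defs "HOL-Analysis.L2_Norm"
begin

text \<open>
  For even \<open>D\<close> with \<open>d - 1 \<le> D \<le> d\<close> let \<open>R\<close> range over the traceless Hermitian unitaries of size \<open>D\<close>,
  let \<open>a\<^sup>2 + b\<^sup>2 = 1\<close> with \<open>b = \<epsilon> / 2\<close>, and let the oracle be \<open>(2 \<eta> \<eta>\<^sup>\<dagger> - 1) U\<^sub>0\<close>, where
  \<open>\<eta> = vec (a 1 + b exp (i \<alpha>) R) / sqrt D\<close> and \<open>U\<^sub>0\<close> prepares the maximally entangled state. At
  \<open>\<alpha> = \<pi> / 2\<close> the encoded state is maximally mixed, because \<open>c 1 + i s R\<close> is unitary when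
  \<open>c\<^sup>2 + s\<^sup>2 = 1\<close>; at \<open>\<alpha> = 0\<close> it is \<open>\<epsilon>\<close>-far from it. Hence the acceptance probability, averaged over a
  unitarily invariant distribution of \<open>R\<close>, must change by \<open>1/3\<close> along \<open>0 \<le> \<alpha> \<le> \<pi> / 2\<close>.

  The derivative in \<open>\<alpha>\<close> is nearly invisible to the algorithm. The entries of \<open>R\<close> are eigenfunctions, with
  eigenvalue \<open>2 D\<close>, of the Casimir Laplacian \<open>C = - \<Sum>\<^sub>k D\<^sub>k\<^sup>2\<close> of the conjugation action of \<open>U(D)\<close>, so the
  self-adjoint operator \<open>C / (2 D)\<close>, which acts on the hidden \<open>R\<close> only and cannot influence the measurement,
  generates the rotation of \<open>\<alpha>\<close> up to the first-order cross terms \<open>\<Sum>\<^sub>k D\<^sub>k \<eta> D\<^sub>k\<close>. These are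
  controlled by the energy \<open>\<Sum>\<^sub>k \<parallel>D\<^sub>k \<psi>\<parallel>\<^sup>2\<close>, whose square root grows by \<open>O(b sqrt D)\<close> per query. The derivative of the
  averaged acceptance probability after \<open>T\<close> queries is therefore \<open>O(b\<^sup>2 T\<^sup>2 / D)\<close>.

  Haar measure is replaced by finitely supported distributions that nearly minimise a conjugation-invariant
  norm of their moments; by the parallelogram law they are nearly invariant, which is all that integration by
  parts needs.
\<close>

section \<open>Weighted families of reflections and their moments\<close>

text \<open>The rate comes from a mismatch between two sizes of the same D^2 directional derivatives
  of \<eta>. Their total squared norm \<Lambda>^2 is of order b^2 D, but as a single map sending v
  to all its inner products with them they have squared norm \<gamma>^2 of order only b^2 / D. Each
  cross term holds one bra against these derivatives, worth \<gamma>, and an energy fed by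
  \<Lambda>. As \<gamma> \<Lambda> = 8 b^2 is free of D, division by the eigenvalue 2 D leaves b^2 /
  D per pair of queries. For a fixed \<open>R\<close> the two endpoint oracles differ in norm by
  order b, so comparing them query by query gives only T of order 1 / b; averaging over
  \<open>R\<close> brings in the factor sqrt D. The obstacle is that a second-order operator obeys
  no plain Leibniz rule, and the cross terms are its failure. Turning the phase of one coefficient
  keeps \<eta> normalised along the whole path and makes its \<alpha>-derivative i times an
  eigenfunction. Tracelessness serves twice: it makes \<open>R\<close> orthogonal to the identity,
  and it makes the entries eigenfunctions. It also forces D to be even.\<close>

definition hermitian_reflections :: "nat \<Rightarrow> complex mat set" where
  "hermitian_reflections D = {R \<in> carrier_mat D D. mat_adjoint R = R \<and> R * R = 1\<^sub>m D \<and> (\<Sum>i<D. R $$ (i,i)) = 0}"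

text \<open>Weights are complex and need not sum to 1: multiplying the integrand by a function, or
  subtracting two distributions, again gives such a list, so moment estimates extend to signed and
  weighted families.\<close>

definition expect :: "(complex \<times> 'r) list \<Rightarrow> ('r \<Rightarrow> complex) \<Rightarrow> complex" where
  "expect \<nu> f = (\<Sum>(a,R)\<leftarrow>\<nu>. a * f R)"

lemma expect_Nil [simp]: "expect [] f = 0"
  and expect_Cons [simp]: "expect ((a,R) # \<nu>) f = a * f R + expect \<nu> f"
  by (auto simp: expect_def)

lemma expect_append: "expect (\<nu> @ \<nu>') f = expect \<nu> f + expect \<nu>' f"
  by (induct \<nu>) auto

lemma expect_add: "expect \<nu> (\<lambda>R. f R + g R) = expect \<nu> f + expect \<nu> g"
  by (induct \<nu>) (auto simp: algebra_simps)

lemma expect_cmult: "expect \<nu> (\<lambda>R. c * f R) = c * expect \<nu> f"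
  by (induct \<nu>) (auto simp: algebra_simps)

lemma expect_multc: "expect \<nu> (\<lambda>R. f R * c) = expect \<nu> f * c"
  by (induct \<nu>) (auto simp: algebra_simps)

lemma expect_diff: "expect \<nu> (\<lambda>R. f R - g R) = expect \<nu> f - expect \<nu> g"
  by (induct \<nu>) (auto simp: algebra_simps)

lemma expect_sum: "expect \<nu> (\<lambda>R. \<Sum>k\<in>K. f k R) = (\<Sum>k\<in>K. expect \<nu> (f k))"
  by (induct \<nu>) (auto simp: sum_distrib_left sum.distrib)

lemma expect_scale: "expect (map (\<lambda>(a,R). (c * a, R)) \<nu>) f = c * expect \<nu> f"
  by (induct \<nu>) (auto simp: algebra_simps)

lemma expect_push: "expect (map (\<lambda>(a,R). (a, g R)) \<nu>) f = expect \<nu> (\<lambda>R. f (g R))"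
  by (induct \<nu>) auto

lemma expect_weight: "expect (map (\<lambda>(a,R). (a * g R, R)) \<nu>) f = expect \<nu> (\<lambda>R. g R * f R)"
  by (induct \<nu>) auto

lemma expect_cong:
  assumes "snd ` set \<nu> \<subseteq> S" "\<And>R. R \<in> S \<Longrightarrow> f R = g R"
  shows "expect \<nu> f = expect \<nu> g"
  using assms(1) by (induct \<nu>) (auto simp: assms(2))

definition prob_list :: "'r set \<Rightarrow> (complex \<times> 'r) list \<Rightarrow> bool" where
  "prob_list S \<nu> \<longleftrightarrow> (\<forall>(a,R)\<in>set \<nu>. a \<in> \<real> \<and> 0 \<le> Re a \<and> R \<in> S) \<and> expect \<nu> (\<lambda>_. 1) = 1"

lemma prob_list_subset: "prob_list S \<nu> \<Longrightarrow> snd ` set \<nu> \<subseteq> S"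
  by (auto simp: prob_list_def)

lemma expect_bound:
  assumes "prob_list S \<nu>" "\<And>R. R \<in> S \<Longrightarrow> cmod (f R) \<le> B"
  shows "cmod (expect \<nu> f) \<le> B"
proof -
  have "cmod (expect \<nu> f) \<le> B * Re (expect \<nu> (\<lambda>_. 1))"
    if "\<forall>(a,R)\<in>set \<nu>. a \<in> \<real> \<and> 0 \<le> Re a \<and> R \<in> S" using that
  proof (induct \<nu>)
    case (Cons x \<nu>)
    obtain a R where x: "x = (a,R)" by force
    have "cmod (a * f R) \<le> B * Re a"
    proof -
      have "cmod a = Re a" using Cons(2) x by (auto simp: complex_is_Real_iff cmod_def)
      thus ?thesis using mult_right_mono[OF assms(2)[of R], of "Re a"] Cons(2) x
        by (auto simp: norm_mult mult.commute)
    qed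
    thus ?case using Cons x norm_triangle_ineq[of "a * f R" "expect \<nu> f"]
      by (auto simp: algebra_simps)
  qed simp
  thus ?thesis using assms(1) by (auto simp: prob_list_def)
qed

text \<open>A squared Sobolev-like norm of the moments up to order \<open>m\<close> of a functional \<open>L\<close> on
  functions of a matrix: it is the functional applied twice to the kernel
  \<open>(1 + tr (R R'\<^sup>\<dagger>)) ^ m\<close>, hence invariant under unitary conjugation.\<close>
fun moment_norm :: "nat \<Rightarrow> nat \<Rightarrow> ((complex mat \<Rightarrow> complex) \<Rightarrow> complex) \<Rightarrow> real" where
  "moment_norm D 0 L = (cmod (L (\<lambda>_. 1)))\<^sup>2"
| "moment_norm D (Suc m) L = moment_norm D m L
     + (\<Sum>i<D. \<Sum>j<D. moment_norm D m (\<lambda>f. L (\<lambda>R. R $$ (i,j) * f R)))"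

lemma moment_norm_nonneg: "0 \<le> moment_norm D m L"
  by (induct m arbitrary: L) (auto intro!: add_nonneg_nonneg sum_nonneg)

lemma moment_norm_Suc: "moment_norm D m L \<le> moment_norm D (Suc m) L"
  by (auto intro!: sum_nonneg moment_norm_nonneg)

lemma moment_norm_mono: "m \<le> m' \<Longrightarrow> moment_norm D m L \<le> moment_norm D m' L"
  using lift_Suc_mono_le[of "\<lambda>m. moment_norm D m L"] moment_norm_Suc by blast

lemma moment_norm_entry:
  assumes "i < D" "j < D"
  shows "moment_norm D m (\<lambda>f. L (\<lambda>R. R $$ (i,j) * f R)) \<le> moment_norm D (Suc m) L"
proof -
  have "moment_norm D m (\<lambda>f. L (\<lambda>R. R $$ (i,j) * f R))
     \<le> (\<Sum>j<D. moment_norm D m (\<lambda>f. L (\<lambda>R. R $$ (i,j) * f R)))"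
    using assms by (intro member_le_sum) (auto intro: moment_norm_nonneg)
  also have "\<dots> \<le> (\<Sum>i<D. \<Sum>j<D. moment_norm D m (\<lambda>f. L (\<lambda>R. R $$ (i,j) * f R)))"
    using assms by (intro member_le_sum[of i "{..<D}" "\<lambda>i. \<Sum>j<D. moment_norm D m (\<lambda>f. L (\<lambda>R. R $$ (i,j) * f R))"])
      (auto intro: moment_norm_nonneg sum_nonneg)
  finally show ?thesis using moment_norm_nonneg[of D m L] by simp
qed

lemma moment_norm_scale: "moment_norm D m (\<lambda>f. c * L f) = (cmod c)\<^sup>2 * moment_norm D m L"
  by (induct m arbitrary: L) (auto simp: norm_mult power_mult_distrib algebra_simps sum_distrib_left)

lemma moment_norm_parallelogram:
  "moment_norm D m (\<lambda>f. L f + L' f) + moment_norm D m (\<lambda>f. L f - L' f)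
   = 2 * moment_norm D m L + 2 * moment_norm D m L'"
proof (induct m arbitrary: L L')
  case 0
  show ?case by (simp add: cmod_power2) (simp add: power2_eq_square algebra_simps)
next
  case (Suc m)
  have "moment_norm D (Suc m) (\<lambda>f. L f + L' f) + moment_norm D (Suc m) (\<lambda>f. L f - L' f) =
    (moment_norm D m (\<lambda>f. L f + L' f) + moment_norm D m (\<lambda>f. L f - L' f)) +
    (\<Sum>i<D. \<Sum>j<D. moment_norm D m (\<lambda>f. L (\<lambda>R. R $$ (i,j) * f R) + L' (\<lambda>R. R $$ (i,j) * f R))
      + moment_norm D m (\<lambda>f. L (\<lambda>R. R $$ (i,j) * f R) - L' (\<lambda>R. R $$ (i,j) * f R)))"
    by (simp add: sum.distrib)
  also have "\<dots> = 2 * moment_norm D (Suc m) L + 2 * moment_norm D (Suc m) L'"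
    unfolding Suc by (simp add: sum.distrib sum_distrib_left algebra_simps)
  finally show ?case .
qed

lemma moment_norm_add_le:
  "moment_norm D m (\<lambda>f. L f + L' f) \<le> 2 * moment_norm D m L + 2 * moment_norm D m L'"
  using moment_norm_parallelogram[of D m L L'] moment_norm_nonneg[of D m "\<lambda>f. L f - L' f"] by linarith

definition frob :: "nat \<Rightarrow> complex mat \<Rightarrow> complex mat \<Rightarrow> complex" where
  "frob D R R' = (\<Sum>i<D. \<Sum>j<D. R $$ (i,j) * cnj (R' $$ (i,j)))"

text \<open>Each level of the recursion sums an entry of one sample against the conjugate entry of
  the other, which contributes one more factor 1 + \<open>frob\<close>. The weight \<open>h\<close>
  is kept general because the recursive call multiplies the integrand by an entry.\<close>

lemma moment_norm_closed:
  "complex_of_real (moment_norm D m (\<lambda>f. expect \<nu> (\<lambda>R. h R * f R))) =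
   expect \<nu> (\<lambda>R. cnj (expect \<nu> (\<lambda>R'. h R' * cnj (h R) * cnj (1 + frob D R R') ^ m)))"
proof (induct m arbitrary: h)
  case 0
  have "complex_of_real ((cmod z)\<^sup>2) = z * cnj z" for z by (rule complex_norm_square)
  hence "complex_of_real (moment_norm D 0 (\<lambda>f. expect \<nu> (\<lambda>R. h R * f R))) = expect \<nu> h * cnj (expect \<nu> h)"
    by simp
  also have "\<dots> = expect \<nu> (\<lambda>R. h R * cnj (expect \<nu> h))" by (rule expect_multc[symmetric])
  also have "\<dots> = expect \<nu> (\<lambda>R. cnj (expect \<nu> (\<lambda>R'. cnj (h R) * h R')))"
    by (simp add: expect_cmult expect_multc)
  finally show ?case by (simp add: mult.commute)
next
  case (Suc m)
  define G where "G = (\<lambda>R R'. h R' * cnj (h R) * cnj (1 + frob D R R') ^ m)"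
  have "complex_of_real (moment_norm D (Suc m) (\<lambda>f. expect \<nu> (\<lambda>R. h R * f R)))
    = expect \<nu> (\<lambda>R. cnj (expect \<nu> (G R))) + (\<Sum>i<D. \<Sum>j<D. expect \<nu> (\<lambda>R. cnj (expect \<nu> (\<lambda>R'.
        cnj (R $$ (i,j)) * R' $$ (i,j) * G R R'))))"
    unfolding moment_norm.simps of_real_add of_real_sum Suc G_def
    using Suc[of "\<lambda>R. h R * R $$ (_,_)"] by (simp add: mult_ac)
  also have "\<dots> = expect \<nu> (\<lambda>R. cnj (expect \<nu> (\<lambda>R'. G R R' + (\<Sum>i<D. \<Sum>j<D. 
        cnj (R $$ (i,j)) * R' $$ (i,j) * G R R'))))"
    by (simp add: expect_sum expect_add cnj_sum)
  also have "(\<lambda>R R'. G R R' + (\<Sum>i<D. \<Sum>j<D. cnj (R $$ (i,j)) * R' $$ (i,j) * G R R'))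
     = (\<lambda>R R'. h R' * cnj (h R) * cnj (1 + frob D R R') ^ Suc m)"
    by (simp add: G_def frob_def cnj_sum sum_distrib_left sum_distrib_right algebra_simps)
  finally show ?case .
qed

lemma moment_norm_closed_1:
  "complex_of_real (moment_norm D m (expect \<nu>)) =
   expect \<nu> (\<lambda>R. cnj (expect \<nu> (\<lambda>R'. cnj (1 + frob D R R') ^ m)))"
  using moment_norm_closed[of D m \<nu> "\<lambda>_. 1"] by (simp add: eta_contract_eq)

text \<open>Only Frobenius products between sample points enter the closed form, so a map that
  preserves them cannot change the norm.\<close>

lemma moment_norm_push:
  assumes "snd ` set \<nu> \<subseteq> S" "\<And>R R'. R \<in> S \<Longrightarrow> R' \<in> S \<Longrightarrow> frob D (g R) (g R') = frob D R R'"
  shows "moment_norm D m (\<lambda>f. expect \<nu> (\<lambda>R. f (g R))) = moment_norm D m (expect \<nu>)"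
proof -
  have "complex_of_real (moment_norm D m (expect (map (\<lambda>(a,R). (a, g R)) \<nu>))) =
     expect \<nu> (\<lambda>R. cnj (expect \<nu> (\<lambda>R'. cnj (1 + frob D (g R) (g R')) ^ m)))"
    unfolding moment_norm_closed_1 expect_push ..
  also have "\<dots> = complex_of_real (moment_norm D m (expect \<nu>))"
    unfolding moment_norm_closed_1
    by (intro expect_cong[OF assms(1)] arg_cong[of _ _ cnj] arg_cong[of _ _ "\<lambda>z. _ ^ m"])
       (simp add: assms(2))
  finally show ?thesis by (simp add: expect_push[abs_def])
qed

text \<open>A real kernel does not notice that all weights are conjugated. This makes
  \<open>controlled\<close> closed under complex conjugation, which inner products require.\<close>

lemma moment_norm_cnj:
  assumes "snd ` set \<nu> \<subseteq> S" "\<And>R R'. R \<in> S \<Longrightarrow> R' \<in> S \<Longrightarrow> frob D R R' \<in> \<real>"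
  shows "moment_norm D m (\<lambda>f. cnj (expect \<nu> (\<lambda>R. cnj (f R)))) = moment_norm D m (expect \<nu>)"
proof -
  have *: "(\<lambda>f. cnj (expect \<nu> (\<lambda>R. cnj (f R)))) = expect (map (\<lambda>(a,R). (cnj a, R)) \<nu>)"
    by (rule ext, induct \<nu>) auto
  have e: "expect (map (\<lambda>(a,R). (cnj a, R)) \<nu>) f = cnj (expect \<nu> (\<lambda>R. cnj (f R)))" for f
    using fun_cong[OF *, of f] by simp
  have "complex_of_real (moment_norm D m (\<lambda>f. cnj (expect \<nu> (\<lambda>R. cnj (f R)))))
     = cnj (expect \<nu> (\<lambda>R. cnj (expect \<nu> (\<lambda>R'. (1 + frob D R R') ^ m))))"
    unfolding * moment_norm_closed_1 unfolding e by simp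
  also have "\<dots> = cnj (complex_of_real (moment_norm D m (expect \<nu>)))"
    unfolding moment_norm_closed_1
    by (intro arg_cong[of _ _ cnj] expect_cong[OF assms(1)])
       (use assms(2) in \<open>simp add: Reals_cnj_iff\<close>)
  finally show ?thesis by simp
qed


section \<open>Unitary conjugation of reflections\<close>

lemma mat_adjoint_dim [simp]: "dim_row (mat_adjoint A) = dim_col A" "dim_col (mat_adjoint A) = dim_row A"
  by (auto simp: mat_adjoint_def)

lemma mat_adjoint_index [simp]:
  "i < dim_col A \<Longrightarrow> j < dim_row A \<Longrightarrow> mat_adjoint A $$ (i,j) = cnj (A $$ (j,i :: nat))"
  by (simp add: mat_adjoint_def mat_of_rows_def conjugate_complex_def)

lemma mat_adjoint_carrier [intro, simp]: "A \<in> carrier_mat n m \<Longrightarrow> mat_adjoint A \<in> carrier_mat m n"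
  by auto

lemma index_mult_mat_sum:
  "i < dim_row A \<Longrightarrow> j < dim_col B \<Longrightarrow> (A * B) $$ (i,j) = (\<Sum>k<dim_row B. A $$ (i,k) * B $$ (k,j))"
  if "dim_col A = dim_row B" for A B :: "complex mat"
  using that by (auto simp: scalar_prod_def lessThan_atLeast0 intro!: sum.cong)

definition conj_by :: "complex mat \<Rightarrow> complex mat \<Rightarrow> complex mat" where
  "conj_by u R = u * R * mat_adjoint u"

lemma conj_by_index:
  assumes "u \<in> carrier_mat D D" "R \<in> carrier_mat D D" "i < D" "j < D"
  shows "conj_by u R $$ (i,j) = (\<Sum>a<D. \<Sum>b<D. u $$ (i,a) * R $$ (a,b) * cnj (u $$ (j,b)))"
proof -
  have "conj_by u R $$ (i,j) = (\<Sum>b<D. (\<Sum>a<D. u $$ (i,a) * R $$ (a,b)) * cnj (u $$ (j,b)))"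
    using assms by (auto simp: conj_by_def index_mult_mat_sum simp del: index_mult_mat(1))
  thus ?thesis by (simp add: sum_distrib_right) (rule sum.swap)
qed

lemma unitary_mat_col:
  assumes "unitary_mat D u" "a < D" "b < D"
  shows "(\<Sum>i<D. cnj (u $$ (i,a)) * u $$ (i,b)) = (if a = b then 1 else 0)"
proof -
  have "(mat_adjoint u * u) $$ (a,b) = (1\<^sub>m D) $$ (a,b)" and u: "u \<in> carrier_mat D D"
    using assms by (auto simp: unitary_mat_def)
  thus ?thesis using assms by (auto simp: index_mult_mat_sum simp del: index_mult_mat(1))
qed

lemma hermitian_reflections_cnj:
  "R \<in> hermitian_reflections D \<Longrightarrow> i < D \<Longrightarrow> j < D \<Longrightarrow> cnj (R $$ (i,j)) = R $$ (j,i)"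
  using mat_adjoint_index[of j R i] by (auto simp: hermitian_reflections_def simp del: mat_adjoint_index)

lemma sum_diag_mult_comm:
  fixes A B :: "complex mat"
  assumes "A \<in> carrier_mat D D" "B \<in> carrier_mat D D"
  shows "(\<Sum>i<D. (A * B) $$ (i,i)) = (\<Sum>i<D. (B * A) $$ (i,i))"
proof -
  have "(\<Sum>i<D. (A * B) $$ (i,i)) = (\<Sum>i<D. \<Sum>k<D. A $$ (i,k) * B $$ (k,i))"
    using assms by (intro sum.cong) (auto simp: index_mult_mat_sum simp del: index_mult_mat(1))
  also have "\<dots> = (\<Sum>k<D. \<Sum>i<D. B $$ (k,i) * A $$ (i,k))"
    by (subst sum.swap) (simp add: mult.commute)
  also have "\<dots> = (\<Sum>i<D. (B * A) $$ (i,i))"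
    using assms by (intro sum.cong) (auto simp: index_mult_mat_sum simp del: index_mult_mat(1))
  finally show ?thesis .
qed

lemma mat_adjoint_conj_by:
  assumes "u \<in> carrier_mat D D" "R \<in> carrier_mat D D"
  shows "mat_adjoint (conj_by u R) = conj_by u (mat_adjoint R)"
proof (rule eq_matI)
  have c: "conj_by u X \<in> carrier_mat D D" if "X \<in> carrier_mat D D" for X
    using assms that by (auto simp: conj_by_def)
  fix i j assume "i < dim_row (conj_by u (mat_adjoint R))" "j < dim_col (conj_by u (mat_adjoint R))"
  hence ij: "i < D" "j < D" using c[of "mat_adjoint R"] assms by auto
  have "mat_adjoint (conj_by u R) $$ (i,j) = cnj (conj_by u R $$ (j,i))"
    using c[OF assms(2)] ij by auto
  also have "\<dots> = (\<Sum>b<D. \<Sum>a<D. u $$ (i,b) * cnj (R $$ (a,b)) * cnj (u $$ (j,a)))"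
    using assms ij by (simp add: conj_by_index cnj_sum mult_ac) (rule sum.swap)
  also have "\<dots> = conj_by u (mat_adjoint R) $$ (i,j)"
    using assms ij by (simp add: conj_by_index)
  finally show "mat_adjoint (conj_by u R) $$ (i,j) = conj_by u (mat_adjoint R) $$ (i,j)" .
qed (use assms in \<open>auto simp: conj_by_def\<close>)

lemma conj_by_mult:
  assumes u: "unitary_mat D u" and "A \<in> carrier_mat D D" "B \<in> carrier_mat D D"
  shows "conj_by u A * conj_by u B = conj_by u (A * B)"
proof -
  have c: "u \<in> carrier_mat D D" "mat_adjoint u \<in> carrier_mat D D" "mat_adjoint u * u = 1\<^sub>m D"
    using u by (auto simp: unitary_mat_def)
  have "conj_by u A * conj_by u B = u * (A * ((mat_adjoint u * u) * (B * mat_adjoint u)))"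
    unfolding conj_by_def using c(1,2) assms by (simp add: assoc_mult_mat[of _ D D _ D _ D])
  thus ?thesis unfolding c(3) conj_by_def using c(1,2) assms by (simp add: assoc_mult_mat[of _ D D _ D _ D])
qed

lemma sum_diag_conj_by:
  assumes u: "unitary_mat D u" and A: "A \<in> carrier_mat D D"
  shows "(\<Sum>i<D. conj_by u A $$ (i,i)) = (\<Sum>i<D. A $$ (i,i))"
proof -
  have c: "u \<in> carrier_mat D D" "mat_adjoint u \<in> carrier_mat D D" "mat_adjoint u * u = 1\<^sub>m D"
    using u by (auto simp: unitary_mat_def)
  have "(\<Sum>i<D. conj_by u A $$ (i,i)) = (\<Sum>i<D. (mat_adjoint u * (u * A)) $$ (i,i))"
    unfolding conj_by_def using c A by (intro sum_diag_mult_comm) auto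
  also have "mat_adjoint u * (u * A) = A"
    using c A by (simp add: assoc_mult_mat[of _ D D _ D _ D, symmetric])
  finally show ?thesis .
qed

lemma frob_eq_sum_diag:
  assumes "R \<in> carrier_mat D D" "R' \<in> carrier_mat D D"
  shows "frob D R R' = (\<Sum>i<D. (R * mat_adjoint R') $$ (i,i))"
  unfolding frob_def using assms
  by (intro sum.cong) (auto simp: index_mult_mat_sum simp del: index_mult_mat(1))

lemma frob_conj_by:
  assumes u: "unitary_mat D u" and R: "R \<in> carrier_mat D D" "R' \<in> carrier_mat D D"
  shows "frob D (conj_by u R) (conj_by u R') = frob D R R'"
proof -
  have c: "u \<in> carrier_mat D D" using u by (auto simp: unitary_mat_def)
  hence c': "conj_by u X \<in> carrier_mat D D" if "X \<in> carrier_mat D D" for X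
    using that by (auto simp: conj_by_def)
  show ?thesis using R c
    by (simp add: frob_eq_sum_diag c' mat_adjoint_conj_by conj_by_mult[OF u] sum_diag_conj_by[OF u] del: index_mult_mat(1))
qed

lemma conj_by_hermitian_reflections:
  assumes u: "unitary_mat D u" and R: "R \<in> hermitian_reflections D"
  shows "conj_by u R \<in> hermitian_reflections D"
proof -
  have c: "u \<in> carrier_mat D D" "R \<in> carrier_mat D D" "u * mat_adjoint u = 1\<^sub>m D" using u R
    by (auto simp: unitary_mat_def hermitian_reflections_def)
  hence cc: "conj_by u R \<in> carrier_mat D D" by (auto simp: conj_by_def)
  have 1: "conj_by u R * conj_by u R = 1\<^sub>m D"
    using R c by (simp add: conj_by_mult[OF u] hermitian_reflections_def) (simp add: conj_by_def)
  have "mat_adjoint (conj_by u R) = conj_by u R"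
    using R c by (simp add: mat_adjoint_conj_by hermitian_reflections_def)
  thus ?thesis using 1 cc sum_diag_conj_by[OF u c(2)] R by (auto simp: hermitian_reflections_def)
qed

lemma frob_real:
  assumes "R \<in> hermitian_reflections D" "R' \<in> hermitian_reflections D"
  shows "frob D R R' \<in> \<real>"
proof -
  have "cnj (frob D R R') = (\<Sum>i<D. \<Sum>j<D. R $$ (j,i) * cnj (R' $$ (j,i)))"
    using assms by (simp add: frob_def cnj_sum hermitian_reflections_cnj)
  also have "\<dots> = frob D R R'" unfolding frob_def by (rule sum.swap)
  finally show ?thesis by (simp add: Reals_cnj_iff)
qed

section \<open>Near-minimisers of the moment norm in place of an invariant measure\<close>

definition min_seq :: "nat \<Rightarrow> (nat \<Rightarrow> (complex \<times> complex mat) list) \<Rightarrow> bool" where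
  "min_seq D \<mu> \<longleftrightarrow> (\<forall>j. prob_list (hermitian_reflections D) (\<mu> j) \<and>
     (\<forall>\<nu>. prob_list (hermitian_reflections D) \<nu> \<longrightarrow>
        moment_norm D j (expect (\<mu> j)) \<le> moment_norm D j (expect \<nu>) + 1 / real (Suc j)))"

text \<open>Near-minimisers come from the infimum of a nonempty set bounded below by 0, so no
  compactness argument enters.\<close>

lemma min_seq_exists:
  assumes "R \<in> hermitian_reflections D"
  shows "\<exists>\<mu>. min_seq D \<mu>"
proof -
  define P where "P = Collect (prob_list (hermitian_reflections D))"
  have "\<exists>\<mu>\<in>P. \<forall>\<nu>\<in>P. moment_norm D j (expect \<mu>) \<le> moment_norm D j (expect \<nu>) + 1 / real (Suc j)" for j
  proof -
    have "[(1,R)] \<in> P" using assms by (auto simp: P_def prob_list_def)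
    hence ne: "(\<lambda>\<nu>. moment_norm D j (expect \<nu>)) ` P \<noteq> {}" by auto
    have bdd: "bdd_below ((\<lambda>\<nu>. moment_norm D j (expect \<nu>)) ` P)"
      by (rule bdd_belowI[of _ 0]) (auto simp: moment_norm_nonneg)
    have "(INF \<nu>\<in>P. moment_norm D j (expect \<nu>)) < (INF \<nu>\<in>P. moment_norm D j (expect \<nu>)) + 1 / real (Suc j)"
      by simp
    then obtain \<mu> where "\<mu> \<in> P" "moment_norm D j (expect \<mu>) < (INF \<nu>\<in>P. moment_norm D j (expect \<nu>)) + 1 / real (Suc j)"
      using cInf_lessD[OF ne] by force
    moreover have "(INF \<nu>\<in>P. moment_norm D j (expect \<nu>)) \<le> moment_norm D j (expect \<nu>)" if "\<nu> \<in> P" for \<nu>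
      using bdd that by (rule cINF_lower)
    ultimately show ?thesis by (intro bexI[of _ \<mu>]) force+
  qed
  then obtain \<mu> where "\<And>j. \<mu> j \<in> P \<and> (\<forall>\<nu>\<in>P. moment_norm D j (expect (\<mu> j)) \<le> moment_norm D j (expect \<nu>) + 1 / real (Suc j))"
    by metis
  thus ?thesis by (auto simp: min_seq_def P_def)
qed

text \<open>The midpoint of \<open>\<mu> j\<close> and its conjugate is an admissible competitor
  whose squared norm is a quarter of that of the sum. Since both summands have equal norm, the
  parallelogram law turns near-minimality into a bound on the difference: four times the slack 1 /
  (j + 1).\<close>

lemma min_seq_almost_invariant:
  assumes \<mu>: "min_seq D \<mu>" and u: "unitary_mat D u"
  shows "moment_norm D j (\<lambda>f. expect (\<mu> j) f - expect (\<mu> j) (\<lambda>R. f (conj_by u R))) \<le> 4 / real (Suc j)"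
proof -
  let ?S = "hermitian_reflections D"
  let ?N = "moment_norm D j"
  let ?L = "expect (\<mu> j)" let ?L' = "\<lambda>f. expect (\<mu> j) (\<lambda>R. f (conj_by u R))"
  have p: "prob_list ?S (\<mu> j)" using \<mu> by (auto simp: min_seq_def)
  define \<nu> where "\<nu> = map (\<lambda>(a,R). ((1/2) * a, R)) (\<mu> j @ map (\<lambda>(a,R). (a, conj_by u R)) (\<mu> j))"
  have e\<nu>: "expect \<nu> = (\<lambda>f. (1/2) * (?L f + ?L' f))"
    by (rule ext) (simp only: \<nu>_def expect_scale expect_append expect_push)
  have "prob_list ?S \<nu>" unfolding prob_list_def
  proof
    show "expect \<nu> (\<lambda>_. 1) = 1" using p by (simp add: e\<nu> prob_list_def)
    show "\<forall>(a,R)\<in>set \<nu>. a \<in> \<real> \<and> 0 \<le> Re a \<and> R \<in> ?S"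
      using p conj_by_hermitian_reflections[OF u]
      by (fastforce simp: \<nu>_def prob_list_def complex_is_Real_iff)
  qed
  hence "?N ?L \<le> ?N (expect \<nu>) + 1 / real (Suc j)" using \<mu> by (auto simp: min_seq_def)
  moreover have "?N (expect \<nu>) = (1/4) * ?N (\<lambda>f. ?L f + ?L' f)"
    unfolding e\<nu> moment_norm_scale by (simp add: power2_eq_square)
  moreover have "?N ?L' = ?N ?L"
    by (rule moment_norm_push[OF prob_list_subset[OF p]])
       (auto intro!: frob_conj_by u simp: hermitian_reflections_def)
  moreover have "4 / real (Suc j) = 4 * (1 / real (Suc j))" by simp
  ultimately show ?thesis using moment_norm_parallelogram[of D j ?L ?L'] by linarith
qed


text \<open>Multiplication by \<open>f\<close> is bounded from moment order m + n to moment order m,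
  uniformly in the parameter. This stands in for being a polynomial of bounded degree in the entries
  and their conjugates; asking it for all m and all complex weightings is what lets such bounds be
  composed.\<close>

definition controlled :: "nat \<Rightarrow> (real \<Rightarrow> complex mat \<Rightarrow> complex) \<Rightarrow> bool" where
  "controlled D f \<longleftrightarrow> (\<exists>n C. 0 \<le> C \<and> (\<forall>\<alpha> m \<nu>. snd ` set \<nu> \<subseteq> hermitian_reflections D \<longrightarrow>
     moment_norm D m (\<lambda>g. expect \<nu> (\<lambda>R. f \<alpha> R * g R)) \<le> C * moment_norm D (m + n) (expect \<nu>)))"

lemma controlled_const:
  assumes "\<And>\<alpha>. cmod (c \<alpha>) \<le> B"
  shows "controlled D (\<lambda>\<alpha> R. c \<alpha>)"
proof -
  have "moment_norm D m (\<lambda>g. expect \<nu> (\<lambda>R. c \<alpha> * g R)) \<le> B\<^sup>2 * moment_norm D (m + 0) (expect \<nu>)" for m \<nu> \<alpha>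
    unfolding expect_cmult moment_norm_scale
    using assms[of \<alpha>] by (auto intro!: mult_right_mono power_mono moment_norm_nonneg)
  thus ?thesis unfolding controlled_def by (intro exI[of _ 0] exI[of _ "B\<^sup>2"]) auto
qed

lemma controlled_add:
  assumes "controlled D f" "controlled D g"
  shows "controlled D (\<lambda>\<alpha> R. f \<alpha> R + g \<alpha> R)"
proof -
  obtain n C where C: "0 \<le> C" "\<And>\<alpha> m \<nu>. snd ` set \<nu> \<subseteq> hermitian_reflections D \<Longrightarrow>
     moment_norm D m (\<lambda>h. expect \<nu> (\<lambda>R. f \<alpha> R * h R)) \<le> C * moment_norm D (m + n) (expect \<nu>)"
    using assms(1) unfolding controlled_def by blast
  obtain n' C' where C': "0 \<le> C'" "\<And>\<alpha> m \<nu>. snd ` set \<nu> \<subseteq> hermitian_reflections D \<Longrightarrow>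
     moment_norm D m (\<lambda>h. expect \<nu> (\<lambda>R. g \<alpha> R * h R)) \<le> C' * moment_norm D (m + n') (expect \<nu>)"
    using assms(2) unfolding controlled_def by blast
  have "moment_norm D m (\<lambda>h. expect \<nu> (\<lambda>R. (f \<alpha> R + g \<alpha> R) * h R))
     \<le> (2 * C + 2 * C') * moment_norm D (m + max n n') (expect \<nu>)"
    if S: "snd ` set \<nu> \<subseteq> hermitian_reflections D" for \<alpha> m \<nu>
  proof -
    have "moment_norm D m (\<lambda>h. expect \<nu> (\<lambda>R. (f \<alpha> R + g \<alpha> R) * h R)) \<le>
       2 * moment_norm D m (\<lambda>h. expect \<nu> (\<lambda>R. f \<alpha> R * h R)) + 2 * moment_norm D m (\<lambda>h. expect \<nu> (\<lambda>R. g \<alpha> R * h R))"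
      unfolding distrib_right expect_add by (rule moment_norm_add_le)
    also have "\<dots> \<le> 2 * (C * moment_norm D (m + max n n') (expect \<nu>)) + 2 * (C' * moment_norm D (m + max n n') (expect \<nu>))"
      by (intro add_mono mult_left_mono order_trans[OF C(2)[OF S]] order_trans[OF C'(2)[OF S]] moment_norm_mono C(1) C'(1)) auto
    finally show ?thesis by (simp add: algebra_simps)
  qed
  thus ?thesis unfolding controlled_def using C(1) C'(1)
    by (intro exI[of _ "max n n'"] exI[of _ "2 * C + 2 * C'"]) auto
qed

text \<open>The factor \<open>g\<close> is absorbed into the weights, and the bound for
  \<open>f\<close> is applied to the reweighted list.\<close>

lemma controlled_mult:
  assumes "controlled D f" "controlled D g"
  shows "controlled D (\<lambda>\<alpha> R. f \<alpha> R * g \<alpha> R)"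
proof -
  obtain n C where C: "0 \<le> C" "\<And>\<alpha> m \<nu>. snd ` set \<nu> \<subseteq> hermitian_reflections D \<Longrightarrow>
     moment_norm D m (\<lambda>h. expect \<nu> (\<lambda>R. f \<alpha> R * h R)) \<le> C * moment_norm D (m + n) (expect \<nu>)"
    using assms(1) unfolding controlled_def by blast
  obtain n' C' where C': "0 \<le> C'" "\<And>\<alpha> m \<nu>. snd ` set \<nu> \<subseteq> hermitian_reflections D \<Longrightarrow>
     moment_norm D m (\<lambda>h. expect \<nu> (\<lambda>R. g \<alpha> R * h R)) \<le> C' * moment_norm D (m + n') (expect \<nu>)"
    using assms(2) unfolding controlled_def by blast
  have "moment_norm D m (\<lambda>h. expect \<nu> (\<lambda>R. (f \<alpha> R * g \<alpha> R) * h R))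
     \<le> (C * C') * moment_norm D (m + (n + n')) (expect \<nu>)"
    if S: "snd ` set \<nu> \<subseteq> hermitian_reflections D" for \<alpha> m \<nu>
  proof -
    define \<nu>' where "\<nu>' = map (\<lambda>(a,R). (a * g \<alpha> R, R)) \<nu>"
    have e: "expect \<nu>' = (\<lambda>h. expect \<nu> (\<lambda>R. g \<alpha> R * h R))"
      by (rule ext) (simp add: \<nu>'_def expect_weight)
    have "moment_norm D m (\<lambda>h. expect \<nu>' (\<lambda>R. f \<alpha> R * h R)) \<le> C * moment_norm D (m + n) (expect \<nu>')"
      by (rule C(2)) (use S in \<open>force simp: \<nu>'_def\<close>)
    also have "\<dots> \<le> C * (C' * moment_norm D (m + n + n') (expect \<nu>))"
      unfolding e by (intro mult_left_mono C'(2) S C(1))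
    finally show ?thesis unfolding e by (simp add: mult_ac add.assoc)
  qed
  thus ?thesis unfolding controlled_def using C(1) C'(1)
    by (intro exI[of _ "n + n'"] exI[of _ "C * C'"]) auto
qed

lemma controlled_entry:
  assumes "i < D" "j < D"
  shows "controlled D (\<lambda>\<alpha> R. R $$ (i,j))"
  unfolding controlled_def
  by (intro exI[of _ "Suc 0"] exI[of _ 1])
     (use moment_norm_entry[OF assms, of _ "expect _"] in simp)

text \<open>Conjugating the weights, multiplying by \<open>f\<close> and conjugating back amounts to
  multiplying by the conjugate of \<open>f\<close>. Both conjugations preserve the norm because
  Frobenius products of reflections are real.\<close>

lemma controlled_cnj:
  assumes "controlled D f"
  shows "controlled D (\<lambda>\<alpha> R. cnj (f \<alpha> R))"
proof -
  obtain n C where C: "0 \<le> C" "\<And>\<alpha> m \<nu>. snd ` set \<nu> \<subseteq> hermitian_reflections D \<Longrightarrow>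
     moment_norm D m (\<lambda>h. expect \<nu> (\<lambda>R. f \<alpha> R * h R)) \<le> C * moment_norm D (m + n) (expect \<nu>)"
    using assms(1) unfolding controlled_def by blast
  have "moment_norm D m (\<lambda>h. expect \<nu> (\<lambda>R. cnj (f \<alpha> R) * h R)) \<le> C * moment_norm D (m + n) (expect \<nu>)"
    if S: "snd ` set \<nu> \<subseteq> hermitian_reflections D" for \<alpha> m \<nu>
  proof -
    define \<nu>' where "\<nu>' = map (\<lambda>(a,R). (cnj a, R)) \<nu>"
    define \<nu>'' where "\<nu>'' = map (\<lambda>(a,R). (a * f \<alpha> R, R)) \<nu>'"
    have S': "snd ` set \<nu>' \<subseteq> hermitian_reflections D" "snd ` set \<nu>'' \<subseteq> hermitian_reflections D"
      using S by (force simp: \<nu>'_def \<nu>''_def)+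
    have e': "expect \<nu>' h = cnj (expect \<nu> (\<lambda>R. cnj (h R)))" for h
      unfolding \<nu>'_def by (induct \<nu>) auto
    have e'': "expect \<nu>'' h = expect \<nu>' (\<lambda>R. f \<alpha> R * h R)" for h
      by (simp add: \<nu>''_def expect_weight)
    have "moment_norm D m (\<lambda>h. expect \<nu> (\<lambda>R. cnj (f \<alpha> R) * h R)) = moment_norm D m (\<lambda>h. cnj (expect \<nu>'' (\<lambda>R. cnj (h R))))"
      by (simp add: e' e'')
    also have "\<dots> = moment_norm D m (\<lambda>h. expect \<nu>' (\<lambda>R. f \<alpha> R * h R))"
      by (subst moment_norm_cnj[OF S'(2)]) (auto intro: frob_real simp: e''[abs_def])
    also have "\<dots> \<le> C * moment_norm D (m + n) (expect \<nu>')" by (rule C(2)[OF S'(1)])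
    also have "expect \<nu>' = (\<lambda>h. cnj (expect \<nu> (\<lambda>R. cnj (h R))))" by (rule ext) (rule e')
    also have "moment_norm D (m + n) \<dots> = moment_norm D (m + n) (expect \<nu>)"
      by (rule moment_norm_cnj[OF S]) (auto intro: frob_real)
    finally show ?thesis .
  qed
  thus ?thesis unfolding controlled_def using C(1) by blast
qed

text \<open>Such a unitary agrees with exp(t X) up to O(t^2), which is all that a first derivative
  sees. A quadratic polynomial in X keeps unitarity an algebraic question.\<close>

definition near_exp :: "nat \<Rightarrow> complex mat \<Rightarrow> real \<Rightarrow> complex mat \<Rightarrow> bool" where
  "near_exp D X t u \<longleftrightarrow> unitary_mat D u \<and> (\<exists>(s :: real) (k :: real). \<bar>s - t\<bar> \<le> t\<^sup>2 \<and> \<bar>k\<bar> \<le> t\<^sup>2 \<and>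
     (\<forall>i<D. \<forall>j<D. u $$ (i,j) = (if i = j then 1 else 0) + s * X $$ (i,j) + k * (X * X) $$ (i,j)))"

text \<open>\<open>f'\<close> is the derivative of \<open>f\<close> along the conjugation action in direction \<open>X\<close>; all estimates are
  uniform in the parameter \<open>\<alpha>\<close>, so that one distribution serves the whole path.\<close>
definition jet :: "nat \<Rightarrow> complex mat \<Rightarrow> (real \<Rightarrow> complex mat \<Rightarrow> complex) \<Rightarrow> (real \<Rightarrow> complex mat \<Rightarrow> complex) \<Rightarrow> bool" where
  "jet D X f f' \<longleftrightarrow> controlled D f \<and>
     (\<exists>C. \<forall>\<alpha>. \<forall>R\<in>hermitian_reflections D. cmod (f \<alpha> R) \<le> C \<and> cmod (f' \<alpha> R) \<le> C) \<and>
     (\<exists>C. \<forall>\<alpha> t u. 0 < t \<and> t \<le> 1 \<and> near_exp D X t u \<longrightarrow> (\<forall>R\<in>hermitian_reflections D.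
        cmod (f \<alpha> (conj_by u R) - f \<alpha> R - t * f' \<alpha> R) \<le> C * t\<^sup>2))"

lemma jet_const:
  assumes "\<And>\<alpha>. cmod (c \<alpha>) \<le> B"
  shows "jet D X (\<lambda>\<alpha> R. c \<alpha>) (\<lambda>\<alpha> R. 0)"
  unfolding jet_def
  by (intro conjI controlled_const exI[of _ B] exI[of _ 0]) (use assms order_trans[OF norm_ge_zero assms] in auto)

lemma jet_add:
  assumes "jet D X f f'" "jet D X g g'"
  shows "jet D X (\<lambda>\<alpha> R. f \<alpha> R + g \<alpha> R) (\<lambda>\<alpha> R. f' \<alpha> R + g' \<alpha> R)"
proof -
  obtain C1 where 1: "\<And>\<alpha> R. R \<in> hermitian_reflections D \<Longrightarrow> cmod (f \<alpha> R) \<le> C1 \<and> cmod (f' \<alpha> R) \<le> C1"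
    using assms(1) unfolding jet_def by blast
  obtain C2 where 2: "\<And>\<alpha> R. R \<in> hermitian_reflections D \<Longrightarrow> cmod (g \<alpha> R) \<le> C2 \<and> cmod (g' \<alpha> R) \<le> C2"
    using assms(2) unfolding jet_def by blast
  obtain C3 where 3: "\<And>\<alpha> t u R. 0 < t \<Longrightarrow> t \<le> 1 \<Longrightarrow> near_exp D X t u \<Longrightarrow> R \<in> hermitian_reflections D \<Longrightarrow>
      cmod (f \<alpha> (conj_by u R) - f \<alpha> R - t * f' \<alpha> R) \<le> C3 * t\<^sup>2"
    using assms(1) unfolding jet_def by blast
  obtain C4 where 4: "\<And>\<alpha> t u R. 0 < t \<Longrightarrow> t \<le> 1 \<Longrightarrow> near_exp D X t u \<Longrightarrow> R \<in> hermitian_reflections D \<Longrightarrow>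
      cmod (g \<alpha> (conj_by u R) - g \<alpha> R - t * g' \<alpha> R) \<le> C4 * t\<^sup>2"
    using assms(2) unfolding jet_def by blast
  show ?thesis unfolding jet_def
  proof (rule conjI[OF controlled_add conjI[OF exI[of _ "C1 + C2"] exI[of _ "C3 + C4"]]]; (intro allI ballI impI conjI)?)
    fix \<alpha> R assume "R \<in> hermitian_reflections D"
    thus "cmod (f \<alpha> R + g \<alpha> R) \<le> C1 + C2" "cmod (f' \<alpha> R + g' \<alpha> R) \<le> C1 + C2"
      using 1[of R \<alpha>] 2[of R \<alpha>] by (auto intro!: norm_triangle_mono)
  next
    fix \<alpha> t u R assume "0 < t \<and> t \<le> 1 \<and> near_exp D X t u" "R \<in> hermitian_reflections D"
    hence "cmod ((f \<alpha> (conj_by u R) - f \<alpha> R - t * f' \<alpha> R) + (g \<alpha> (conj_by u R) - g \<alpha> R - t * g' \<alpha> R)) \<le> C3 * t\<^sup>2 + C4 * t\<^sup>2"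
      by (intro norm_triangle_mono 3 4) auto
    thus "cmod (f \<alpha> (conj_by u R) + g \<alpha> (conj_by u R) - (f \<alpha> R + g \<alpha> R) - t * (f' \<alpha> R + g' \<alpha> R)) \<le> (C3 + C4) * t\<^sup>2"
      by (simp add: algebra_simps)
  qed (use assms in \<open>auto simp: jet_def\<close>)
qed

lemma jet_mult:
  assumes "jet D X f f'" "jet D X g g'"
  shows "jet D X (\<lambda>\<alpha> R. f \<alpha> R * g \<alpha> R) (\<lambda>\<alpha> R. f' \<alpha> R * g \<alpha> R + f \<alpha> R * g' \<alpha> R)"
proof -
  obtain C1' where 1: "\<And>\<alpha> R. R \<in> hermitian_reflections D \<Longrightarrow> cmod (f \<alpha> R) \<le> C1' \<and> cmod (f' \<alpha> R) \<le> C1'"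
    using assms(1) unfolding jet_def by blast
  obtain C2' where 2: "\<And>\<alpha> R. R \<in> hermitian_reflections D \<Longrightarrow> cmod (g \<alpha> R) \<le> C2' \<and> cmod (g' \<alpha> R) \<le> C2'"
    using assms(2) unfolding jet_def by blast
  \<comment> \<open>The bounds may be negative when there are no reflections at all, as for odd
    \<open>D\<close>; absolute values make them usable as factors.\<close>
  define C1 C2 where "C1 = \<bar>C1'\<bar>" and "C2 = \<bar>C2'\<bar>"
  have 1: "\<And>\<alpha> R. R \<in> hermitian_reflections D \<Longrightarrow> cmod (f \<alpha> R) \<le> C1 \<and> cmod (f' \<alpha> R) \<le> C1"
    using 1 unfolding C1_def by (meson abs_ge_self order_trans)
  have 2: "\<And>\<alpha> R. R \<in> hermitian_reflections D \<Longrightarrow> cmod (g \<alpha> R) \<le> C2 \<and> cmod (g' \<alpha> R) \<le> C2"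
    using 2 unfolding C2_def by (meson abs_ge_self order_trans)
  have nn: "0 \<le> C1" "0 \<le> C2" by (auto simp: C1_def C2_def)
  obtain C3 where 3: "\<And>\<alpha> t u R. 0 < t \<Longrightarrow> t \<le> 1 \<Longrightarrow> near_exp D X t u \<Longrightarrow> R \<in> hermitian_reflections D \<Longrightarrow>
      cmod (f \<alpha> (conj_by u R) - f \<alpha> R - t * f' \<alpha> R) \<le> C3 * t\<^sup>2"
    using assms(1) unfolding jet_def by blast
  obtain C4 where 4: "\<And>\<alpha> t u R. 0 < t \<Longrightarrow> t \<le> 1 \<Longrightarrow> near_exp D X t u \<Longrightarrow> R \<in> hermitian_reflections D \<Longrightarrow>
      cmod (g \<alpha> (conj_by u R) - g \<alpha> R - t * g' \<alpha> R) \<le> C4 * t\<^sup>2"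
    using assms(2) unfolding jet_def by blast
  show ?thesis unfolding jet_def
  proof (rule conjI[OF controlled_mult conjI[OF exI[of _ "2 * (C1 * C2)"] exI[of _ "C3 * C2 + 2 * (C1 * C4) + C1 * C2"]]];
      (intro allI ballI impI conjI)?)
    fix \<alpha> R assume R: "R \<in> hermitian_reflections D"
    have "cmod (f \<alpha> R * g \<alpha> R) \<le> C1 * C2" "cmod (f' \<alpha> R * g \<alpha> R) \<le> C1 * C2" "cmod (f \<alpha> R * g' \<alpha> R) \<le> C1 * C2"
      unfolding norm_mult using 1[OF R, of \<alpha>] 2[OF R, of \<alpha>] nn by (auto intro!: mult_mono)
    moreover have "0 \<le> C1 * C2" using nn by simp
    ultimately show "cmod (f \<alpha> R * g \<alpha> R) \<le> 2 * (C1 * C2)" "cmod (f' \<alpha> R * g \<alpha> R + f \<alpha> R * g' \<alpha> R) \<le> 2 * (C1 * C2)"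
      using norm_triangle_ineq[of "f' \<alpha> R * g \<alpha> R" "f \<alpha> R * g' \<alpha> R"] by linarith+
  next
    fix \<alpha> t u R assume t: "0 < t \<and> t \<le> 1 \<and> near_exp D X t u" and R: "R \<in> hermitian_reflections D"
    define a where "a = f \<alpha> (conj_by u R) - f \<alpha> R - t * f' \<alpha> R"
    define b where "b = g \<alpha> (conj_by u R) - g \<alpha> R - t * g' \<alpha> R"
    have R': "conj_by u R \<in> hermitian_reflections D"
      using t R by (auto simp: near_exp_def intro: conj_by_hermitian_reflections)
    have a: "cmod a \<le> C3 * t\<^sup>2" and b: "cmod b \<le> C4 * t\<^sup>2" using 3 4 t R by (auto simp: a_def b_def)
    have nn3: "0 \<le> C3 * t\<^sup>2" "0 \<le> C4 * t\<^sup>2" using a b norm_ge_zero order_trans by blast+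
    have "cmod (complex_of_real t * f' \<alpha> R) \<le> 1 * C1"
      unfolding norm_mult using t 1[OF R, of \<alpha>] by (intro mult_mono) auto
    hence c: "cmod (f \<alpha> R + t * f' \<alpha> R) \<le> 2 * C1"
      using 1[OF R, of \<alpha>] norm_triangle_ineq[of "f \<alpha> R" "t * f' \<alpha> R"] by auto
    \<comment> \<open>The error consists of the two remainders and the product of the two
      first-order terms. The factor \<open>g\<close> at the conjugated point is bounded because
      conjugation stays among the reflections.\<close>
    have "f \<alpha> (conj_by u R) * g \<alpha> (conj_by u R) - f \<alpha> R * g \<alpha> R - t * (f' \<alpha> R * g \<alpha> R + f \<alpha> R * g' \<alpha> R)
       = a * g \<alpha> (conj_by u R) + (f \<alpha> R + t * f' \<alpha> R) * b + complex_of_real (t\<^sup>2) * (f' \<alpha> R * g' \<alpha> R)"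
      by (simp add: a_def b_def algebra_simps power2_eq_square)
    also have "cmod \<dots> \<le> C3 * t\<^sup>2 * C2 + 2 * C1 * (C4 * t\<^sup>2) + t\<^sup>2 * (C1 * C2)"
      unfolding norm_mult
      by (intro norm_triangle_mono order_trans[OF eq_refl[OF norm_mult]] mult_mono a b c)
         (use nn nn3 1[OF R, of \<alpha>] 2[OF R, of \<alpha>] 2[OF R', of \<alpha>] in \<open>auto simp: norm_mult norm_power intro!: mult_mono\<close>)
    finally show "cmod (f \<alpha> (conj_by u R) * g \<alpha> (conj_by u R) - f \<alpha> R * g \<alpha> R - t * (f' \<alpha> R * g \<alpha> R + f \<alpha> R * g' \<alpha> R))
       \<le> (C3 * C2 + 2 * (C1 * C4) + C1 * C2) * t\<^sup>2"
      by (simp add: algebra_simps)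
  qed (use assms in \<open>auto simp: jet_def\<close>)
qed

lemma jet_cnj:
  assumes "jet D X f f'"
  shows "jet D X (\<lambda>\<alpha> R. cnj (f \<alpha> R)) (\<lambda>\<alpha> R. cnj (f' \<alpha> R))"
proof -
  have *: "cmod (cnj a - cnj b - complex_of_real t * cnj c) = cmod (a - b - t * c)" for a b c t
    using complex_mod_cnj[of "a - b - t * c"] by simp
  show ?thesis using assms unfolding jet_def * complex_mod_cnj by (auto intro: controlled_cnj)
qed

lemma jet_cmult:
  "jet D X f f' \<Longrightarrow> jet D X (\<lambda>\<alpha> R. c * f \<alpha> R) (\<lambda>\<alpha> R. c * f' \<alpha> R)"
  using jet_mult[OF jet_const[of "\<lambda>_. c" "cmod c"]] by simp

lemma jet_diff:
  "jet D X f f' \<Longrightarrow> jet D X g g' \<Longrightarrow> jet D X (\<lambda>\<alpha> R. f \<alpha> R - g \<alpha> R) (\<lambda>\<alpha> R. f' \<alpha> R - g' \<alpha> R)"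
  using jet_add[of D X f f', OF _ jet_cmult[of D X g g' "-1"]] by simp

lemma jet_sum:
  assumes "\<And>k. k \<in> K \<Longrightarrow> jet D X (f k) (f' k)"
  shows "jet D X (\<lambda>\<alpha> R. \<Sum>k\<in>K. f k \<alpha> R) (\<lambda>\<alpha> R. \<Sum>k\<in>K. f' k \<alpha> R)"
proof (cases "finite K")
  case True
  thus ?thesis using assms
    by (induct K) (use jet_const[of "\<lambda>_. 0" 0] in \<open>auto intro!: jet_add\<close>)
next
  case False
  thus ?thesis using jet_const[of "\<lambda>_. 0" 0] by simp
qed

lemma hermitian_reflections_entry_le:
  assumes R: "R \<in> hermitian_reflections D" and "i < D" "j < D"
  shows "cmod (R $$ (i,j)) \<le> 1"
proof -
  have c: "R \<in> carrier_mat D D" "R * R = 1\<^sub>m D" using R by (auto simp: hermitian_reflections_def)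
  have "(R * R) $$ (i,i) = (\<Sum>k<D. R $$ (i,k) * R $$ (k,i))"
    using c(1) assms by (auto simp: index_mult_mat_sum simp del: index_mult_mat(1))
  also have "\<dots> = (\<Sum>k<D. R $$ (i,k) * cnj (R $$ (i,k)))"
    using assms by (intro sum.cong) (auto simp: hermitian_reflections_cnj)
  also have "\<dots> = of_real (\<Sum>k<D. (cmod (R $$ (i,k)))\<^sup>2)" by (simp only: complex_norm_square of_real_sum)
  finally have "(\<Sum>k<D. (cmod (R $$ (i,k)))\<^sup>2) = 1"
    unfolding c(2) using assms by (metis index_one_mat(1) of_real_eq_1_iff)
  moreover have "(cmod (R $$ (i,j)))\<^sup>2 \<le> (\<Sum>k<D. (cmod (R $$ (i,k)))\<^sup>2)"
    using assms by (intro member_le_sum) auto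
  ultimately have "(cmod (R $$ (i,j)))\<^sup>2 \<le> 1" by simp
  thus ?thesis by (simp add: abs_square_le_1)
qed

text \<open>\<open>u\<close> and \<open>v\<close> are an entry of the unitary and a conjugated one,
  \<open>d\<close> and \<open>d'\<close> the Kronecker deltas they deviate from. The errors in the
  coefficients \<open>s\<close> and \<open>k\<close> contribute 4 B; two full corrections of size at
  most 3 t B multiply to 9 B^2 t^2.\<close>

lemma near_exp_term_bound:
  fixes t s k B :: real and x y x' y' d d' u v :: complex
  assumes t: "0 < t" "t \<le> 1" "\<bar>s - t\<bar> \<le> t\<^sup>2" "\<bar>k\<bar> \<le> t\<^sup>2"
    and B: "cmod x \<le> B" "cmod y \<le> B" "cmod x' \<le> B" "cmod y' \<le> B" "cmod d \<le> 1" "cmod d' \<le> 1"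
    and uv: "u = d + s * x + k * y" "v = d' + s * x' + k * y'"
  shows "cmod (u * v - d * d' - t * (x * d' + d * x')) \<le> (4 * B + 9 * B\<^sup>2) * t\<^sup>2"
proof -
  have B0: "0 \<le> B" using B(1) norm_ge_zero order_trans by blast
  have tt: "t\<^sup>2 \<le> t" using t by (simp add: power2_eq_square mult_left_le)
  have s: "\<bar>s\<bar> \<le> 2 * t" using t tt by linarith
  have k: "\<bar>k\<bar> \<le> t" using t tt by linarith
  have e: "cmod (s * x + k * y) \<le> 3 * t * B" if "cmod x \<le> B" "cmod y \<le> B" for x y :: complex
  proof -
    have "cmod (s * x + k * y) \<le> \<bar>s\<bar> * cmod x + \<bar>k\<bar> * cmod y"
      using norm_triangle_ineq[of "s * x" "k * y"] by (simp add: norm_mult)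
    also have "\<dots> \<le> (2 * t) * B + t * B" using that s k t by (intro add_mono mult_mono) auto
    finally show ?thesis by (simp add: algebra_simps)
  qed
  have e': "cmod (complex_of_real (s - t) * x + k * y) \<le> 2 * B * t\<^sup>2" if "cmod x \<le> B" "cmod y \<le> B" for x y :: complex
  proof -
    have "cmod (complex_of_real (s - t) * x + k * y) \<le> \<bar>s - t\<bar> * cmod x + \<bar>k\<bar> * cmod y"
      using norm_triangle_ineq[of "complex_of_real (s - t) * x" "k * y"] by (simp only: norm_mult norm_of_real)
    also have "\<dots> \<le> t\<^sup>2 * B + t\<^sup>2 * B" using that t by (intro add_mono mult_mono) auto
    finally show ?thesis by (simp add: algebra_simps)
  qed
  have "u * v - d * d' - t * (x * d' + d * x') = d * (complex_of_real (s - t) * x' + k * y')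
     + (complex_of_real (s - t) * x + k * y) * d' + (s * x + k * y) * (s * x' + k * y')"
    by (simp add: uv algebra_simps)
  also have "cmod \<dots> \<le> 1 * (2 * B * t\<^sup>2) + (2 * B * t\<^sup>2) * 1 + (3 * t * B) * (3 * t * B)"
    by (intro norm_triangle_mono order_trans[OF eq_refl[OF norm_mult]] mult_mono e e' B) (use B0 t in auto)
  finally show ?thesis by (simp add: algebra_simps power2_eq_square)
qed

text \<open>To first order conjugation adds t times a commutator: skewness of \<open>X\<close> turns
  the adjoint on the right into a multiplication by - X.\<close>

lemma jet_entry:
  assumes X: "X \<in> carrier_mat D D" "\<And>i j. i < D \<Longrightarrow> j < D \<Longrightarrow> cnj (X $$ (i,j)) = - X $$ (j,i)"
    and ij: "i < D" "j < D"
  shows "jet D X (\<lambda>\<alpha> R. R $$ (i,j)) (\<lambda>\<alpha> R. (X * R - R * X) $$ (i,j))"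
proof -
  have comm: "(X * R - R * X) $$ (i,j) = (\<Sum>a<D. X $$ (i,a) * R $$ (a,j)) + (\<Sum>b<D. R $$ (i,b) * cnj (X $$ (j,b)))"
    if "R \<in> hermitian_reflections D" for R
    using that ij X by (auto simp: hermitian_reflections_def index_mult_mat_sum sum_negf simp del: index_mult_mat(1))
  define B where "B = (\<Sum>i<D. \<Sum>j<D. cmod (X $$ (i,j)) + cmod ((X * X) $$ (i,j)))"
  have B: "cmod (X $$ (a,b)) \<le> B \<and> cmod ((X * X) $$ (a,b)) \<le> B" if "a < D" "b < D" for a b
  proof -
    have "cmod (X $$ (a,b)) + cmod ((X * X) $$ (a,b)) \<le> (\<Sum>j<D. cmod (X $$ (a,j)) + cmod ((X * X) $$ (a,j)))"
      using that by (intro member_le_sum[of b "{..<D}" "\<lambda>b. cmod (X $$ (a,b)) + cmod ((X * X) $$ (a,b))"]) auto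
    also have "\<dots> \<le> B" unfolding B_def
      using that by (intro member_le_sum[of a "{..<D}" "\<lambda>a. \<Sum>j<D. cmod (X $$ (a,j)) + cmod ((X * X) $$ (a,j))"])
        (auto intro!: sum_nonneg add_nonneg_nonneg simp del: sum.distrib)
    finally show ?thesis using norm_ge_zero[of "X $$ (a,b)"] norm_ge_zero[of "(X * X) $$ (a,b)"] by linarith
  qed
  have B0: "0 \<le> B" unfolding B_def by (intro sum_nonneg) auto
  show ?thesis unfolding jet_def
  proof (rule conjI[OF controlled_entry[OF ij] conjI[OF exI[of _ "1 + 2 * (real D * B)"] exI[of _ "real D * (real D * (4 * B + 9 * B\<^sup>2))"]]];
      (intro allI ballI impI conjI)?)
    fix \<alpha> :: real and R assume R: "R \<in> hermitian_reflections D"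
    have "cmod (\<Sum>a<D. X $$ (i,a) * R $$ (a,j)) \<le> real (card {..<D}) * (B * 1)"
      by (intro sum_norm_bound order_trans[OF eq_refl[OF norm_mult]] mult_mono)
        (use B B0 ij hermitian_reflections_entry_le[OF R] in auto)
    moreover have "cmod (\<Sum>b<D. R $$ (i,b) * cnj (X $$ (j,b))) \<le> real (card {..<D}) * (1 * B)"
      by (intro sum_norm_bound order_trans[OF eq_refl[OF norm_mult]] mult_mono)
        (use B B0 ij hermitian_reflections_entry_le[OF R] in auto)
    ultimately show "cmod ((X * R - R * X) $$ (i,j)) \<le> 1 + 2 * (real D * B)"
      unfolding comm[OF R] using norm_triangle_ineq[of "\<Sum>a<D. X $$ (i,a) * R $$ (a,j)"] 
      by (intro order_trans[OF norm_triangle_ineq]) simp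
    show "cmod (R $$ (i,j)) \<le> 1 + 2 * (real D * B)"
      using hermitian_reflections_entry_le[OF R ij] B0 by (simp add: add_increasing2)
  next
    fix \<alpha> t :: real and u R assume t: "0 < t \<and> t \<le> 1 \<and> near_exp D X t u" and R: "R \<in> hermitian_reflections D"
    then obtain s k where sk: "\<bar>s - t\<bar> \<le> t\<^sup>2" "\<bar>k\<bar> \<le> t\<^sup>2" and u: "unitary_mat D u"
      "\<And>i j. i < D \<Longrightarrow> j < D \<Longrightarrow> u $$ (i,j) = (if i = j then 1 else 0) + complex_of_real s * X $$ (i,j) + complex_of_real k * (X * X) $$ (i,j)"
      unfolding near_exp_def by blast
    have c: "u \<in> carrier_mat D D" "R \<in> carrier_mat D D" using u R by (auto simp: unitary_mat_def hermitian_reflections_def)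
    let ?\<delta> = "\<lambda>i j. if i = j then 1 else (0::complex)"
    have "R $$ (i,j) = (\<Sum>a<D. \<Sum>b<D. R $$ (a,b) * (?\<delta> i a * ?\<delta> j b))"
      using ij by (simp add: if_distrib[of "\<lambda>x. _ * x"] if_distrib[of "\<lambda>x. x * _"] cong: if_cong)
    moreover have "(X * R - R * X) $$ (i,j) = (\<Sum>a<D. \<Sum>b<D. R $$ (a,b) * (X $$ (i,a) * ?\<delta> j b + ?\<delta> i a * cnj (X $$ (j,b))))"
    proof -
      have "(\<Sum>a<D. \<Sum>b<D. R $$ (a,b) * (X $$ (i,a) * ?\<delta> j b)) = (\<Sum>a<D. X $$ (i,a) * R $$ (a,j))"
        using ij by (simp add: if_distrib[of "\<lambda>x. _ * x"] mult.commute cong: if_cong)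
      moreover have "(\<Sum>a<D. \<Sum>b<D. R $$ (a,b) * (?\<delta> i a * cnj (X $$ (j,b)))) = (\<Sum>b<D. R $$ (i,b) * cnj (X $$ (j,b)))"
        using ij by (subst sum.swap) (simp add: if_distrib[of "\<lambda>x. _ * x"] if_distrib[of "\<lambda>x. x * _"] cong: if_cong)
      ultimately show ?thesis unfolding comm[OF R] distrib_left sum.distrib by simp
    qed
    moreover have "conj_by u R $$ (i,j) = (\<Sum>a<D. \<Sum>b<D. R $$ (a,b) * (u $$ (i,a) * cnj (u $$ (j,b))))"
      using c ij by (simp add: conj_by_index mult_ac)
    ultimately have "conj_by u R $$ (i,j) - R $$ (i,j) - t * (X * R - R * X) $$ (i,j) =
      (\<Sum>a<D. \<Sum>b<D. R $$ (a,b) * (u $$ (i,a) * cnj (u $$ (j,b)) - ?\<delta> i a * ?\<delta> j b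
         - t * (X $$ (i,a) * ?\<delta> j b + ?\<delta> i a * cnj (X $$ (j,b)))))"
      by (simp add: sum_subtractf sum_distrib_left algebra_simps)
    also have "cmod \<dots> \<le> real (card {..<D}) * (real (card {..<D}) * (1 * ((4 * B + 9 * B\<^sup>2) * t\<^sup>2)))"
    proof (intro sum_norm_bound order_trans[OF eq_refl[OF norm_mult]] mult_mono)
      fix a b assume ab: "a \<in> {..<D}" "b \<in> {..<D}"
      show "cmod (u $$ (i,a) * cnj (u $$ (j,b)) - ?\<delta> i a * ?\<delta> j b
         - t * (X $$ (i,a) * ?\<delta> j b + ?\<delta> i a * cnj (X $$ (j,b)))) \<le> (4 * B + 9 * B\<^sup>2) * t\<^sup>2"
        by (rule near_exp_term_bound[where s = s and k = k and y = "(X * X) $$ (i,a)" and y' = "cnj ((X * X) $$ (j,b))"])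
           (use t sk B[of i a] B[of j b] ab ij u(2) in auto)
    qed (use hermitian_reflections_entry_le[OF R] in auto)
    finally show "cmod (conj_by u R $$ (i,j) - R $$ (i,j) - t * (X * R - R * X) $$ (i,j))
       \<le> real D * (real D * (4 * B + 9 * B\<^sup>2)) * t\<^sup>2" by (simp add: mult_ac)
  qed
qed

text \<open>This is integration by parts. The increment of \<open>f\<close> under a step
  \<open>t\<close> has small mean by near-invariance, and differs from t f' by O(t^2). The step is
  fixed before \<open>j\<close> grows. As the norm minimised at index \<open>j\<close> has order
  \<open>j\<close>, it eventually covers whatever number of orders \<open>f\<close> costs.\<close>

lemma expect_derivative_vanishes:
  assumes \<mu>: "min_seq D \<mu>" and X: "\<And>t. 0 < t \<Longrightarrow> t \<le> 1 \<Longrightarrow> \<exists>u. near_exp D X t u"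
    and f: "jet D X f f'" and \<eta>: "0 < \<eta>"
  shows "\<exists>N. \<forall>j\<ge>N. \<forall>\<alpha>. cmod (expect (\<mu> j) (f' \<alpha>)) \<le> \<eta>"
proof -
  let ?S = "hermitian_reflections D"
  obtain C' where C': "\<And>\<alpha> t u R. 0 < t \<Longrightarrow> t \<le> 1 \<Longrightarrow> near_exp D X t u \<Longrightarrow> R \<in> ?S \<Longrightarrow>
      cmod (f \<alpha> (conj_by u R) - f \<alpha> R - t * f' \<alpha> R) \<le> C' * t\<^sup>2"
    using f unfolding jet_def by blast
  define C where "C = \<bar>C'\<bar>"
  have C: "cmod (f \<alpha> (conj_by u R) - f \<alpha> R - t * f' \<alpha> R) \<le> C * t\<^sup>2"
    if "0 < t" "t \<le> 1" "near_exp D X t u" "R \<in> ?S" for \<alpha> t u R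
    using C'[OF that, of \<alpha>] mult_right_mono[OF abs_ge_self[of C'], of "t\<^sup>2"] by (simp add: C_def)
  obtain n A where A: "0 \<le> A" "\<And>\<alpha> m \<nu>. snd ` set \<nu> \<subseteq> ?S \<Longrightarrow>
     moment_norm D m (\<lambda>g. expect \<nu> (\<lambda>R. f \<alpha> R * g R)) \<le> A * moment_norm D (m + n) (expect \<nu>)"
    using f unfolding jet_def controlled_def by blast
  \<comment> \<open>Half of the budget \<open>\<eta>\<close> pays for the remainder C t; the other
    half is left for the defect of invariance, which \<open>N0\<close> makes small.\<close>
  define t where "t = min 1 (\<eta> / (2 * (C + 1)))"
  have C0: "0 \<le> C" by (simp add: C_def)
  have t: "0 < t" "t \<le> 1" using \<eta> C0 by (auto simp: t_def)
  have "C * t \<le> (C + 1) * (\<eta> / (2 * (C + 1)))"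
    using C0 \<eta> t by (intro mult_mono) (auto simp: t_def)
  also have "(C + 1) * (\<eta> / (2 * (C + 1))) = \<eta> / 2" using C0 by (simp add: divide_simps)
  finally have Ct: "C * t \<le> \<eta> / 2" .
  obtain u where u: "near_exp D X t u" using X t by blast
  hence uu: "unitary_mat D u" by (auto simp: near_exp_def)
  obtain N0 where N0: "A * 4 / (t * \<eta> / 2)\<^sup>2 < real N0" using reals_Archimedean2 by blast
  have "cmod (expect (\<mu> j) (f' \<alpha>)) \<le> \<eta>" if j: "j \<ge> max n N0" for j \<alpha>
  proof -
    let ?L = "\<lambda>h. expect (\<mu> j) h - expect (\<mu> j) (\<lambda>R. h (conj_by u R))"
    have p: "prob_list ?S (\<mu> j)" using \<mu> by (auto simp: min_seq_def)
    \<comment> \<open>The defect of invariance is itself a weighted list, with negative weights, so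
      the \<open>controlled\<close> bound applies to it.\<close>
    define \<nu> where "\<nu> = \<mu> j @ map (\<lambda>(a,R). ((-1) * a, R)) (map (\<lambda>(a,R). (a, conj_by u R)) (\<mu> j))"
    have e: "expect \<nu> = ?L"
      by (rule ext) (simp only: \<nu>_def expect_append expect_scale expect_push, simp)
    have S: "snd ` set \<nu> \<subseteq> ?S"
      using prob_list_subset[OF p] conj_by_hermitian_reflections[OF uu] by (force simp: \<nu>_def)
    have "(cmod (?L (f \<alpha>)))\<^sup>2 = moment_norm D 0 (\<lambda>g. expect \<nu> (\<lambda>R. f \<alpha> R * g R))" by (simp add: e)
    also have "\<dots> \<le> A * moment_norm D (0 + n) (expect \<nu>)" by (rule A(2)[OF S])
    also have "\<dots> \<le> A * moment_norm D j (expect \<nu>)" using A(1) j by (intro mult_left_mono moment_norm_mono) auto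
    also have "\<dots> \<le> A * (4 / real (Suc j))"
      unfolding e by (intro mult_left_mono min_seq_almost_invariant \<mu> uu A(1))
    also have "\<dots> \<le> (t * \<eta> / 2)\<^sup>2"
    proof -
      have "A * 4 / (t * \<eta> / 2)\<^sup>2 \<le> real (Suc j)" using N0 j by linarith
      thus ?thesis using t \<eta> by (simp add: field_simps)
    qed
    finally have L: "cmod (?L (f \<alpha>)) \<le> t * \<eta> / 2"
      using t \<eta> by (auto intro: power2_le_imp_le)
    have "cmod (expect (\<mu> j) (\<lambda>R. f \<alpha> (conj_by u R) - f \<alpha> R - t * f' \<alpha> R)) \<le> C * t\<^sup>2"
      by (rule expect_bound[OF p]) (rule C[OF t u])
    hence "cmod (- ?L (f \<alpha>) - t * expect (\<mu> j) (f' \<alpha>)) \<le> C * t\<^sup>2"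
      by (simp add: expect_diff expect_cmult)
    hence "cmod (t * expect (\<mu> j) (f' \<alpha>)) \<le> C * t\<^sup>2 + cmod (?L (f \<alpha>))"
      using norm_triangle_ineq4[of "- ?L (f \<alpha>)" "- ?L (f \<alpha>) - t * expect (\<mu> j) (f' \<alpha>)"]
      by (simp only: norm_minus_cancel diff_diff_eq2 add_diff_cancel_left' diff_minus_eq_add) (simp add: add.commute)
    also have "\<dots> \<le> t * \<eta>"
    proof -
      have "C * t\<^sup>2 = t * (C * t)" by (simp add: power2_eq_square)
      also have "\<dots> \<le> t * (\<eta> / 2)" using Ct t by (intro mult_left_mono) auto
      finally show ?thesis using L by simp
    qed
    finally show ?thesis using t by (simp add: norm_mult)
  qed
  thus ?thesis by blast
qed

section \<open>States, reflections and the pairing\<close>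

text \<open>In an index (j, x) the second part runs over the oracle register and the first over
  everything else, control qubit included. Only finitely many indices matter; values outside the
  range are left arbitrary.\<close>

type_synonym state = "nat \<times> nat \<Rightarrow> complex"

definition inner :: "nat \<Rightarrow> nat \<Rightarrow> state \<Rightarrow> state \<Rightarrow> complex" where
  "inner B n u v = (\<Sum>q\<in>{..<B} \<times> {..<n}. cnj (u q) * v q)"

definition block_inner :: "nat \<Rightarrow> (nat \<Rightarrow> complex) \<Rightarrow> (nat \<Rightarrow> complex) \<Rightarrow> complex" where
  "block_inner B g h = (\<Sum>j<B. cnj (g j) * h j)"

definition bra :: "nat \<Rightarrow> nat set \<Rightarrow> (nat \<Rightarrow> complex) \<Rightarrow> state \<Rightarrow> nat \<Rightarrow> complex" where
  "bra n S h u j = (if j \<in> S then \<Sum>x<n. cnj (h x) * u (j,x) else 0)"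

text \<open>This is 2 h h^dagger - 1 on the blocks in \<open>S\<close> and the identity on the
  others, where \<open>bra\<close> is zero.\<close>

definition refl_op :: "nat \<Rightarrow> nat set \<Rightarrow> (nat \<Rightarrow> complex) \<Rightarrow> state \<Rightarrow> state" where
  "refl_op n S h u q = (if fst q \<in> S then - u q else u q) + 2 * (h (snd q) * bra n S h u (fst q))"

text \<open>The derivative of 2 h h^dagger - 1 as h moves in direction k.\<close>

definition refl_deriv :: "nat \<Rightarrow> nat set \<Rightarrow> (nat \<Rightarrow> complex) \<Rightarrow> (nat \<Rightarrow> complex) \<Rightarrow> state \<Rightarrow> state" where
  "refl_deriv n S h k u q = 2 * (k (snd q) * bra n S h u (fst q) + h (snd q) * bra n S k u (fst q))"

definition apply_kernel :: "nat \<Rightarrow> nat \<Rightarrow> (nat \<times> nat \<Rightarrow> nat \<times> nat \<Rightarrow> complex) \<Rightarrow> state \<Rightarrow> state" where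
  "apply_kernel B n A u q = (\<Sum>r\<in>{..<B} \<times> {..<n}. A q r * u r)"

definition adj_kernel :: "(nat \<times> nat \<Rightarrow> nat \<times> nat \<Rightarrow> complex) \<Rightarrow> nat \<times> nat \<Rightarrow> nat \<times> nat \<Rightarrow> complex" where
  "adj_kernel A q r = cnj (A r q)"

definition isometry_kernel :: "nat \<Rightarrow> nat \<Rightarrow> (nat \<times> nat \<Rightarrow> nat \<times> nat \<Rightarrow> complex) \<Rightarrow> bool" where
  "isometry_kernel B n A \<longleftrightarrow> (\<forall>r\<in>{..<B} \<times> {..<n}. \<forall>r'\<in>{..<B} \<times> {..<n}.
     (\<Sum>q\<in>{..<B} \<times> {..<n}. cnj (A q r) * A q r') = (if r = r' then 1 else 0))"

lemma inner_add_right: "inner B n u (\<lambda>q. v q + w q) = inner B n u v + inner B n u w"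
  and inner_add_left: "inner B n (\<lambda>q. v q + w q) u = inner B n v u + inner B n w u"
  and inner_cmult_right: "inner B n u (\<lambda>q. c * v q) = c * inner B n u v"
  and inner_cmult_left: "inner B n (\<lambda>q. c * v q) u = cnj c * inner B n v u"
  by (auto simp: inner_def algebra_simps sum.distrib sum_distrib_left)

lemma inner_cnj: "cnj (inner B n u v) = inner B n v u"
  by (simp add: inner_def mult.commute)

lemma block_inner_cnj: "cnj (block_inner B u v) = block_inner B v u"
  by (simp add: block_inner_def mult.commute)

lemma block_inner_linear:
  "block_inner B (\<lambda>j. c * g j) h = cnj c * block_inner B g h"
  "block_inner B h (\<lambda>j. c * g j) = c * block_inner B h g"
  "block_inner B (\<lambda>j. \<Sum>k\<in>K. g' k j) h = (\<Sum>k\<in>K. block_inner B (g' k) h)"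
  "block_inner B h (\<lambda>j. \<Sum>k\<in>K. g' k j) = (\<Sum>k\<in>K. block_inner B h (g' k))"
  by (simp_all add: block_inner_def sum_distrib_left sum_distrib_right cnj_sum mult_ac sum.swap[where A = "{..<B}" and B = K])

lemma inner_ket: "inner B n u (\<lambda>q. h (snd q) * bra n S h' v (fst q)) = block_inner B (bra n S h u) (bra n S h' v)"
proof -
  have "inner B n u (\<lambda>q. h (snd q) * bra n S h' v (fst q)) = (\<Sum>j<B. \<Sum>x<n. cnj (u (j,x)) * (h x * bra n S h' v j))"
    by (simp add: inner_def sum.cartesian_product case_prod_beta)
  also have "\<dots> = (\<Sum>j<B. cnj (bra n S h u j) * bra n S h' v j)"
  proof (intro sum.cong refl)
    fix j
    have "(\<Sum>x<n. cnj (u (j,x)) * (h x * c)) = cnj (\<Sum>x<n. cnj (h x) * u (j,x)) * c" for c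
      by (simp add: sum_distrib_left sum_distrib_right mult_ac)
    thus "(\<Sum>x<n. cnj (u (j,x)) * (h x * bra n S h' v j)) = cnj (bra n S h u j) * bra n S h' v j"
      by (cases "j \<in> S") (auto simp: bra_def[of n S h u j] bra_def[of n S h' v j])
  qed
  finally show ?thesis by (simp add: block_inner_def)
qed

lemma inner_ket_left: "inner B n (\<lambda>q. h (snd q) * bra n S h' v (fst q)) u = block_inner B (bra n S h' v) (bra n S h u)"
  using arg_cong[OF inner_ket[of B n u h S h' v], of cnj] by (simp add: inner_cnj block_inner_cnj)

lemma inner_refl_op: "inner B n u (refl_op n S h v) = inner B n (refl_op n S h u) v"
proof -
  have "inner B n u (\<lambda>q. if fst q \<in> S then - v q else v q) = inner B n (\<lambda>q. if fst q \<in> S then - u q else u q) v"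
    by (auto simp: inner_def intro!: sum.cong)
  thus ?thesis
    unfolding refl_op_def[abs_def]
    by (simp add: inner_add_right inner_add_left inner_cmult_right inner_cmult_left inner_ket inner_ket_left)
qed

lemma inner_refl_deriv:
  "inner B n u (refl_deriv n S h k v) =
     2 * (block_inner B (bra n S k u) (bra n S h v) + block_inner B (bra n S h u) (bra n S k v))"
  unfolding refl_deriv_def[abs_def]
  by (simp add: inner_add_right inner_cmult_right inner_ket)

lemma inner_refl_deriv_left:
  "inner B n (refl_deriv n S h k v) u = inner B n v (refl_deriv n S h k u)"
  unfolding inner_refl_deriv unfolding refl_deriv_def[abs_def]
  by (simp add: inner_add_left inner_cmult_left inner_ket_left)

lemma inner_apply_kernel: "inner B n u (apply_kernel B n A v) = inner B n (apply_kernel B n (adj_kernel A) u) v"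
proof -
  have "inner B n u (apply_kernel B n A v) = (\<Sum>q\<in>{..<B} \<times> {..<n}. \<Sum>r\<in>{..<B} \<times> {..<n}. cnj (u q) * (A q r * v r))"
    by (simp add: inner_def apply_kernel_def sum_distrib_left)
  also have "\<dots> = (\<Sum>r\<in>{..<B} \<times> {..<n}. \<Sum>q\<in>{..<B} \<times> {..<n}. cnj (u q) * (A q r * v r))" by (rule sum.swap)
  also have "\<dots> = inner B n (apply_kernel B n (adj_kernel A) u) v"
    by (simp add: inner_def apply_kernel_def adj_kernel_def cnj_sum sum_distrib_left sum_distrib_right mult_ac)
  finally show ?thesis .
qed

lemma bra_refl_op:
  assumes "(\<Sum>x<n. cnj (h x) * h x) = 1"
  shows "bra n S h (refl_op n S h u) j = bra n S h u j"
proof (cases "j \<in> S")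
  case True
  define c where "c = bra n S h u j"
  have "bra n S h (refl_op n S h u) j = (\<Sum>x<n. cnj (h x) * (- u (j,x) + 2 * (h x * c)))"
    using True by (simp add: bra_def[of n S h "refl_op n S h u"] refl_op_def c_def)
  also have "\<dots> = - (\<Sum>x<n. cnj (h x) * u (j,x)) + (\<Sum>x<n. cnj (h x) * h x) * (2 * c)"
    unfolding sum_distrib_right sum_negf[symmetric] sum.distrib[symmetric] by (simp add: algebra_simps)
  finally show ?thesis unfolding assms using True by (simp add: bra_def c_def)
qed (simp add: bra_def)

lemma refl_op_involution:
  assumes "(\<Sum>x<n. cnj (h x) * h x) = 1"
  shows "refl_op n S h (refl_op n S h u) = u"
proof
  fix q show "refl_op n S h (refl_op n S h u) q = u q"
    unfolding refl_op_def[of n S h "refl_op n S h u"] bra_refl_op[OF assms]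
    by (auto simp: refl_op_def bra_def)
qed

section \<open>Norms of states and of families of derivatives\<close>

definition state_norm :: "nat \<Rightarrow> nat \<Rightarrow> state \<Rightarrow> real" where
  "state_norm B n u = L2_set (\<lambda>q. cmod (u q)) ({..<B} \<times> {..<n})"

definition family_norm :: "'k set \<Rightarrow> nat \<Rightarrow> nat \<Rightarrow> ('k \<Rightarrow> state) \<Rightarrow> real" where
  "family_norm K B n d = L2_set (\<lambda>(k,q). cmod (d k q)) (K \<times> ({..<B} \<times> {..<n}))"

lemma state_norm_sq: "complex_of_real ((state_norm B n u)\<^sup>2) = inner B n u u"
  by (simp add: state_norm_def L2_set_def inner_def sum_nonneg complex_norm_square mult.commute del: of_real_power)

lemma family_norm_sq: "finite K \<Longrightarrow> (family_norm K B n d)\<^sup>2 = (\<Sum>k\<in>K. (state_norm B n (d k))\<^sup>2)"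
  by (simp add: family_norm_def state_norm_def L2_set_def sum_nonneg sum.cartesian_product case_prod_beta)

lemma state_norm_nonneg [simp]: "0 \<le> state_norm B n u" and family_norm_nonneg [simp]: "0 \<le> family_norm K B n d"
  by (auto simp: state_norm_def family_norm_def)

text \<open>A self-adjoint involution preserves inner products.\<close>

lemma state_norm_refl_op:
  assumes "(\<Sum>x<n. cnj (h x) * h x) = 1"
  shows "state_norm B n (refl_op n S h u) = state_norm B n u"
proof -
  have "complex_of_real ((state_norm B n (refl_op n S h u))\<^sup>2) = complex_of_real ((state_norm B n u)\<^sup>2)"
    unfolding state_norm_sq inner_refl_op refl_op_involution[OF assms] ..
  thus ?thesis by (simp only: of_real_eq_iff) (simp add: power2_eq_iff_nonneg)
qed

lemma state_norm_apply_kernel: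
  assumes "isometry_kernel B n A"
  shows "state_norm B n (apply_kernel B n A u) = state_norm B n u"
proof -
  let ?I = "{..<B} \<times> {..<n}"
  have "inner B n (apply_kernel B n A u) (apply_kernel B n A u) =
     (\<Sum>q\<in>?I. \<Sum>r\<in>?I. \<Sum>r'\<in>?I. cnj (u r) * ((cnj (A q r) * A q r') * u r'))"
    unfolding inner_def apply_kernel_def cnj_sum sum_product by (simp add: mult_ac)
  also have "\<dots> = (\<Sum>r\<in>?I. \<Sum>r'\<in>?I. \<Sum>q\<in>?I. cnj (u r) * ((cnj (A q r) * A q r') * u r'))"
    by (rule trans[OF sum.swap], rule sum.cong[OF refl], rule sum.swap)
  also have "\<dots> = (\<Sum>r\<in>?I. \<Sum>r'\<in>?I. cnj (u r) * ((if r = r' then 1 else 0) * u r'))"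
  proof (intro sum.cong refl)
    fix r r' assume "r \<in> ?I" "r' \<in> ?I"
    hence "(\<Sum>q\<in>?I. cnj (A q r) * A q r') = (if r = r' then 1 else 0)"
      using assms unfolding isometry_kernel_def by blast
    thus "(\<Sum>q\<in>?I. cnj (u r) * ((cnj (A q r) * A q r') * u r')) = cnj (u r) * ((if r = r' then 1 else 0) * u r')"
      by (simp only: sum_distrib_left[symmetric] sum_distrib_right[symmetric])
  qed
  also have "\<dots> = inner B n u u"
    unfolding inner_def
    by (intro sum.cong refl) (simp add: if_distrib[of "\<lambda>x. _ * x"] if_distrib[of "\<lambda>x. x * _"] cong: if_cong)
  finally have "complex_of_real ((state_norm B n (apply_kernel B n A u))\<^sup>2) = complex_of_real ((state_norm B n u)\<^sup>2)"
    unfolding state_norm_sq .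
  thus ?thesis by (simp only: of_real_eq_iff) (simp add: power2_eq_iff_nonneg)
qed

lemma family_norm_cong:
  assumes "finite K" "\<And>k. k \<in> K \<Longrightarrow> state_norm B n (d k) = state_norm B n (e k)"
  shows "family_norm K B n d = family_norm K B n e"
proof -
  have "(family_norm K B n d)\<^sup>2 = (family_norm K B n e)\<^sup>2"
    using assms by (simp add: family_norm_sq)
  thus ?thesis by (simp add: power2_eq_iff_nonneg)
qed

lemma family_norm_add:
  "family_norm K B n (\<lambda>k q. d k q + e k q) \<le> family_norm K B n d + family_norm K B n e"
proof -
  have "family_norm K B n (\<lambda>k q. d k q + e k q) \<le>
    L2_set (\<lambda>p. (\<lambda>(k,q). cmod (d k q)) p + (\<lambda>(k,q). cmod (e k q)) p) (K \<times> ({..<B} \<times> {..<n}))"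
    unfolding family_norm_def by (intro L2_set_mono) (auto intro: norm_triangle_ineq)
  also have "\<dots> \<le> family_norm K B n d + family_norm K B n e"
    unfolding family_norm_def by (rule L2_set_triangle_ineq)
  finally show ?thesis .
qed

lemma family_norm_cmult: "family_norm K B n (\<lambda>k q. c * d k q) = cmod c * family_norm K B n d"
proof -
  have "family_norm K B n (\<lambda>k q. c * d k q) = L2_set (\<lambda>p. cmod c * (\<lambda>(k,q). cmod (d k q)) p) (K \<times> ({..<B} \<times> {..<n}))"
    unfolding family_norm_def by (intro L2_set_cong) (auto simp: norm_mult)
  thus ?thesis by (simp add: L2_set_right_distrib family_norm_def)
qed

text \<open>Directional data of one oracle: \<open>\<eta>\<close> is the vector the oracle reflects about, \<open>\<kappa>\<close> its part
  depending on the hidden matrix, \<open>\<delta> k\<close> and \<open>\<delta>\<delta> k\<close> the first and second derivatives of \<open>\<kappa>\<close> in direction \<open>k\<close>.\<close>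
locale oracle_point =
  fixes n :: nat and K :: "'k set" and \<eta> \<kappa> :: "nat \<Rightarrow> complex" and \<delta> \<delta>\<delta> :: "'k \<Rightarrow> nat \<Rightarrow> complex"
    and lam \<gamma> \<Lambda> :: real
  assumes finite_K: "finite K"
    and unit: "(\<Sum>x<n. cnj (\<eta> x) * \<eta> x) = 1"
    and eigen: "\<And>x. x < n \<Longrightarrow> (\<Sum>k\<in>K. \<delta>\<delta> k x) = - complex_of_real lam * \<kappa> x"
    and \<gamma>: "0 \<le> \<gamma>" "\<And>v. (\<Sum>k\<in>K. (cmod (\<Sum>x<n. cnj (\<delta> k x) * v x))\<^sup>2) \<le> \<gamma>\<^sup>2 * (\<Sum>x<n. (cmod (v x))\<^sup>2)"
    and \<Lambda>: "0 \<le> \<Lambda>" "(\<Sum>k\<in>K. \<Sum>x<n. (cmod (\<delta> k x))\<^sup>2) \<le> \<Lambda>\<^sup>2"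
    and lam: "0 < lam"
begin

lemma unit_real: "(\<Sum>x<n. (cmod (\<eta> x))\<^sup>2) = 1"
proof -
  have "complex_of_real (\<Sum>x<n. (cmod (\<eta> x))\<^sup>2) = 1"
    unfolding of_real_sum complex_norm_square using unit by (simp add: mult.commute)
  thus ?thesis by (simp only: of_real_eq_1_iff)
qed

lemma cauchy_schwarz_unit: "(cmod (\<Sum>x<n. cnj (\<eta> x) * v x))\<^sup>2 \<le> (\<Sum>x<n. (cmod (v x))\<^sup>2)"
proof -
  have "cmod (\<Sum>x<n. cnj (\<eta> x) * v x) \<le> (\<Sum>x<n. \<bar>cmod (\<eta> x)\<bar> * \<bar>cmod (v x)\<bar>)"
    by (rule order_trans[OF norm_sum]) (simp add: norm_mult)
  also have "\<dots> \<le> L2_set (\<lambda>x. cmod (\<eta> x)) {..<n} * L2_set (\<lambda>x. cmod (v x)) {..<n}" by (rule L2_set_mult_ineq)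
  also have "L2_set (\<lambda>x. cmod (\<eta> x)) {..<n} = 1" by (simp add: L2_set_def unit_real)
  finally have "(cmod (\<Sum>x<n. cnj (\<eta> x) * v x))\<^sup>2 \<le> (L2_set (\<lambda>x. cmod (v x)) {..<n})\<^sup>2"
    by (intro power_mono) auto
  thus ?thesis by (simp add: L2_set_def sum_nonneg)
qed

lemma bra_eta_le: "(\<Sum>j<B. (cmod (bra n S \<eta> u j))\<^sup>2) \<le> (state_norm B n u)\<^sup>2"
proof -
  have "(\<Sum>j<B. (cmod (bra n S \<eta> u j))\<^sup>2) \<le> (\<Sum>j<B. \<Sum>x<n. (cmod (u (j,x)))\<^sup>2)"
    by (intro sum_mono) (auto simp: bra_def cauchy_schwarz_unit sum_nonneg)
  thus ?thesis by (simp add: state_norm_def L2_set_def sum_nonneg sum.cartesian_product case_prod_beta)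
qed

text \<open>\<open>\<gamma>\<close> bounds all inner products with the \<open>\<delta> k\<close>
  jointly, as an operator norm, so the number of directions does not enter.\<close>

lemma bra_delta_le: "(\<Sum>k\<in>K. \<Sum>j<B. (cmod (bra n S (\<delta> k) u j))\<^sup>2) \<le> \<gamma>\<^sup>2 * (state_norm B n u)\<^sup>2"
proof -
  have "(\<Sum>k\<in>K. \<Sum>j<B. (cmod (bra n S (\<delta> k) u j))\<^sup>2) = (\<Sum>j<B. \<Sum>k\<in>K. (cmod (bra n S (\<delta> k) u j))\<^sup>2)"
    by (rule sum.swap)
  also have "\<dots> \<le> (\<Sum>j<B. \<gamma>\<^sup>2 * (\<Sum>x<n. (cmod (u (j,x)))\<^sup>2))"
  proof (rule sum_mono)
    fix j show "(\<Sum>k\<in>K. (cmod (bra n S (\<delta> k) u j))\<^sup>2) \<le> \<gamma>\<^sup>2 * (\<Sum>x<n. (cmod (u (j,x)))\<^sup>2)"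
      using \<gamma>(2)[of "\<lambda>x. u (j,x)"] by (cases "j \<in> S") (simp_all add: bra_def sum_nonneg)
  qed
  also have "\<dots> = \<gamma>\<^sup>2 * (state_norm B n u)\<^sup>2"
    by (simp add: state_norm_def L2_set_def sum_nonneg sum.cartesian_product case_prod_beta sum_distrib_left)
  finally show ?thesis .
qed

lemma family_block_inner_le:
  assumes "(\<Sum>k\<in>K. \<Sum>j<B. (cmod (g k j))\<^sup>2) \<le> a\<^sup>2" "(\<Sum>k\<in>K. \<Sum>j<B. (cmod (h k j))\<^sup>2) \<le> b\<^sup>2" "0 \<le> a" "0 \<le> b"
  shows "cmod (\<Sum>k\<in>K. block_inner B (g k) (h k)) \<le> a * b"
proof -
  have "cmod (\<Sum>k\<in>K. block_inner B (g k) (h k)) = cmod (\<Sum>p\<in>K \<times> {..<B}. cnj (g (fst p) (snd p)) * h (fst p) (snd p))"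
    by (simp add: block_inner_def sum.cartesian_product case_prod_beta)
  also have "\<dots> \<le> (\<Sum>p\<in>K \<times> {..<B}. \<bar>cmod (g (fst p) (snd p))\<bar> * \<bar>cmod (h (fst p) (snd p))\<bar>)"
    by (rule order_trans[OF norm_sum]) (simp add: norm_mult)
  also have "\<dots> \<le> L2_set (\<lambda>p. cmod (g (fst p) (snd p))) (K \<times> {..<B}) * L2_set (\<lambda>p. cmod (h (fst p) (snd p))) (K \<times> {..<B})"
    by (rule L2_set_mult_ineq)
  also have "\<dots> \<le> a * b"
    by (intro mult_mono) (use assms in \<open>auto simp: L2_set_def sum.cartesian_product case_prod_beta real_sqrt_le_iff intro: real_le_lsqrt sum_nonneg\<close>)
  finally show ?thesis .
qed

text \<open>One oracle call creates energy in two ways: by emitting the vectors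
  \<open>\<delta> k\<close>, whose total mass is at most \<open>\<Lambda>\<close> squared, and by
  testing the state against them, which costs only \<open>\<gamma>\<close>.\<close>

lemma family_norm_refl_deriv:
  "family_norm K B n (\<lambda>k. refl_deriv n S \<eta> (\<delta> k) u) \<le> 2 * (\<Lambda> + \<gamma>) * state_norm B n u"
proof -
  let ?d = "\<lambda>k q. \<delta> k (snd q) * bra n S \<eta> u (fst q)" and ?e = "\<lambda>k q. \<eta> (snd q) * bra n S (\<delta> k) u (fst q)"
  have "(family_norm K B n ?d)\<^sup>2 = (\<Sum>k\<in>K. \<Sum>x<n. (cmod (\<delta> k x))\<^sup>2) * (\<Sum>j<B. (cmod (bra n S \<eta> u j))\<^sup>2)"
  proof -
    have "(state_norm B n (?d k))\<^sup>2 = (\<Sum>j<B. \<Sum>x<n. (cmod (\<delta> k x))\<^sup>2 * (cmod (bra n S \<eta> u j))\<^sup>2)" for k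
      by (simp add: state_norm_def L2_set_def sum_nonneg norm_mult power_mult_distrib sum.cartesian_product case_prod_beta)
    also have "\<dots> k = (\<Sum>x<n. (cmod (\<delta> k x))\<^sup>2) * (\<Sum>j<B. (cmod (bra n S \<eta> u j))\<^sup>2)" for k
      unfolding sum_product by (rule sum.swap)
    finally show ?thesis by (simp add: family_norm_sq finite_K sum_distrib_right)
  qed
  also have "\<dots> \<le> \<Lambda>\<^sup>2 * (state_norm B n u)\<^sup>2" by (intro mult_mono \<Lambda> bra_eta_le sum_nonneg) auto
  finally have 1: "family_norm K B n ?d \<le> \<Lambda> * state_norm B n u"
    using \<Lambda>(1) by (auto simp: power_mult_distrib[symmetric] intro: power2_le_imp_le)
  have "(family_norm K B n ?e)\<^sup>2 = (\<Sum>k\<in>K. \<Sum>j<B. (\<Sum>x<n. (cmod (\<eta> x))\<^sup>2) * (cmod (bra n S (\<delta> k) u j))\<^sup>2)"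
  proof -
    have "(state_norm B n (?e k))\<^sup>2 = (\<Sum>j<B. \<Sum>x<n. (cmod (\<eta> x))\<^sup>2 * (cmod (bra n S (\<delta> k) u j))\<^sup>2)" for k
      by (simp add: state_norm_def L2_set_def sum_nonneg norm_mult power_mult_distrib sum.cartesian_product case_prod_beta)
    thus ?thesis by (simp add: family_norm_sq finite_K sum_distrib_right)
  qed
  also have "\<dots> \<le> \<gamma>\<^sup>2 * (state_norm B n u)\<^sup>2" unfolding unit_real using bra_delta_le by simp
  finally have 2: "family_norm K B n ?e \<le> \<gamma> * state_norm B n u"
    using \<gamma>(1) by (auto simp: power_mult_distrib[symmetric] intro: power2_le_imp_le)
  have "family_norm K B n (\<lambda>k. refl_deriv n S \<eta> (\<delta> k) u) = 2 * family_norm K B n (\<lambda>k q. ?d k q + ?e k q)"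
    unfolding refl_deriv_def[abs_def] by (subst family_norm_cmult) simp
  also have "\<dots> \<le> 2 * (family_norm K B n ?d + family_norm K B n ?e)"
    by (intro mult_left_mono family_norm_add) auto
  finally show ?thesis using 1 2 by (simp add: algebra_simps)
qed


lemma bra_ii: "bra n S (\<lambda>x. \<i> * h x) u = (\<lambda>j. - \<i> * bra n S h u j)"
  by (rule ext) (simp add: bra_def sum_distrib_left sum_negf mult_ac)

lemma sum_bra_second: "(\<lambda>j. \<Sum>k\<in>K. bra n S (\<delta>\<delta> k) u j) = (\<lambda>j. - complex_of_real lam * bra n S \<kappa> u j)"
proof
  fix j
  have "(\<Sum>k\<in>K. \<Sum>x<n. cnj (\<delta>\<delta> k x) * u (j,x)) = (\<Sum>x<n. cnj (\<Sum>k\<in>K. \<delta>\<delta> k x) * u (j,x))"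
    unfolding cnj_sum sum_distrib_right by (rule sum.swap)
  also have "\<dots> = (\<Sum>x<n. - complex_of_real lam * (cnj (\<kappa> x) * u (j,x)))"
    by (intro sum.cong refl) (simp add: eigen mult_ac)
  finally have "(\<Sum>k\<in>K. \<Sum>x<n. cnj (\<delta>\<delta> k x) * u (j,x)) = - complex_of_real lam * (\<Sum>x<n. cnj (\<kappa> x) * u (j,x))"
    by (simp only: sum_distrib_left)
  thus "(\<Sum>k\<in>K. bra n S (\<delta>\<delta> k) u j) = - complex_of_real lam * bra n S \<kappa> u j"
    by (cases "j \<in> S") (simp_all add: bra_def)
qed

end

text \<open>The components are the state, its derivatives in the hidden directions k, and its
  derivative in \<alpha>; \<open>jet_step\<close> is then the product rule.\<close>

type_synonym 'k jet_state = "state \<times> ('k \<Rightarrow> state) \<times> state"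

datatype step = Fixed "nat \<times> nat \<Rightarrow> nat \<times> nat \<Rightarrow> complex" | Oracle "nat set"

fun jet_step :: "nat \<Rightarrow> nat \<Rightarrow> (nat \<Rightarrow> complex) \<Rightarrow> (nat \<Rightarrow> complex) \<Rightarrow> ('k \<Rightarrow> nat \<Rightarrow> complex) \<Rightarrow>
    step \<Rightarrow> 'k jet_state \<Rightarrow> 'k jet_state" where
  "jet_step B n \<eta> \<kappa> \<delta> (Fixed A) (u,d,a) = (apply_kernel B n A u, \<lambda>k. apply_kernel B n A (d k), apply_kernel B n A a)"
| "jet_step B n \<eta> \<kappa> \<delta> (Oracle S) (u,d,a) = (refl_op n S \<eta> u,
     \<lambda>k q. refl_op n S \<eta> (d k) q + refl_deriv n S \<eta> (\<delta> k) u q,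
     \<lambda>q. refl_op n S \<eta> a q + refl_deriv n S \<eta> (\<lambda>x. \<i> * \<kappa> x) u q)"

text \<open>Twice the real part of the final value is the derivative of the acceptance probability in \<open>\<alpha>\<close>:
  the second term, a Dirichlet form of the Casimir Laplacian, is then purely imaginary. The scheme is that
  the value vanishes initially and hardly changes under an oracle call.\<close>
fun pairing :: "nat \<Rightarrow> nat \<Rightarrow> 'k set \<Rightarrow> real \<Rightarrow> 'k jet_state \<Rightarrow> 'k jet_state \<Rightarrow> complex" where
  "pairing B n K lam (u,d,_) (v,e,a) = inner B n u a - (\<i> / lam) * (\<Sum>k\<in>K. inner B n (d k) (e k))"

text \<open>The derivative in direction \<open>k\<close> of
  \<open>\<langle>[\<delta> k|u], [\<eta>|v]\<rangle> - \<langle>[\<eta>|u], [\<delta> k|v]\<rangle>\<close>, hence of mean zero.\<close>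
definition exact_part :: "nat \<Rightarrow> nat \<Rightarrow> (nat \<Rightarrow> complex) \<Rightarrow> ('k \<Rightarrow> nat \<Rightarrow> complex) \<Rightarrow> ('k \<Rightarrow> nat \<Rightarrow> complex) \<Rightarrow>
    nat set \<Rightarrow> 'k jet_state \<Rightarrow> 'k jet_state \<Rightarrow> 'k \<Rightarrow> complex" where
  "exact_part B n \<eta> \<delta> \<delta>\<delta> S \<chi> \<psi> k = (case (\<chi>, \<psi>) of ((u,d,_), (v,e,_)) \<Rightarrow>
     block_inner B (bra n S (\<delta>\<delta> k) u) (bra n S \<eta> v) + block_inner B (bra n S (\<delta> k) (d k)) (bra n S \<eta> v)
   + block_inner B (bra n S (\<delta> k) u) (bra n S \<eta> (e k)) 
   - block_inner B (bra n S \<eta> (d k)) (bra n S (\<delta> k) v)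
   - block_inner B (bra n S \<eta> u) (bra n S (\<delta>\<delta> k) v) - block_inner B (bra n S \<eta> u) (bra n S (\<delta> k) (e k)))"

context oracle_point
begin

text \<open>Self-adjointness removes the undifferentiated reflections and leaves product-rule terms.
  By the eigenvalue equation the \<alpha>-derivative equals the second-derivative terms of the exact
  part, and \<open>A1\<close> and \<open>A4\<close> agree with it too. The terms \<open>A2\<close>
  and \<open>A3\<close> occur there with the opposite sign, so twice their difference
  remains.\<close>

lemma pairing_oracle_step:
  "pairing B n K lam (u,d,c) (jet_step B n \<eta> \<kappa> \<delta> (Oracle S) (v,e,a))
   - pairing B n K lam (jet_step B n \<eta> \<kappa> \<delta> (Oracle S) (u,d,c)) (v,e,a) =
   - (2 * \<i> / lam) * (\<Sum>k\<in>K. exact_part B n \<eta> \<delta> \<delta>\<delta> S (u,d,c) (v,e,a) k)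
   - (4 * \<i> / lam) * ((\<Sum>k\<in>K. block_inner B (bra n S \<eta> (d k)) (bra n S (\<delta> k) v))
                   - (\<Sum>k\<in>K. block_inner B (bra n S (\<delta> k) u) (bra n S \<eta> (e k))))"
proof -
  let ?b = "block_inner B" and ?r = "bra n S"
  define P where "P = ?b (?r \<kappa> u) (?r \<eta> v)"
  define Q where "Q = ?b (?r \<eta> u) (?r \<kappa> v)"
  define A1 where "A1 = (\<Sum>k\<in>K. ?b (?r (\<delta> k) (d k)) (?r \<eta> v))"
  define A2 where "A2 = (\<Sum>k\<in>K. ?b (?r \<eta> (d k)) (?r (\<delta> k) v))"
  define A3 where "A3 = (\<Sum>k\<in>K. ?b (?r (\<delta> k) u) (?r \<eta> (e k)))"
  define A4 where "A4 = (\<Sum>k\<in>K. ?b (?r \<eta> u) (?r (\<delta> k) (e k)))"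
  have s1: "(\<Sum>k\<in>K. ?b (?r (\<delta>\<delta> k) u) (?r \<eta> v)) = - complex_of_real lam * P"
    unfolding block_inner_linear(3)[symmetric] sum_bra_second block_inner_linear(1) P_def by simp
  have s2: "(\<Sum>k\<in>K. ?b (?r \<eta> u) (?r (\<delta>\<delta> k) v)) = - complex_of_real lam * Q"
    unfolding block_inner_linear(4)[symmetric] sum_bra_second block_inner_linear(2) Q_def by simp
  have exact: "(\<Sum>k\<in>K. exact_part B n \<eta> \<delta> \<delta>\<delta> S (u,d,c) (v,e,a) k) = - complex_of_real lam * P + A1 + A3 - A2 + complex_of_real lam * Q - A4"
    by (simp add: exact_part_def sum.distrib sum_subtractf s1 s2 A1_def A2_def A3_def A4_def)
  have T1: "inner B n u (refl_deriv n S \<eta> (\<lambda>x. \<i> * \<kappa> x) v) = 2 * \<i> * (P - Q)"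
    unfolding inner_refl_deriv bra_ii block_inner_linear P_def Q_def by (simp add: algebra_simps)
  have "(\<Sum>k\<in>K. inner B n (d k) (\<lambda>q. refl_op n S \<eta> (e k) q + refl_deriv n S \<eta> (\<delta> k) v q))
      - (\<Sum>k\<in>K. inner B n (\<lambda>q. refl_op n S \<eta> (d k) q + refl_deriv n S \<eta> (\<delta> k) u q) (e k))
     = (\<Sum>k\<in>K. inner B n (d k) (refl_deriv n S \<eta> (\<delta> k) v)) - (\<Sum>k\<in>K. inner B n u (refl_deriv n S \<eta> (\<delta> k) (e k)))"
    by (simp add: inner_add_right inner_add_left inner_refl_op inner_refl_deriv_left sum.distrib)
  also have "\<dots> = 2 * (A1 + A2 - A3 - A4)"
    unfolding inner_refl_deriv sum_distrib_left[symmetric] sum.distrib A1_def A2_def A3_def A4_def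
    by (simp add: algebra_simps)
  finally have T2: "(\<Sum>k\<in>K. inner B n (d k) (\<lambda>q. refl_op n S \<eta> (e k) q + refl_deriv n S \<eta> (\<delta> k) v q))
      - (\<Sum>k\<in>K. inner B n (\<lambda>q. refl_op n S \<eta> (d k) q + refl_deriv n S \<eta> (\<delta> k) u q) (e k)) = 2 * (A1 + A2 - A3 - A4)" .
  have "pairing B n K lam (u,d,c) (jet_step B n \<eta> \<kappa> \<delta> (Oracle S) (v,e,a))
   - pairing B n K lam (jet_step B n \<eta> \<kappa> \<delta> (Oracle S) (u,d,c)) (v,e,a)
   = 2 * \<i> * (P - Q) - (\<i> / lam) * (2 * (A1 + A2 - A3 - A4))"
    unfolding T2[symmetric] by (simp add: inner_add_right T1 inner_refl_op algebra_simps)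
  also have "\<dots> = - (2 * \<i> / lam) * (- complex_of_real lam * P + A1 + A3 - A2 + complex_of_real lam * Q - A4)
     - (4 * \<i> / lam) * (A2 - A3)"
    using lam by (simp add: field_simps)
  finally show ?thesis unfolding exact A2_def A3_def .
qed

lemma pairing_fixed_step:
  "pairing B n K lam (u,d,c) (jet_step B n \<eta> \<kappa> \<delta> (Fixed A) (v,e,a))
   = pairing B n K lam (jet_step B n \<eta> \<kappa> \<delta> (Fixed (adj_kernel A)) (u,d,c)) (v,e,a)"
  by (simp add: inner_apply_kernel)

end

section \<open>Adjoint steps and the growth of the energy\<close>

fun step_adj :: "step \<Rightarrow> step" where
  "step_adj (Fixed A) = Fixed (adj_kernel A)"
| "step_adj (Oracle S) = Oracle S"

text \<open>The adjoint kernel must be an isometry as well, since steps are also run backwards; a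
  reflection is its own adjoint.\<close>

fun valid_step :: "nat \<Rightarrow> nat \<Rightarrow> step \<Rightarrow> bool" where
  "valid_step B n (Fixed A) \<longleftrightarrow> isometry_kernel B n A \<and> isometry_kernel B n (adj_kernel A)"
| "valid_step B n (Oracle S) \<longleftrightarrow> True"

fun oracle_count :: "step list \<Rightarrow> nat" where
  "oracle_count [] = 0"
| "oracle_count (Fixed A # ss) = oracle_count ss"
| "oracle_count (Oracle S # ss) = Suc (oracle_count ss)"

lemma oracle_count_append: "oracle_count (ss @ ss') = oracle_count ss + oracle_count ss'"
  by (induct ss rule: oracle_count.induct) auto

lemma oracle_count_rev_adj: "oracle_count (rev (map step_adj ss)) = oracle_count ss"
  by (induct ss rule: oracle_count.induct) (auto simp: oracle_count_append)

lemma adj_kernel_adj [simp]: "adj_kernel (adj_kernel A) = A"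
  by (intro ext) (simp add: adj_kernel_def)

lemma valid_step_adj: "valid_step B n s \<Longrightarrow> valid_step B n (step_adj s)"
  by (cases s) auto

context oracle_point
begin

lemma jet_step_norms:
  assumes "valid_step B n s"
  shows "state_norm B n (fst (jet_step B n \<eta> \<kappa> \<delta> s J)) = state_norm B n (fst J)"
    and "family_norm K B n (fst (snd (jet_step B n \<eta> \<kappa> \<delta> s J)))
      \<le> family_norm K B n (fst (snd J)) + oracle_count [s] * (2 * (\<Lambda> + \<gamma>)) * state_norm B n (fst J)"
proof -
  obtain u d a where J: "J = (u,d,a)" by (cases J)
  show "state_norm B n (fst (jet_step B n \<eta> \<kappa> \<delta> s J)) = state_norm B n (fst J)"
    using assms by (cases s) (auto simp: J state_norm_apply_kernel state_norm_refl_op[OF unit])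
  show "family_norm K B n (fst (snd (jet_step B n \<eta> \<kappa> \<delta> s J)))
      \<le> family_norm K B n (fst (snd J)) + oracle_count [s] * (2 * (\<Lambda> + \<gamma>)) * state_norm B n (fst J)"
  proof (cases s)
    case (Fixed A)
    have "family_norm K B n (\<lambda>k. apply_kernel B n A (d k)) = family_norm K B n d"
      using assms Fixed by (intro family_norm_cong finite_K) (auto simp: state_norm_apply_kernel)
    thus ?thesis by (simp add: Fixed J)
  next
    case (Oracle S)
    have "family_norm K B n (\<lambda>k q. refl_op n S \<eta> (d k) q + refl_deriv n S \<eta> (\<delta> k) u q)
      \<le> family_norm K B n (\<lambda>k. refl_op n S \<eta> (d k)) + family_norm K B n (\<lambda>k. refl_deriv n S \<eta> (\<delta> k) u)"
      by (rule family_norm_add)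
    also have "family_norm K B n (\<lambda>k. refl_op n S \<eta> (d k)) = family_norm K B n d"
      by (intro family_norm_cong finite_K state_norm_refl_op unit)
    finally show ?thesis using family_norm_refl_deriv[of B S u] by (simp add: Oracle J)
  qed
qed

lemma fold_norms:
  assumes "\<forall>s\<in>set ss. valid_step B n s"
  shows "state_norm B n (fst (fold (jet_step B n \<eta> \<kappa> \<delta>) ss J)) = state_norm B n (fst J)"
    and "family_norm K B n (fst (snd (fold (jet_step B n \<eta> \<kappa> \<delta>) ss J)))
      \<le> family_norm K B n (fst (snd J)) + oracle_count ss * (2 * (\<Lambda> + \<gamma>)) * state_norm B n (fst J)"
proof -
  have "state_norm B n (fst (fold (jet_step B n \<eta> \<kappa> \<delta>) ss J)) = state_norm B n (fst J) \<and>
    family_norm K B n (fst (snd (fold (jet_step B n \<eta> \<kappa> \<delta>) ss J)))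
      \<le> family_norm K B n (fst (snd J)) + oracle_count ss * (2 * (\<Lambda> + \<gamma>)) * state_norm B n (fst J)"
    using assms
  proof (induct ss arbitrary: J)
    case (Cons s ss)
    have c: "oracle_count (s # ss) = oracle_count [s] + oracle_count ss"
      using oracle_count_append[of "[s]" ss] by simp
    show ?case
      using Cons(1)[of "jet_step B n \<eta> \<kappa> \<delta> s J"] jet_step_norms[of B s J] Cons(2)
      unfolding c of_nat_add by (simp add: algebra_simps)
  qed simp
  thus "state_norm B n (fst (fold (jet_step B n \<eta> \<kappa> \<delta>) ss J)) = state_norm B n (fst J)"
    and "family_norm K B n (fst (snd (fold (jet_step B n \<eta> \<kappa> \<delta>) ss J)))
      \<le> family_norm K B n (fst (snd J)) + oracle_count ss * (2 * (\<Lambda> + \<gamma>)) * state_norm B n (fst J)" by auto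
qed

text \<open>Once the exact part is removed, every remaining term couples a bra of
  \<open>\<delta> k\<close> on an undifferentiated state with a bra of \<open>\<eta>\<close> on a
  differentiated one. Cauchy-Schwarz over all k and blocks bounds it by \<open>\<gamma>\<close>
  times an energy.\<close>

lemma pairing_oracle_step_le:
  assumes "state_norm B n (fst \<chi>) \<le> 1" "state_norm B n (fst \<psi>) \<le> 1"
  shows "cmod (pairing B n K lam \<chi> (jet_step B n \<eta> \<kappa> \<delta> (Oracle S) \<psi>)
     - pairing B n K lam (jet_step B n \<eta> \<kappa> \<delta> (Oracle S) \<chi>) \<psi>
     + (2 * \<i> / lam) * (\<Sum>k\<in>K. exact_part B n \<eta> \<delta> \<delta>\<delta> S \<chi> \<psi> k))
   \<le> (4 * \<gamma> / lam) * (family_norm K B n (fst (snd \<chi>)) + family_norm K B n (fst (snd \<psi>)))"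
proof -
  obtain u d c where \<chi>: "\<chi> = (u,d,c)" by (cases \<chi>)
  obtain v e a where \<psi>: "\<psi> = (v,e,a)" by (cases \<psi>)
  define X where "X = (\<Sum>k\<in>K. block_inner B (bra n S \<eta> (d k)) (bra n S (\<delta> k) v))"
  define Y where "Y = (\<Sum>k\<in>K. block_inner B (bra n S (\<delta> k) u) (bra n S \<eta> (e k)))"
  have \<eta>le: "(\<Sum>k\<in>K. \<Sum>j<B. (cmod (bra n S \<eta> (f k) j))\<^sup>2) \<le> (family_norm K B n f)\<^sup>2" for f
    unfolding family_norm_sq[OF finite_K] by (intro sum_mono bra_eta_le)
  have \<delta>le: "(\<Sum>k\<in>K. \<Sum>j<B. (cmod (bra n S (\<delta> k) w j))\<^sup>2) \<le> (\<gamma> * 1)\<^sup>2" if "state_norm B n w \<le> 1" for w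
  proof -
    have "\<gamma>\<^sup>2 * (state_norm B n w)\<^sup>2 \<le> \<gamma>\<^sup>2 * 1" using that by (intro mult_left_mono) (auto simp: power_le_one)
    thus ?thesis using bra_delta_le[where B = B and S = S and u = w] by simp
  qed
  have X: "cmod X \<le> family_norm K B n d * (\<gamma> * 1)" unfolding X_def
    using assms \<gamma>(1) by (intro family_block_inner_le \<eta>le \<delta>le) (auto simp: \<psi>)
  have Y: "cmod Y \<le> (\<gamma> * 1) * family_norm K B n e" unfolding Y_def
    using assms \<gamma>(1) by (intro family_block_inner_le \<eta>le \<delta>le) (auto simp: \<chi>)
  have "cmod (- (4 * \<i> / lam) * (X - Y)) = (4 / lam) * cmod (X - Y)"
    using lam by (simp add: norm_mult norm_divide)
  also have "\<dots> \<le> (4 / lam) * (family_norm K B n d * \<gamma> + \<gamma> * family_norm K B n e)"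
    using X Y lam norm_triangle_ineq4[of X Y] by (intro mult_left_mono) auto
  finally have "cmod (- (4 * \<i> / lam) * (X - Y)) \<le> (4 * \<gamma> / lam) * (family_norm K B n d + family_norm K B n e)"
    by (simp add: algebra_simps)
  moreover have "pairing B n K lam \<chi> (jet_step B n \<eta> \<kappa> \<delta> (Oracle S) \<psi>)
     - pairing B n K lam (jet_step B n \<eta> \<kappa> \<delta> (Oracle S) \<chi>) \<psi>
     + (2 * \<i> / lam) * (\<Sum>k\<in>K. exact_part B n \<eta> \<delta> \<delta>\<delta> S \<chi> \<psi> k) = - (4 * \<i> / lam) * (X - Y)"
    unfolding \<chi> \<psi> pairing_oracle_step X_def Y_def by simp
  ultimately show ?thesis by (simp add: \<chi> \<psi>)
qed

end

section \<open>Telescoping along the algorithm\<close>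

lemma jet_step_proj:
  "fst (jet_step B n \<eta> \<kappa> \<delta> (Fixed A) J) = apply_kernel B n A (fst J)"
  "fst (snd (jet_step B n \<eta> \<kappa> \<delta> (Fixed A) J)) k = apply_kernel B n A (fst (snd J) k)"
  "snd (snd (jet_step B n \<eta> \<kappa> \<delta> (Fixed A) J)) = apply_kernel B n A (snd (snd J))"
  "fst (jet_step B n \<eta> \<kappa> \<delta> (Oracle S) J) = refl_op n S \<eta> (fst J)"
  "fst (snd (jet_step B n \<eta> \<kappa> \<delta> (Oracle S) J)) k q = refl_op n S \<eta> (fst (snd J) k) q + refl_deriv n S \<eta> (\<delta> k) (fst J) q"
  "snd (snd (jet_step B n \<eta> \<kappa> \<delta> (Oracle S) J)) q = refl_op n S \<eta> (snd (snd J)) q + refl_deriv n S \<eta> (\<lambda>x. \<i> * \<kappa> x) (fst J) q"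
  by (cases J; simp)+

lemma jet_eq: "jet D X f f' \<Longrightarrow> (\<And>\<alpha> R. f \<alpha> R = g \<alpha> R) \<Longrightarrow> (\<And>\<alpha> R. f' \<alpha> R = g' \<alpha> R) \<Longrightarrow> jet D X g g'"
  by (subgoal_tac "f = g \<and> f' = g'") (auto intro!: ext)

lemma jet_bra:
  assumes "\<And>x. x < n \<Longrightarrow> jet D X (\<lambda>\<alpha> R. h \<alpha> R x) (\<lambda>\<alpha> R. h' \<alpha> R x)"
    and "\<And>x. x < n \<Longrightarrow> jet D X (\<lambda>\<alpha> R. u \<alpha> R (j,x)) (\<lambda>\<alpha> R. u' \<alpha> R (j,x))"
  shows "jet D X (\<lambda>\<alpha> R. bra n S (h \<alpha> R) (u \<alpha> R) j) (\<lambda>\<alpha> R. bra n S (h' \<alpha> R) (u \<alpha> R) j + bra n S (h \<alpha> R) (u' \<alpha> R) j)"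
proof (cases "j \<in> S")
  case True
  have "jet D X (\<lambda>\<alpha> R. \<Sum>x<n. cnj (h \<alpha> R x) * u \<alpha> R (j,x))
     (\<lambda>\<alpha> R. \<Sum>x<n. cnj (h' \<alpha> R x) * u \<alpha> R (j,x) + cnj (h \<alpha> R x) * u' \<alpha> R (j,x))"
    by (intro jet_sum jet_mult jet_cnj assms) auto
  thus ?thesis by (rule jet_eq) (use True in \<open>auto simp: bra_def sum.distrib\<close>)
next
  case False
  show ?thesis by (rule jet_eq[OF jet_const[of "\<lambda>_. 0" 0]]) (use False in \<open>auto simp: bra_def\<close>)
qed

lemma jet_block_inner:
  assumes "\<And>j. j < B \<Longrightarrow> jet D X (\<lambda>\<alpha> R. g \<alpha> R j) (\<lambda>\<alpha> R. g' \<alpha> R j)"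
    and "\<And>j. j < B \<Longrightarrow> jet D X (\<lambda>\<alpha> R. h \<alpha> R j) (\<lambda>\<alpha> R. h' \<alpha> R j)"
  shows "jet D X (\<lambda>\<alpha> R. block_inner B (g \<alpha> R) (h \<alpha> R))
     (\<lambda>\<alpha> R. block_inner B (g' \<alpha> R) (h \<alpha> R) + block_inner B (g \<alpha> R) (h' \<alpha> R))"
proof -
  have "jet D X (\<lambda>\<alpha> R. \<Sum>j<B. cnj (g \<alpha> R j) * h \<alpha> R j)
     (\<lambda>\<alpha> R. \<Sum>j<B. cnj (g' \<alpha> R j) * h \<alpha> R j + cnj (g \<alpha> R j) * h' \<alpha> R j)"
    by (intro jet_sum jet_mult jet_cnj assms) auto
  thus ?thesis by (rule jet_eq) (auto simp: block_inner_def sum.distrib)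
qed

lemma block_inner_add:
  "block_inner B (\<lambda>j. g j + g' j) h = block_inner B g h + block_inner B g' h"
  "block_inner B h (\<lambda>j. g j + g' j) = block_inner B h g + block_inner B h g'"
  by (auto simp: block_inner_def algebra_simps sum.distrib)

lemma has_vector_derivative_cnj_comp:
  "(f has_vector_derivative f') F \<Longrightarrow> ((\<lambda>x. cnj (f x)) has_vector_derivative cnj f') F"
  by (rule bounded_linear.has_vector_derivative[OF bounded_linear_cnj])

lemma has_vector_derivative_bra:
  assumes "\<And>x. x < n \<Longrightarrow> ((\<lambda>\<alpha>. h \<alpha> x) has_vector_derivative h' x) (at \<alpha>)"
    and "\<And>x. x < n \<Longrightarrow> ((\<lambda>\<alpha>. u \<alpha> (j,x)) has_vector_derivative u' (j,x)) (at \<alpha>)"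
  shows "((\<lambda>\<alpha>. bra n S (h \<alpha>) (u \<alpha>) j) has_vector_derivative bra n S h' (u \<alpha>) j + bra n S (h \<alpha>) u' j) (at \<alpha>)"
proof (cases "j \<in> S")
  case True
  have "((\<lambda>\<alpha>. \<Sum>x<n. cnj (h \<alpha> x) * u \<alpha> (j,x)) has_vector_derivative
     (\<Sum>x<n. cnj (h \<alpha> x) * u' (j,x) + cnj (h' x) * u \<alpha> (j,x))) (at \<alpha>)"
    by (intro has_vector_derivative_sum has_vector_derivative_mult has_vector_derivative_cnj_comp assms) auto
  thus ?thesis using True by (simp add: bra_def sum.distrib add.commute)
qed (simp add: bra_def)

lemma has_vector_derivative_expect:
  assumes "\<And>R. R \<in> snd ` set \<nu> \<Longrightarrow> ((\<lambda>\<alpha>. g \<alpha> R) has_vector_derivative g' R) (at \<alpha>)"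
  shows "((\<lambda>\<alpha>. expect \<nu> (g \<alpha>)) has_vector_derivative expect \<nu> g') (at \<alpha>)"
  using assms
proof (induct \<nu>)
  case (Cons x \<nu>)
  obtain a R where x: "x = (a,R)" by force
  show ?case using Cons x
    by (auto intro!: has_vector_derivative_add bounded_linear.has_vector_derivative[OF bounded_linear_mult_right])
qed simp

text \<open>The motion of the hidden matrix and the rotation in \<alpha> are linked only through
  \<open>\<kappa>\<close>: it is the \<alpha>-derivative of \<open>\<eta>\<close> up to the factor
  i, and in \<open>oracle_point\<close> it is what the summed second derivatives reproduce.\<close>

locale oracle_field =
  fixes D n :: nat and K :: "'k set" and X :: "'k \<Rightarrow> complex mat"
    and \<eta> \<kappa> :: "real \<Rightarrow> complex mat \<Rightarrow> nat \<Rightarrow> complex"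
    and \<delta> \<delta>\<delta> :: "real \<Rightarrow> complex mat \<Rightarrow> 'k \<Rightarrow> nat \<Rightarrow> complex"
    and lam \<gamma> \<Lambda> :: real and \<mu> :: "nat \<Rightarrow> (complex \<times> complex mat) list"
  assumes point: "\<And>\<alpha> R. R \<in> hermitian_reflections D \<Longrightarrow>
      oracle_point n K (\<eta> \<alpha> R) (\<kappa> \<alpha> R) (\<delta> \<alpha> R) (\<delta>\<delta> \<alpha> R) lam \<gamma> \<Lambda>"
    and min_seq: "min_seq D \<mu>"
    and directions: "\<And>k t. k \<in> K \<Longrightarrow> 0 < t \<Longrightarrow> t \<le> 1 \<Longrightarrow> \<exists>u. near_exp D (X k) t u"
    and jet_\<eta>: "\<And>k x. k \<in> K \<Longrightarrow> x < n \<Longrightarrow> jet D (X k) (\<lambda>\<alpha> R. \<eta> \<alpha> R x) (\<lambda>\<alpha> R. \<delta> \<alpha> R k x)"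
    and jet_\<delta>: "\<And>k x. k \<in> K \<Longrightarrow> x < n \<Longrightarrow> jet D (X k) (\<lambda>\<alpha> R. \<delta> \<alpha> R k x) (\<lambda>\<alpha> R. \<delta>\<delta> \<alpha> R k x)"
    and deriv_\<eta>: "\<And>\<alpha> R x. R \<in> hermitian_reflections D \<Longrightarrow> x < n \<Longrightarrow>
      ((\<lambda>\<alpha>. \<eta> \<alpha> R x) has_vector_derivative \<i> * \<kappa> \<alpha> R x) (at \<alpha>)"
begin

abbreviation reflections :: "complex mat set" where "reflections \<equiv> hermitian_reflections D"

text \<open>Uniformity in \<alpha> matters because one index \<open>j\<close> is fixed before the
  mean value theorem picks an angle depending on it.\<close>

definition vanishing :: "(real \<Rightarrow> complex mat \<Rightarrow> complex) \<Rightarrow> bool" where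
  "vanishing f \<longleftrightarrow> (\<forall>e>0. \<exists>N. \<forall>j\<ge>N. \<forall>\<alpha>. cmod (expect (\<mu> j) (f \<alpha>)) \<le> e)"

lemma vanishing_0: "vanishing (\<lambda>_ _. 0)"
proof -
  have "expect \<nu> (\<lambda>_. 0) = 0" for \<nu> :: "(complex \<times> complex mat) list" using expect_cmult[of \<nu> 0 "\<lambda>_. 0"] by simp
  thus ?thesis by (simp add: vanishing_def)
qed

lemma vanishing_add:
  assumes "vanishing f" "vanishing g"
  shows "vanishing (\<lambda>\<alpha> R. f \<alpha> R + g \<alpha> R)"
  unfolding vanishing_def
proof (intro allI impI)
  fix e :: real assume e: "0 < e"
  obtain N where N: "\<And>j \<alpha>. j \<ge> N \<Longrightarrow> cmod (expect (\<mu> j) (f \<alpha>)) \<le> e / 2"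
    using assms(1) e unfolding vanishing_def by (meson half_gt_zero)
  obtain N' where N': "\<And>j \<alpha>. j \<ge> N' \<Longrightarrow> cmod (expect (\<mu> j) (g \<alpha>)) \<le> e / 2"
    using assms(2) e unfolding vanishing_def by (meson half_gt_zero)
  show "\<exists>N. \<forall>j\<ge>N. \<forall>\<alpha>. cmod (expect (\<mu> j) (\<lambda>R. f \<alpha> R + g \<alpha> R)) \<le> e"
  proof (intro exI[of _ "max N N'"] allI impI)
    fix j \<alpha> assume "max N N' \<le> j"
    thus "cmod (expect (\<mu> j) (\<lambda>R. f \<alpha> R + g \<alpha> R)) \<le> e"
      unfolding expect_add using norm_triangle_mono[OF N[of j \<alpha>] N'[of j \<alpha>]] by simp
  qed
qed

lemma vanishing_sum:
  assumes "\<And>k. k \<in> K' \<Longrightarrow> vanishing (\<lambda>\<alpha> R. f \<alpha> R k)"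
  shows "vanishing (\<lambda>\<alpha> R. \<Sum>k\<in>K'. f \<alpha> R k)"
proof (cases "finite K'")
  case True thus ?thesis using assms by (induct K') (auto intro: vanishing_add vanishing_0)
qed (simp add: vanishing_0)

lemma vanishing_jet: "k \<in> K \<Longrightarrow> jet D (X k) f f' \<Longrightarrow> vanishing f'"
  unfolding vanishing_def using expect_derivative_vanishes[OF min_seq directions] by metis

text \<open>The second component of the jet really is the derivative of the first in the hidden
  directions. The third component is treated separately in
  \<open>differentiable_field\<close>.\<close>

definition regular :: "nat \<Rightarrow> (real \<Rightarrow> complex mat \<Rightarrow> 'k jet_state) \<Rightarrow> bool" where
  "regular B J \<longleftrightarrow> (\<forall>k\<in>K. \<forall>q\<in>{..<B} \<times> {..<n}. jet D (X k) (\<lambda>\<alpha> R. fst (J \<alpha> R) q) (\<lambda>\<alpha> R. fst (snd (J \<alpha> R)) k q))"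

abbreviation field_step :: "nat \<Rightarrow> real \<Rightarrow> complex mat \<Rightarrow> step \<Rightarrow> 'k jet_state \<Rightarrow> 'k jet_state" where
  "field_step B \<alpha> R \<equiv> jet_step B n (\<eta> \<alpha> R) (\<kappa> \<alpha> R) (\<delta> \<alpha> R)"

lemma regularD:
  "regular B J \<Longrightarrow> k \<in> K \<Longrightarrow> j < B \<Longrightarrow> x < n \<Longrightarrow> jet D (X k) (\<lambda>\<alpha> R. fst (J \<alpha> R) (j,x)) (\<lambda>\<alpha> R. fst (snd (J \<alpha> R)) k (j,x))"
  by (auto simp: regular_def)

lemma regular_step:
  assumes "regular B J"
  shows "regular B (\<lambda>\<alpha> R. field_step B \<alpha> R s (J \<alpha> R))"
  unfolding regular_def
proof (intro ballI)
  fix k q assume k: "k \<in> K" and q: "q \<in> {..<B} \<times> {..<n}"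
  obtain j x where jx: "q = (j,x)" "j < B" "x < n" using q by auto
  show "jet D (X k) (\<lambda>\<alpha> R. fst (field_step B \<alpha> R s (J \<alpha> R)) q) (\<lambda>\<alpha> R. fst (snd (field_step B \<alpha> R s (J \<alpha> R))) k q)"
  proof (cases s)
    case (Fixed A)
    show ?thesis unfolding Fixed jet_step_proj apply_kernel_def
      using assms k by (intro jet_sum jet_cmult) (auto simp: regular_def)
  next
    case (Oracle S)
    have b: "jet D (X k) (\<lambda>\<alpha> R. bra n S (\<eta> \<alpha> R) (fst (J \<alpha> R)) j)
       (\<lambda>\<alpha> R. bra n S (\<delta> \<alpha> R k) (fst (J \<alpha> R)) j + bra n S (\<eta> \<alpha> R) (fst (snd (J \<alpha> R)) k) j)"
      by (intro jet_bra jet_\<eta> regularD[OF assms] k jx)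
    have 1: "jet D (X k) (\<lambda>\<alpha> R. if j \<in> S then - fst (J \<alpha> R) (j,x) else fst (J \<alpha> R) (j,x))
       (\<lambda>\<alpha> R. if j \<in> S then - fst (snd (J \<alpha> R)) k (j,x) else fst (snd (J \<alpha> R)) k (j,x))"
      using regularD[OF assms k jx(2,3)] jet_cmult[OF regularD[OF assms k jx(2,3)], of "-1"]
      by (cases "j \<in> S") simp_all
    have 2: "jet D (X k) (\<lambda>\<alpha> R. 2 * (\<eta> \<alpha> R x * bra n S (\<eta> \<alpha> R) (fst (J \<alpha> R)) j))
       (\<lambda>\<alpha> R. 2 * (\<delta> \<alpha> R k x * bra n S (\<eta> \<alpha> R) (fst (J \<alpha> R)) j + \<eta> \<alpha> R x *
          (bra n S (\<delta> \<alpha> R k) (fst (J \<alpha> R)) j + bra n S (\<eta> \<alpha> R) (fst (snd (J \<alpha> R)) k) j)))"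
      by (intro jet_cmult jet_mult b jet_\<eta> k jx)
    show ?thesis
      by (rule jet_eq[OF jet_add[OF 1 2]])
         (simp_all add: Oracle jet_step_proj refl_op_def refl_deriv_def jx algebra_simps)
  qed
qed

lemma regular_fold: "regular B J \<Longrightarrow> regular B (\<lambda>\<alpha> R. fold (field_step B \<alpha> R) ss (J \<alpha> R))"
proof (induct ss arbitrary: J)
  case (Cons s ss)
  show ?case using Cons(1)[OF regular_step[OF Cons(2)]] by simp
qed simp

text \<open>In the derivative of the antisymmetric combination the two terms with
  \<open>\<delta>\<close> in both bras cancel, and precisely \<open>exact_part\<close> is left.
  Integration by parts then makes its mean vanish.\<close>

lemma vanishing_exact_part:
  assumes "regular B \<chi>" "regular B \<psi>"
  shows "vanishing (\<lambda>\<alpha> R. \<Sum>k\<in>K. exact_part B n (\<eta> \<alpha> R) (\<delta> \<alpha> R) (\<delta>\<delta> \<alpha> R) S (\<chi> \<alpha> R) (\<psi> \<alpha> R) k)"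
proof (rule vanishing_sum)
  fix k assume k: "k \<in> K"
  let ?u = "\<lambda>\<alpha> R. fst (\<chi> \<alpha> R)" and ?d = "\<lambda>\<alpha> R. fst (snd (\<chi> \<alpha> R)) k"
  let ?v = "\<lambda>\<alpha> R. fst (\<psi> \<alpha> R)" and ?e = "\<lambda>\<alpha> R. fst (snd (\<psi> \<alpha> R)) k"
  have j: "jet D (X k) (\<lambda>\<alpha> R. block_inner B (bra n S (\<delta> \<alpha> R k) (?u \<alpha> R)) (bra n S (\<eta> \<alpha> R) (?v \<alpha> R))
       - block_inner B (bra n S (\<eta> \<alpha> R) (?u \<alpha> R)) (bra n S (\<delta> \<alpha> R k) (?v \<alpha> R)))
     (\<lambda>\<alpha> R. (block_inner B (\<lambda>j. bra n S (\<delta>\<delta> \<alpha> R k) (?u \<alpha> R) j + bra n S (\<delta> \<alpha> R k) (?d \<alpha> R) j) (bra n S (\<eta> \<alpha> R) (?v \<alpha> R))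
        + block_inner B (bra n S (\<delta> \<alpha> R k) (?u \<alpha> R)) (\<lambda>j. bra n S (\<delta> \<alpha> R k) (?v \<alpha> R) j + bra n S (\<eta> \<alpha> R) (?e \<alpha> R) j))
      - (block_inner B (\<lambda>j. bra n S (\<delta> \<alpha> R k) (?u \<alpha> R) j + bra n S (\<eta> \<alpha> R) (?d \<alpha> R) j) (bra n S (\<delta> \<alpha> R k) (?v \<alpha> R))
        + block_inner B (bra n S (\<eta> \<alpha> R) (?u \<alpha> R)) (\<lambda>j. bra n S (\<delta>\<delta> \<alpha> R k) (?v \<alpha> R) j + bra n S (\<delta> \<alpha> R k) (?e \<alpha> R) j)))"
    by (intro jet_diff jet_block_inner jet_bra jet_\<eta> jet_\<delta> regularD[OF assms(1)] regularD[OF assms(2)] k)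
  show "vanishing (\<lambda>\<alpha> R. exact_part B n (\<eta> \<alpha> R) (\<delta> \<alpha> R) (\<delta>\<delta> \<alpha> R) S (\<chi> \<alpha> R) (\<psi> \<alpha> R) k)"
    by (rule vanishing_jet[OF k], rule jet_eq[OF j refl])
       (simp add: exact_part_def block_inner_add case_prod_beta algebra_simps)
qed

text \<open>The steps are moved one by one from the right argument to the left. Fixed steps move for
  free; an oracle call costs 4 \<gamma> / lam times the two current energies. Whatever the position,
  forward and backward runs together contain at most all the calls, so these energies never exceed
  \<open>a + b\<close> plus the growth over the whole list; hence the bound is quadratic in the
  number of calls.\<close>

lemma pairing_telescope:
  assumes "regular B \<chi>" "regular B \<psi>" "\<forall>s\<in>set ss. valid_step B n s"
    and "\<And>\<alpha> R. R \<in> reflections \<Longrightarrow> state_norm B n (fst (\<chi> \<alpha> R)) \<le> 1"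
    and "\<And>\<alpha> R. R \<in> reflections \<Longrightarrow> state_norm B n (fst (\<psi> \<alpha> R)) \<le> 1"
    and "\<And>\<alpha> R. R \<in> reflections \<Longrightarrow> family_norm K B n (fst (snd (\<chi> \<alpha> R))) \<le> a"
    and "\<And>\<alpha> R. R \<in> reflections \<Longrightarrow> family_norm K B n (fst (snd (\<psi> \<alpha> R))) \<le> b"
    and nonneg: "0 \<le> \<gamma>" "0 < lam" "0 \<le> \<Lambda>"
  shows "\<exists>\<tau>. vanishing \<tau> \<and> (\<forall>\<alpha>. \<forall>R\<in>reflections.
     cmod (pairing B n K lam (\<chi> \<alpha> R) (fold (field_step B \<alpha> R) ss (\<psi> \<alpha> R))
       - pairing B n K lam (fold (field_step B \<alpha> R) (rev (map step_adj ss)) (\<chi> \<alpha> R)) (\<psi> \<alpha> R) + (2 * \<i> / lam) * \<tau> \<alpha> R)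
     \<le> oracle_count ss * (4 * \<gamma> / lam) * (a + b + oracle_count ss * (2 * (\<Lambda> + \<gamma>))))"
  using assms(2,3,5,7)
proof (induct ss arbitrary: \<psi> b)
  case Nil
  show ?case by (intro exI[of _ "\<lambda>_ _. 0"]) (simp add: vanishing_0)
next
  case (Cons s ss)
  let ?G = "2 * (\<Lambda> + \<gamma>)"
  define \<psi>' where "\<psi>' = (\<lambda>\<alpha> R. field_step B \<alpha> R s (\<psi> \<alpha> R))"
  define \<chi>' where "\<chi>' = (\<lambda>\<alpha> R. fold (field_step B \<alpha> R) (rev (map step_adj ss)) (\<chi> \<alpha> R))"
  have v: "valid_step B n s" "\<forall>s\<in>set ss. valid_step B n s" "\<forall>s\<in>set (rev (map step_adj ss)). valid_step B n s"
    using Cons(3) valid_step_adj by auto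
  have step: "state_norm B n (fst (\<psi>' \<alpha> R)) \<le> 1" "family_norm K B n (fst (snd (\<psi>' \<alpha> R))) \<le> b + oracle_count [s] * ?G"
    if R: "R \<in> reflections" for \<alpha> R
  proof -
    interpret oracle_point n K "\<eta> \<alpha> R" "\<kappa> \<alpha> R" "\<delta> \<alpha> R" "\<delta>\<delta> \<alpha> R" lam \<gamma> \<Lambda> by (rule point[OF R])
    show "state_norm B n (fst (\<psi>' \<alpha> R)) \<le> 1" unfolding \<psi>'_def jet_step_norms(1)[OF v(1)] by (rule Cons(4)[OF R])
    have "oracle_count [s] * ?G * state_norm B n (fst (\<psi> \<alpha> R)) \<le> oracle_count [s] * ?G * 1"
      using nonneg by (intro mult_left_mono Cons(4) R) auto
    thus "family_norm K B n (fst (snd (\<psi>' \<alpha> R))) \<le> b + oracle_count [s] * ?G"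
      using jet_step_norms(2)[OF v(1), of "\<psi> \<alpha> R"] Cons(5)[OF R, of \<alpha>] unfolding \<psi>'_def by linarith
  qed
  have bwd: "state_norm B n (fst (\<chi>' \<alpha> R)) \<le> 1" "family_norm K B n (fst (snd (\<chi>' \<alpha> R))) \<le> a + oracle_count ss * ?G"
    if R: "R \<in> reflections" for \<alpha> R
  proof -
    interpret oracle_point n K "\<eta> \<alpha> R" "\<kappa> \<alpha> R" "\<delta> \<alpha> R" "\<delta>\<delta> \<alpha> R" lam \<gamma> \<Lambda> by (rule point[OF R])
    show "state_norm B n (fst (\<chi>' \<alpha> R)) \<le> 1" unfolding \<chi>'_def fold_norms(1)[OF v(3)] by (rule assms(4)[OF R])
    have "oracle_count ss * ?G * state_norm B n (fst (\<chi> \<alpha> R)) \<le> oracle_count ss * ?G * 1"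
      using nonneg by (intro mult_left_mono assms(4) R) auto
    thus "family_norm K B n (fst (snd (\<chi>' \<alpha> R))) \<le> a + oracle_count ss * ?G"
      using fold_norms(2)[OF v(3), of "\<chi> \<alpha> R"] assms(6)[OF R, of \<alpha>] unfolding \<chi>'_def oracle_count_rev_adj by linarith
  qed
  have reg: "regular B \<psi>'" "regular B \<chi>'"
    unfolding \<psi>'_def \<chi>'_def by (intro regular_step regular_fold Cons(2) assms(1))+
  obtain \<tau> where \<tau>: "vanishing \<tau>" "\<And>\<alpha> R. R \<in> reflections \<Longrightarrow>
     cmod (pairing B n K lam (\<chi> \<alpha> R) (fold (field_step B \<alpha> R) ss (\<psi>' \<alpha> R))
       - pairing B n K lam (\<chi>' \<alpha> R) (\<psi>' \<alpha> R) + (2 * \<i> / lam) * \<tau> \<alpha> R)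
     \<le> oracle_count ss * (4 * \<gamma> / lam) * (a + (b + oracle_count [s] * ?G) + oracle_count ss * ?G)"
    using Cons(1)[OF reg(1) v(2) step] unfolding \<chi>'_def by blast
  have c: "oracle_count (s # ss) = oracle_count [s] + oracle_count ss"
    using oracle_count_append[of "[s]" ss] by simp
  have f: "fold (field_step B \<alpha> R) (s # ss) (\<psi> \<alpha> R) = fold (field_step B \<alpha> R) ss (\<psi>' \<alpha> R)"
    "fold (field_step B \<alpha> R) (rev (map step_adj (s # ss))) (\<chi> \<alpha> R) = field_step B \<alpha> R (step_adj s) (\<chi>' \<alpha> R)" for \<alpha> R
    by (simp_all add: \<psi>'_def \<chi>'_def)
  show ?case
  proof (cases s)
    case (Fixed A)
    have "pairing B n K lam (\<chi>' \<alpha> R) (\<psi>' \<alpha> R) = pairing B n K lam (field_step B \<alpha> R (step_adj s) (\<chi>' \<alpha> R)) (\<psi> \<alpha> R)"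
      if R: "R \<in> reflections" for \<alpha> R
    proof -
      interpret oracle_point n K "\<eta> \<alpha> R" "\<kappa> \<alpha> R" "\<delta> \<alpha> R" "\<delta>\<delta> \<alpha> R" lam \<gamma> \<Lambda> by (rule point[OF R])
      show ?thesis unfolding \<psi>'_def Fixed step_adj.simps
        by (cases "\<chi>' \<alpha> R"; cases "\<psi> \<alpha> R") (simp only: pairing_fixed_step)
    qed
    thus ?thesis using \<tau> unfolding f by (intro exI[of _ \<tau>]) (simp add: Fixed algebra_simps)
  next
    case (Oracle S)
    define \<rho> where "\<rho> = (\<lambda>\<alpha> R. \<Sum>k\<in>K. exact_part B n (\<eta> \<alpha> R) (\<delta> \<alpha> R) (\<delta>\<delta> \<alpha> R) S (\<chi>' \<alpha> R) (\<psi> \<alpha> R) k)"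
    have \<rho>: "vanishing \<rho>" unfolding \<rho>_def by (intro vanishing_exact_part reg Cons(2))
    show ?thesis
    proof (intro exI[of _ "\<lambda>\<alpha> R. \<tau> \<alpha> R + \<rho> \<alpha> R"] conjI vanishing_add \<tau>(1) \<rho> allI ballI)
      fix \<alpha> R assume R: "R \<in> reflections"
      interpret oracle_point n K "\<eta> \<alpha> R" "\<kappa> \<alpha> R" "\<delta> \<alpha> R" "\<delta>\<delta> \<alpha> R" lam \<gamma> \<Lambda> by (rule point[OF R])
      have id: "(p - c + w * t) + (c - q + w * r) = p - q + w * (t + r)" for p c w t q r :: complex
        by (simp add: algebra_simps)
      have "cmod (pairing B n K lam (\<chi>' \<alpha> R) (\<psi>' \<alpha> R)
         - pairing B n K lam (field_step B \<alpha> R (step_adj s) (\<chi>' \<alpha> R)) (\<psi> \<alpha> R) + (2 * \<i> / lam) * \<rho> \<alpha> R)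
        \<le> (4 * \<gamma> / lam) * (family_norm K B n (fst (snd (\<chi>' \<alpha> R))) + family_norm K B n (fst (snd (\<psi> \<alpha> R))))"
        unfolding \<psi>'_def \<rho>_def Oracle step_adj.simps by (intro pairing_oracle_step_le bwd Cons(4) R)
      also have "\<dots> \<le> (4 * \<gamma> / lam) * (a + oracle_count ss * ?G + b)"
        using nonneg bwd(2)[OF R, of \<alpha>] Cons(5)[OF R, of \<alpha>] by (intro mult_left_mono) auto
      finally have 1: "cmod (pairing B n K lam (\<chi>' \<alpha> R) (\<psi>' \<alpha> R)
         - pairing B n K lam (field_step B \<alpha> R (step_adj s) (\<chi>' \<alpha> R)) (\<psi> \<alpha> R) + (2 * \<i> / lam) * \<rho> \<alpha> R)
        \<le> (4 * \<gamma> / lam) * (a + oracle_count ss * ?G + b)" .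
      have "cmod ((pairing B n K lam (\<chi> \<alpha> R) (fold (field_step B \<alpha> R) ss (\<psi>' \<alpha> R))
       - pairing B n K lam (\<chi>' \<alpha> R) (\<psi>' \<alpha> R) + (2 * \<i> / lam) * \<tau> \<alpha> R) + 
         (pairing B n K lam (\<chi>' \<alpha> R) (\<psi>' \<alpha> R)
         - pairing B n K lam (field_step B \<alpha> R (step_adj s) (\<chi>' \<alpha> R)) (\<psi> \<alpha> R) + (2 * \<i> / lam) * \<rho> \<alpha> R))
        \<le> oracle_count ss * (4 * \<gamma> / lam) * (a + (b + oracle_count [s] * ?G) + oracle_count ss * ?G)
         + (4 * \<gamma> / lam) * (a + oracle_count ss * ?G + b)"
        by (intro norm_triangle_mono 1 \<tau>(2) R)
      also have "\<dots> \<le> oracle_count ss * (4 * \<gamma> / lam) * (a + (b + oracle_count [s] * ?G) + oracle_count ss * ?G)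
         + (4 * \<gamma> / lam) * (a + b + oracle_count (s # ss) * ?G)"
        using nonneg unfolding c by (intro add_left_mono mult_left_mono) (auto simp: algebra_simps)
      also have "\<dots> = oracle_count (s # ss) * (4 * \<gamma> / lam) * (a + b + oracle_count (s # ss) * ?G)"
      proof -
        have "x * g * (a + (b + 1 * h) + x * h) + g * (a + b + (1 + x) * h) = (1 + x) * g * (a + b + (1 + x) * h)" for x g h :: real
          by (simp add: algebra_simps)
        moreover have "real (oracle_count [s]) = 1" "real (oracle_count (s # ss)) = 1 + real (oracle_count ss)"
          by (simp_all add: Oracle)
        ultimately show ?thesis by presburger
      qed
      finally show "cmod (pairing B n K lam (\<chi> \<alpha> R) (fold (field_step B \<alpha> R) (s # ss) (\<psi> \<alpha> R))
       - pairing B n K lam (fold (field_step B \<alpha> R) (rev (map step_adj (s # ss))) (\<chi> \<alpha> R)) (\<psi> \<alpha> R) + (2 * \<i> / lam) * (\<tau> \<alpha> R + \<rho> \<alpha> R))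
     \<le> oracle_count (s # ss) * (4 * \<gamma> / lam) * (a + b + oracle_count (s # ss) * ?G)"
        unfolding f id .
    qed
  qed
qed

section \<open>Differentiation in the angle and variation of the acceptance probability\<close>

definition differentiable_field :: "nat \<Rightarrow> (real \<Rightarrow> complex mat \<Rightarrow> 'k jet_state) \<Rightarrow> bool" where
  "differentiable_field B J \<longleftrightarrow> (\<forall>R\<in>reflections. \<forall>q\<in>{..<B} \<times> {..<n}. \<forall>\<alpha>.
     ((\<lambda>\<alpha>. fst (J \<alpha> R) q) has_vector_derivative snd (snd (J \<alpha> R)) q) (at \<alpha>))"

lemma differentiable_field_step:
  assumes J: "differentiable_field B J"
  shows "differentiable_field B (\<lambda>\<alpha> R. field_step B \<alpha> R s (J \<alpha> R))"
  unfolding differentiable_field_def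
proof (intro ballI allI)
  fix R q \<alpha> assume R: "R \<in> reflections" and q: "q \<in> {..<B} \<times> {..<n}"
  have d: "((\<lambda>\<alpha>. fst (J \<alpha> R) q) has_vector_derivative snd (snd (J \<alpha> R)) q) (at \<alpha>)" if "q \<in> {..<B} \<times> {..<n}" for q
    using J R that by (auto simp: differentiable_field_def)
  obtain j x where jx: "q = (j,x)" "j < B" "x < n" using q by auto
  show "((\<lambda>\<alpha>. fst (field_step B \<alpha> R s (J \<alpha> R)) q) has_vector_derivative snd (snd (field_step B \<alpha> R s (J \<alpha> R))) q) (at \<alpha>)"
  proof (cases s)
    case (Fixed A)
    show ?thesis unfolding Fixed jet_step_proj apply_kernel_def
      by (intro has_vector_derivative_sum bounded_linear.has_vector_derivative[OF bounded_linear_mult_right] d)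
  next
    case (Oracle S)
    have b: "((\<lambda>\<alpha>. bra n S (\<eta> \<alpha> R) (fst (J \<alpha> R)) j) has_vector_derivative
        bra n S (\<lambda>x. \<i> * \<kappa> \<alpha> R x) (fst (J \<alpha> R)) j + bra n S (\<eta> \<alpha> R) (snd (snd (J \<alpha> R))) j) (at \<alpha>)"
      by (intro has_vector_derivative_bra deriv_\<eta> R d) (use jx in auto)
    have 1: "((\<lambda>\<alpha>. if j \<in> S then - fst (J \<alpha> R) q else fst (J \<alpha> R) q) has_vector_derivative
       (if j \<in> S then - snd (snd (J \<alpha> R)) q else snd (snd (J \<alpha> R)) q)) (at \<alpha>)"
      using d[OF q] by (auto intro: has_vector_derivative_minus)
    have 2: "((\<lambda>\<alpha>. 2 * (\<eta> \<alpha> R x * bra n S (\<eta> \<alpha> R) (fst (J \<alpha> R)) j)) has_vector_derivative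
       2 * (\<eta> \<alpha> R x * (bra n S (\<lambda>x. \<i> * \<kappa> \<alpha> R x) (fst (J \<alpha> R)) j + bra n S (\<eta> \<alpha> R) (snd (snd (J \<alpha> R))) j)
         + \<i> * \<kappa> \<alpha> R x * bra n S (\<eta> \<alpha> R) (fst (J \<alpha> R)) j)) (at \<alpha>)"
      by (intro bounded_linear.has_vector_derivative[OF bounded_linear_mult_right] has_vector_derivative_mult deriv_\<eta> R b jx)
    have e1: "(\<lambda>\<alpha>. fst (field_step B \<alpha> R s (J \<alpha> R)) q) = (\<lambda>\<alpha>. (if j \<in> S then - fst (J \<alpha> R) q else fst (J \<alpha> R) q)
        + 2 * (\<eta> \<alpha> R x * bra n S (\<eta> \<alpha> R) (fst (J \<alpha> R)) j))"
      unfolding Oracle jet_step_proj refl_op_def by (simp add: jx)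
    have e2: "snd (snd (field_step B \<alpha> R s (J \<alpha> R))) q = (if j \<in> S then - snd (snd (J \<alpha> R)) q else snd (snd (J \<alpha> R)) q)
       + 2 * (\<eta> \<alpha> R x * (bra n S (\<lambda>x. \<i> * \<kappa> \<alpha> R x) (fst (J \<alpha> R)) j + bra n S (\<eta> \<alpha> R) (snd (snd (J \<alpha> R))) j)
         + \<i> * \<kappa> \<alpha> R x * bra n S (\<eta> \<alpha> R) (fst (J \<alpha> R)) j)"
      by (simp add: Oracle jet_step_proj refl_op_def refl_deriv_def jx algebra_simps)
    show ?thesis unfolding e1 e2 by (rule has_vector_derivative_add[OF 1 2])
  qed
qed

lemma differentiable_field_fold:
  "differentiable_field B J \<Longrightarrow> differentiable_field B (\<lambda>\<alpha> R. fold (field_step B \<alpha> R) ss (J \<alpha> R))"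
proof (induct ss arbitrary: J)
  case (Cons s ss)
  show ?case using Cons(1)[OF differentiable_field_step[OF Cons(2)]] by simp
qed simp


text \<open>With the measurement inserted as the projector \<open>cut\<close>, the
  \<alpha>-derivative of the probability is twice the real part of a pairing with the final jet.
  Telescoping replaces that jet by the initial one, whose derivatives are all zero, so nothing but
  the accumulated errors survives.\<close>

lemma acceptance_variation:
  fixes B :: nat and Acc :: "(nat \<times> nat) set" and u0 :: state and ss :: "step list"
  defines "final \<equiv> \<lambda>\<alpha> R. fold (field_step B \<alpha> R) ss (u0, \<lambda>_ _. 0, \<lambda>_. 0)"
  defines "P \<equiv> \<lambda>\<alpha> R. \<Sum>q\<in>{..<B} \<times> {..<n}. if q \<in> Acc then (cmod (fst (final \<alpha> R) q))\<^sup>2 else 0"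
  defines "E \<equiv> \<lambda>j \<alpha>. Re (expect (\<mu> j) (\<lambda>R. complex_of_real (P \<alpha> R)))"
  assumes ss: "\<forall>s\<in>set ss. valid_step B n s" and u0: "state_norm B n u0 \<le> 1"
    and nonneg: "0 \<le> \<gamma>" "0 < lam" "0 \<le> \<Lambda>" and e: "0 < e"
  shows "\<exists>j. \<bar>E j (pi / 2) - E j 0\<bar> \<le> pi * (16 * \<gamma> * (\<Lambda> + \<gamma>) * (real (oracle_count ss))\<^sup>2 / lam) + e"
proof -
  let ?T = "real (oracle_count ss)"
  let ?G = "2 * (\<Lambda> + \<gamma>)"
  define cut :: "state \<Rightarrow> state" where "cut = (\<lambda>u q. if q \<in> Acc then u q else 0)"
  define J0 :: "real \<Rightarrow> complex mat \<Rightarrow> 'k jet_state" where "J0 = (\<lambda>_ _. (u0, \<lambda>_ _. 0, \<lambda>_. 0))"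
  have final: "final = (\<lambda>\<alpha> R. fold (field_step B \<alpha> R) ss (J0 \<alpha> R))" by (simp add: final_def J0_def)
  \<comment> \<open>The third component is a dummy: the pairing reads the \<alpha>-derivative of its
    right argument only.\<close>
  define \<chi> :: "real \<Rightarrow> complex mat \<Rightarrow> 'k jet_state" where
    "\<chi> = (\<lambda>\<alpha> R. (cut (fst (final \<alpha> R)), \<lambda>k. cut (fst (snd (final \<alpha> R)) k), \<lambda>_. 0))"
  have z: "jet D Y (\<lambda>\<alpha> R. c) (\<lambda>\<alpha> R. 0)" for Y c by (rule jet_const[of _ "cmod c"]) simp
  have reg0: "regular B J0" by (simp add: regular_def J0_def z)
  hence regf: "regular B final" unfolding final by (rule regular_fold)
  have reg\<chi>: "regular B \<chi>" unfolding regular_def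
  proof (intro ballI)
    fix k q assume "k \<in> K" "q \<in> {..<B} \<times> {..<n}"
    thus "jet D (X k) (\<lambda>\<alpha> R. fst (\<chi> \<alpha> R) q) (\<lambda>\<alpha> R. fst (snd (\<chi> \<alpha> R)) k q)"
      using regf z[of "X k" 0] by (cases "q \<in> Acc") (auto simp: \<chi>_def cut_def regular_def)
  qed
  have norms: "state_norm B n (fst (final \<alpha> R)) \<le> 1" "family_norm K B n (fst (snd (final \<alpha> R))) \<le> ?T * ?G"
    if R: "R \<in> reflections" for \<alpha> R
  proof -
    interpret oracle_point n K "\<eta> \<alpha> R" "\<kappa> \<alpha> R" "\<delta> \<alpha> R" "\<delta>\<delta> \<alpha> R" lam \<gamma> \<Lambda> by (rule point[OF R])
    show "state_norm B n (fst (final \<alpha> R)) \<le> 1" unfolding final fold_norms(1)[OF ss] using u0 by (simp add: J0_def)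
    have "family_norm K B n (\<lambda>k q. 0) = 0" by (simp add: family_norm_def L2_set_def case_prod_beta)
    moreover have "?T * ?G * state_norm B n u0 \<le> ?T * ?G * 1" using nonneg u0 by (intro mult_left_mono) auto
    ultimately show "family_norm K B n (fst (snd (final \<alpha> R))) \<le> ?T * ?G"
      using fold_norms(2)[OF ss, of "J0 \<alpha> R"] unfolding final by (simp add: J0_def)
  qed
  have cut1: "state_norm B n (cut u) \<le> state_norm B n u" for u
    unfolding state_norm_def by (rule L2_set_mono) (auto simp: cut_def)
  have cut2: "family_norm K B n (\<lambda>k. cut (d k)) \<le> family_norm K B n d" for d
    unfolding family_norm_def by (rule L2_set_mono) (auto simp: cut_def)
  have "\<exists>\<tau>. vanishing \<tau> \<and> (\<forall>\<alpha>. \<forall>R\<in>reflections.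
     cmod (pairing B n K lam (\<chi> \<alpha> R) (fold (field_step B \<alpha> R) ss (J0 \<alpha> R))
       - pairing B n K lam (fold (field_step B \<alpha> R) (rev (map step_adj ss)) (\<chi> \<alpha> R)) (J0 \<alpha> R) + (2 * \<i> / lam) * \<tau> \<alpha> R)
     \<le> ?T * (4 * \<gamma> / lam) * (?T * ?G + 0 + ?T * ?G))"
  proof (rule pairing_telescope[OF reg\<chi> reg0 ss _ _ _ _ nonneg])
    fix \<alpha> R assume R: "R \<in> reflections"
    show "state_norm B n (fst (\<chi> \<alpha> R)) \<le> 1" using norms(1)[OF R, of \<alpha>] cut1 order_trans by (auto simp: \<chi>_def)
    show "state_norm B n (fst (J0 \<alpha> R)) \<le> 1" using u0 by (simp add: J0_def)
    show "family_norm K B n (fst (snd (\<chi> \<alpha> R))) \<le> ?T * ?G"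
      unfolding \<chi>_def fst_conv snd_conv by (rule order_trans[OF cut2 norms(2)[OF R]])
    show "family_norm K B n (fst (snd (J0 \<alpha> R))) \<le> 0" by (simp add: J0_def family_norm_def L2_set_def case_prod_beta)
  qed
  moreover have p0: "pairing B n K lam J (J0 \<alpha> R) = 0" for J \<alpha> R
    by (cases J) (simp add: J0_def inner_def)
  ultimately obtain \<tau> where \<tau>: "vanishing \<tau>" "\<And>\<alpha> R. R \<in> reflections \<Longrightarrow>
     cmod (pairing B n K lam (\<chi> \<alpha> R) (final \<alpha> R) + (2 * \<i> / lam) * \<tau> \<alpha> R) \<le> ?T * (4 * \<gamma> / lam) * (?T * ?G + 0 + ?T * ?G)"
    unfolding final p0 by auto
  \<comment> \<open>One \<open>?T * ?G\<close> is the energy that \<open>\<chi>\<close> inherits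
    from the complete forward run; the other is the growth while the steps are moved across.\<close>
  define r where "r = ?T * (4 * \<gamma> / lam) * (?T * ?G + 0 + ?T * ?G)"
  \<comment> \<open>The mean value theorem will contribute the factor pi: an interval of length pi /
    2 times the 2 in front of the real part.\<close>
  define e' where "e' = e / pi"
  have e': "0 < e'" using e by (simp add: e'_def)
  \<comment> \<open>The vanishing term \<open>\<tau>\<close> enters the pairing with the factor 2 /
    lam.\<close>
  have "0 < e' * lam / 2" using e' nonneg by simp
  then obtain j where j: "\<And>\<alpha>. cmod (expect (\<mu> j) (\<tau> \<alpha>)) \<le> e' * lam / 2"
    using \<tau>(1) unfolding vanishing_def by blast
  have prob: "prob_list reflections (\<mu> j)" using min_seq by (auto simp: min_seq_def)
  define p' where "p' = (\<lambda>\<alpha>. expect (\<mu> j) (\<lambda>R. pairing B n K lam (\<chi> \<alpha> R) (final \<alpha> R)))"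
  have p'le: "cmod (p' \<alpha>) \<le> r + e'" for \<alpha>
  proof -
    have "cmod (expect (\<mu> j) (\<lambda>R. pairing B n K lam (\<chi> \<alpha> R) (final \<alpha> R) + (2 * \<i> / lam) * \<tau> \<alpha> R)) \<le> r"
      unfolding r_def by (rule expect_bound[OF prob \<tau>(2)])
    hence 1: "cmod (p' \<alpha> + (2 * \<i> / lam) * expect (\<mu> j) (\<tau> \<alpha>)) \<le> r"
      by (simp only: expect_add expect_cmult p'_def)
    have "cmod ((2 * \<i> / lam) * expect (\<mu> j) (\<tau> \<alpha>)) = (2 / lam) * cmod (expect (\<mu> j) (\<tau> \<alpha>))"
      using nonneg by (simp add: norm_mult norm_divide)
    also have "\<dots> \<le> (2 / lam) * (e' * lam / 2)" using nonneg by (intro mult_left_mono j) auto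
    also have "\<dots> = e'" using nonneg by simp
    finally show ?thesis using 1 norm_triangle_ineq4[of "p' \<alpha> + (2 * \<i> / lam) * expect (\<mu> j) (\<tau> \<alpha>)" "(2 * \<i> / lam) * expect (\<mu> j) (\<tau> \<alpha>)"]
      by simp
  qed
  have deriv: "(E j has_real_derivative 2 * Re (p' \<alpha>)) (at \<alpha>)" for \<alpha>
  proof -
    have dP: "((\<lambda>\<alpha>. complex_of_real (P \<alpha> R)) has_vector_derivative
        complex_of_real (2 * Re (pairing B n K lam (\<chi> \<alpha> R) (final \<alpha> R)))) (at \<alpha>)" if R: "R \<in> reflections" for R
    proof -
      let ?u = "\<lambda>\<alpha>. fst (final \<alpha> R)" and ?a = "snd (snd (final \<alpha> R))"
      have d: "((\<lambda>\<alpha>. ?u \<alpha> q) has_vector_derivative ?a q) (at \<alpha>)" if "q \<in> {..<B} \<times> {..<n}" for q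
      proof -
        have "differentiable_field B J0" by (simp add: differentiable_field_def J0_def)
        from differentiable_field_fold[OF this, of ss] show ?thesis
          using that R unfolding final differentiable_field_def by blast
      qed
      have "((\<lambda>\<alpha>. \<Sum>q\<in>{..<B} \<times> {..<n}. if q \<in> Acc then cnj (?u \<alpha> q) * ?u \<alpha> q else 0) has_vector_derivative
        (\<Sum>q\<in>{..<B} \<times> {..<n}. if q \<in> Acc then cnj (?u \<alpha> q) * ?a q + cnj (?a q) * ?u \<alpha> q else 0)) (at \<alpha>)"
      proof (rule has_vector_derivative_sum)
        fix q assume "q \<in> {..<B} \<times> {..<n}"
        thus "((\<lambda>\<alpha>. if q \<in> Acc then cnj (?u \<alpha> q) * ?u \<alpha> q else 0) has_vector_derivative
          (if q \<in> Acc then cnj (?u \<alpha> q) * ?a q + cnj (?a q) * ?u \<alpha> q else 0)) (at \<alpha>)"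
          by (cases "q \<in> Acc") (auto intro!: has_vector_derivative_mult has_vector_derivative_cnj_comp d)
      qed
      moreover have "(\<lambda>\<alpha>. \<Sum>q\<in>{..<B} \<times> {..<n}. if q \<in> Acc then cnj (?u \<alpha> q) * ?u \<alpha> q else 0) = (\<lambda>\<alpha>. complex_of_real (P \<alpha> R))"
        unfolding P_def of_real_sum by (intro ext sum.cong refl) (simp add: complex_norm_square mult.commute del: of_real_power)
      moreover have "(\<Sum>q\<in>{..<B} \<times> {..<n}. if q \<in> Acc then cnj (?u \<alpha> q) * ?a q + cnj (?a q) * ?u \<alpha> q else 0)
         = complex_of_real (2 * Re (pairing B n K lam (\<chi> \<alpha> R) (final \<alpha> R)))"
      proof -
        \<comment> \<open>A projector has real diagonal inner products, so the term with the factor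
          i drops out of the real part.\<close>
        have "cnj (inner B n (cut v) v) = inner B n (cut v) v" for v
          unfolding inner_def cnj_sum by (intro sum.cong refl) (simp add: cut_def)
        hence im: "Im (inner B n (cut v) v) = 0" for v by (metis Reals_cnj_iff complex_is_Real_iff)
        obtain u d a where f: "final \<alpha> R = (u,d,a)" by (cases "final \<alpha> R")
        have "Re (pairing B n K lam (\<chi> \<alpha> R) (final \<alpha> R)) = Re (inner B n (cut u) a)"
          by (simp add: \<chi>_def f im Im_sum)
        moreover have "(\<Sum>q\<in>{..<B} \<times> {..<n}. if q \<in> Acc then cnj (u q) * a q + cnj (a q) * u q else 0)
           = inner B n (cut u) a + cnj (inner B n (cut u) a)"
          unfolding inner_def cnj_sum sum.distrib[symmetric] by (intro sum.cong refl) (auto simp: cut_def)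
        ultimately show ?thesis by (simp add: f complex_add_cnj cong: if_cong)
      qed
      ultimately show ?thesis by simp
    qed
    have "((\<lambda>\<alpha>. expect (\<mu> j) (\<lambda>R. complex_of_real (P \<alpha> R))) has_vector_derivative
        expect (\<mu> j) (\<lambda>R. complex_of_real (2 * Re (pairing B n K lam (\<chi> \<alpha> R) (final \<alpha> R))))) (at \<alpha>)"
      by (rule has_vector_derivative_expect) (use dP prob_list_subset[OF prob] in blast)
    from bounded_linear.has_vector_derivative[OF bounded_linear_Re this]
    have dE: "(E j has_vector_derivative Re (expect (\<mu> j) (\<lambda>R. complex_of_real (2 * Re (pairing B n K lam (\<chi> \<alpha> R) (final \<alpha> R)))))) (at \<alpha>)"
      by (simp add: E_def)
    have re: "Re (expect \<nu> (\<lambda>R. complex_of_real (2 * Re (f R)))) = 2 * Re (expect \<nu> f)"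
      if "\<forall>(a,R)\<in>set \<nu>. a \<in> \<real>" for \<nu> :: "(complex \<times> complex mat) list" and f
      using that by (induct \<nu>) (auto simp: complex_is_Real_iff)
    have "\<forall>(a,R)\<in>set (\<mu> j). a \<in> \<real>" using prob by (auto simp: prob_list_def)
    from re[OF this] have "Re (expect (\<mu> j) (\<lambda>R. complex_of_real (2 * Re (pairing B n K lam (\<chi> \<alpha> R) (final \<alpha> R))))) = 2 * Re (p' \<alpha>)"
      unfolding p'_def .
    thus ?thesis using dE unfolding has_real_derivative_iff_has_vector_derivative by (rule subst)
  qed
  obtain \<xi> where \<xi>: "E j (pi / 2) - E j 0 = (pi / 2 - 0) * (2 * Re (p' \<xi>))"
    using MVT2[of 0 "pi / 2" "E j" "\<lambda>\<alpha>. 2 * Re (p' \<alpha>)"] deriv by auto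
  have "\<bar>E j (pi / 2) - E j 0\<bar> = pi * \<bar>Re (p' \<xi>)\<bar>" unfolding \<xi> by (simp add: abs_mult)
  also have "\<dots> \<le> pi * (r + e')" using p'le[of \<xi>] abs_Re_le_cmod[of "p' \<xi>"] by (intro mult_left_mono) auto
  also have "\<dots> = pi * (16 * \<gamma> * (\<Lambda> + \<gamma>) * ?T\<^sup>2 / lam) + e"
  proof -
    have "r = 16 * \<gamma> * (\<Lambda> + \<gamma>) * ?T\<^sup>2 / lam"
      using nonneg by (simp add: r_def power2_eq_square field_simps)
    thus ?thesis by (simp add: e'_def distrib_left)
  qed
  finally show ?thesis by blast
qed

end

section \<open>The hidden reflections\<close>

text \<open>The coefficients make the family over all pairs an orthonormal basis of the skew-Hermitian matrices:
  \<open>\<Sum>\<^sub>k X\<^sub>k \<otimes> X\<^sub>k\<close> is minus the swap.\<close>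
definition gen :: "nat \<Rightarrow> nat \<times> nat \<Rightarrow> complex mat" where
  "gen D k = mat D D (\<lambda>(i,j). (if i = fst k \<and> j = snd k then (1 + \<i>) / 2 else 0)
     + (if i = snd k \<and> j = fst k then (\<i> - 1) / 2 else 0))"

lemma gen_carrier [simp]: "gen D k \<in> carrier_mat D D" "dim_row (gen D k) = D" "dim_col (gen D k) = D"
  by (auto simp: gen_def)

lemma gen_index: "i < D \<Longrightarrow> j < D \<Longrightarrow> gen D (a,b) $$ (i,j) =
    (if i = a then (if j = b then (1 + \<i>) / 2 else 0) else 0) + (if i = b then (if j = a then (\<i> - 1) / 2 else 0) else 0)"
  by (simp add: gen_def)

lemma gen_skew:
  assumes "i < D" "j < D"
  shows "cnj (gen D k $$ (i,j)) = - gen D k $$ (j,i)"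
  using assms by (cases k) (auto simp: gen_index complex_eq_iff)

lemma gen_mult_left:
  assumes "a < D" "b < D" "A \<in> carrier_mat D D" "i < D" "j < D"
  shows "(gen D (a,b) * A) $$ (i,j) = (if i = a then (1 + \<i>) / 2 * A $$ (b,j) else 0) + (if i = b then (\<i> - 1) / 2 * A $$ (a,j) else 0)"
proof -
  have "(gen D (a,b) * A) $$ (i,j) = (\<Sum>l<D. gen D (a,b) $$ (i,l) * A $$ (l,j))"
    using assms by (auto simp: index_mult_mat_sum simp del: index_mult_mat(1))
  also have "\<dots> = (\<Sum>l<D. (if l = b then (if i = a then (1 + \<i>) / 2 * A $$ (b,j) else 0) else 0)
      + (if l = a then (if i = b then (\<i> - 1) / 2 * A $$ (a,j) else 0) else 0))"
    using assms by (intro sum.cong refl) (auto simp: gen_index algebra_simps add_divide_distrib diff_divide_distrib)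
  also have "\<dots> = (if i = a then (1 + \<i>) / 2 * A $$ (b,j) else 0) + (if i = b then (\<i> - 1) / 2 * A $$ (a,j) else 0)"
    using assms by (simp add: sum.distrib)
  finally show ?thesis .
qed

lemma gen_mult_right:
  assumes "a < D" "b < D" "A \<in> carrier_mat D D" "i < D" "j < D"
  shows "(A * gen D (a,b)) $$ (i,j) = (if j = b then (1 + \<i>) / 2 * A $$ (i,a) else 0) + (if j = a then (\<i> - 1) / 2 * A $$ (i,b) else 0)"
proof -
  have "(A * gen D (a,b)) $$ (i,j) = (\<Sum>l<D. A $$ (i,l) * gen D (a,b) $$ (l,j))"
    using assms by (auto simp: index_mult_mat_sum simp del: index_mult_mat(1))
  also have "\<dots> = (\<Sum>l<D. (if l = a then (if j = b then (1 + \<i>) / 2 * A $$ (i,a) else 0) else 0)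
      + (if l = b then (if j = a then (\<i> - 1) / 2 * A $$ (i,b) else 0) else 0))"
    using assms by (intro sum.cong refl) (auto simp: gen_index algebra_simps add_divide_distrib diff_divide_distrib)
  also have "\<dots> = (if j = b then (1 + \<i>) / 2 * A $$ (i,a) else 0) + (if j = a then (\<i> - 1) / 2 * A $$ (i,b) else 0)"
    using assms by (simp add: sum.distrib)
  finally show ?thesis .
qed

definition comm :: "complex mat \<Rightarrow> complex mat \<Rightarrow> complex mat" where
  "comm X A = X * A - A * X"

lemma comm_carrier [simp]: "X \<in> carrier_mat D D \<Longrightarrow> A \<in> carrier_mat D D \<Longrightarrow> comm X A \<in> carrier_mat D D"
  by (auto simp: comm_def)

lemma comm_gen_index:
  assumes "a < D" "b < D" "A \<in> carrier_mat D D" "i < D" "j < D"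
  shows "comm (gen D (a,b)) A $$ (i,j) =
     (if i = a then (1 + \<i>) / 2 * A $$ (b,j) else 0) + (if i = b then (\<i> - 1) / 2 * A $$ (a,j) else 0)
   - (if j = b then (1 + \<i>) / 2 * A $$ (i,a) else 0) - (if j = a then (\<i> - 1) / 2 * A $$ (i,b) else 0)"
  using assms gen_mult_left[OF assms] gen_mult_right[OF assms] by (simp add: comm_def del: index_mult_mat(1))

lemma comm_index:
  assumes "X \<in> carrier_mat D D" "A \<in> carrier_mat D D" "i < D" "j < D"
  shows "comm X A $$ (i,j) = (\<Sum>l<D. X $$ (i,l) * A $$ (l,j) - A $$ (i,l) * X $$ (l,j))"
  using assms by (auto simp: comm_def index_mult_mat_sum sum_subtractf simp del: index_mult_mat(1))

text \<open>For such a basis the squares X_k^2 sum to - D times the identity and the products X_k A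
  X_k to - tr A times the identity. The double commutators therefore sum to - 2 D A + 2 tr A, and
  the trace vanishes.\<close>

lemma casimir:
  assumes A: "A \<in> carrier_mat D D" "(\<Sum>i<D. A $$ (i,i)) = 0" and ij: "i < D" "j < D"
  shows "(\<Sum>k\<in>{..<D} \<times> {..<D}. comm (gen D k) (comm (gen D k) A) $$ (i,j)) = - (2 * of_nat D) * A $$ (i,j)"
proof -
  let ?p = "(1 + \<i>) / 2" and ?q = "(\<i> - 1) / 2"
  define C where "C = (\<lambda>a b. comm (gen D (a,b)) A)"
  have Cc: "C a b \<in> carrier_mat D D" for a b by (simp add: C_def A)
  have C: "C a b $$ (i,j) = (if i = a then ?p * A $$ (b,j) else 0) + (if i = b then ?q * A $$ (a,j) else 0)
     - (if j = b then ?p * A $$ (i,a) else 0) - (if j = a then ?q * A $$ (i,b) else 0)"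
    if "a < D" "b < D" "i < D" "j < D" for a b i j
    unfolding C_def by (rule comm_gen_index) (use that A in auto)
  \<comment> \<open>For the coefficients of \<open>gen\<close>, p^2 + q^2 = 0 removes the transposed
    entry and 4 p q = -2 produces the eigenvalue.\<close>
  have alg: "p * (p * x + d * (q * x) - p * y) + q * (d * (p * x) + q * x - q * y) - p * (p * y - p * x - d * (q * x))
      - q * (q * y - d * (p * x) - q * x) = 2 * (p * p + q * q) * (x - y) + 4 * (p * q) * d * x" for p q x y d :: complex
    by (simp add: algebra_simps)
  have tr: "(\<Sum>b<D. if Q then c * A $$ (b,b) else 0) = 0" for Q c
    using A(2) by (cases Q) (simp_all add: sum_distrib_left[symmetric])
  have "(\<Sum>k\<in>{..<D} \<times> {..<D}. comm (gen D k) (comm (gen D k) A) $$ (i,j)) =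
    (\<Sum>a<D. \<Sum>b<D. comm (gen D (a,b)) (C a b) $$ (i,j))"
    by (simp add: sum.cartesian_product C_def case_prod_beta)
  also have "\<dots> = (\<Sum>a<D. \<Sum>b<D. (if i = a then ?p * C a b $$ (b,j) else 0) + (if i = b then ?q * C a b $$ (a,j) else 0)
     - (if j = b then ?p * C a b $$ (i,a) else 0) - (if j = a then ?q * C a b $$ (i,b) else 0))"
    by (intro sum.cong refl comm_gen_index) (use ij Cc in auto)
  also have "\<dots> = (\<Sum>a<D. \<Sum>b<D. if i = a then ?p * C a b $$ (b,j) else 0) + (\<Sum>a<D. \<Sum>b<D. if i = b then ?q * C a b $$ (a,j) else 0)
     - (\<Sum>a<D. \<Sum>b<D. if j = b then ?p * C a b $$ (i,a) else 0) - (\<Sum>b<D. \<Sum>a<D. if j = a then ?q * C a b $$ (i,b) else 0)"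
    by (simp only: sum.distrib sum_subtractf sum.swap[of "\<lambda>b a. if j = a then ?q * C a b $$ (i,b) else 0"])
  also have "(\<Sum>a<D. \<Sum>b<D. if i = a then ?p * C a b $$ (b,j) else 0) = ?p * (\<Sum>b<D. C i b $$ (b,j))"
    by (subst sum.swap) (use ij in \<open>simp add: sum_distrib_left\<close>)
  also have "(\<Sum>a<D. \<Sum>b<D. if i = b then ?q * C a b $$ (a,j) else 0) = ?q * (\<Sum>a<D. C a i $$ (a,j))"
    using ij by (simp add: sum_distrib_left)
  also have "(\<Sum>a<D. \<Sum>b<D. if j = b then ?p * C a b $$ (i,a) else 0) = ?p * (\<Sum>a<D. C a j $$ (i,a))"
    using ij by (simp add: sum_distrib_left)
  also have "(\<Sum>b<D. \<Sum>a<D. if j = a then ?q * C a b $$ (i,b) else 0) = ?q * (\<Sum>b<D. C j b $$ (i,b))"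
    using ij by (simp add: sum_distrib_left)
  also have "(\<Sum>b<D. C i b $$ (b,j)) = (\<Sum>b<D. (if b = i then ?p * A $$ (b,j) else 0) + ?q * A $$ (i,j)
     - (if b = j then ?p * A $$ (b,i) else 0) - (if j = i then ?q * A $$ (b,b) else 0))"
    using ij by (intro sum.cong refl) (auto simp: C)
  also have "\<dots> = ?p * A $$ (i,j) + of_nat D * (?q * A $$ (i,j)) - ?p * A $$ (j,i)"
    using ij by (simp add: sum.distrib sum_subtractf tr)
  also have "(\<Sum>a<D. C a i $$ (a,j)) = (\<Sum>a<D. ?p * A $$ (i,j) + (if a = i then ?q * A $$ (a,j) else 0)
     - (if j = i then ?p * A $$ (a,a) else 0) - (if a = j then ?q * A $$ (a,i) else 0))"
    using ij by (intro sum.cong refl) (auto simp: C)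
  also have "\<dots> = of_nat D * (?p * A $$ (i,j)) + ?q * A $$ (i,j) - ?q * A $$ (j,i)"
    using ij by (simp add: sum.distrib sum_subtractf tr)
  also have "(\<Sum>a<D. C a j $$ (i,a)) = (\<Sum>a<D. (if a = i then ?p * A $$ (j,a) else 0) + (if i = j then ?q * A $$ (a,a) else 0)
     - (if a = j then ?p * A $$ (i,a) else 0) - ?q * A $$ (i,j))"
    using ij by (intro sum.cong refl) (auto simp: C)
  also have "\<dots> = ?p * A $$ (j,i) - ?p * A $$ (i,j) - of_nat D * (?q * A $$ (i,j))"
    using ij by (simp add: sum.distrib sum_subtractf tr)
  also have "(\<Sum>b<D. C j b $$ (i,b)) = (\<Sum>b<D. (if i = j then ?p * A $$ (b,b) else 0) + (if b = i then ?q * A $$ (j,b) else 0)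
     - ?p * A $$ (i,j) - (if b = j then ?q * A $$ (i,b) else 0))"
    using ij by (intro sum.cong refl) (auto simp: C)
  also have "\<dots> = ?q * A $$ (j,i) - of_nat D * (?p * A $$ (i,j)) - ?q * A $$ (i,j)"
    using ij by (simp add: sum.distrib sum_subtractf tr)
  finally have e: "(\<Sum>k\<in>{..<D} \<times> {..<D}. comm (gen D k) (comm (gen D k) A) $$ (i,j)) =
    2 * (?p * ?p + ?q * ?q) * (A $$ (i,j) - A $$ (j,i)) + 4 * (?p * ?q) * of_nat D * A $$ (i,j)"
    unfolding alg .
  have "?p * ?p + ?q * ?q = 0" "?p * ?q = - 1 / 2" by (auto simp: complex_eq_iff)
  thus ?thesis unfolding e by simp
qed

text \<open>\<open>u\<close> is the Cayley transform (1 + t X / 2) (1 - t X / 2)^(-1). It is a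
  quadratic polynomial in X because X^3 = - w X.\<close>

lemma near_exp_gen:
  assumes k: "k \<in> {..<D} \<times> {..<D}" and t: "0 < t" "t \<le> 1"
  shows "\<exists>u. near_exp D (gen D k) t u"
proof -
  obtain a b where ab: "k = (a,b)" "a < D" "b < D" using k by auto
  define X where "X = gen D k"
  define Y where "Y = X * X"
  have X: "X \<in> carrier_mat D D" "Y \<in> carrier_mat D D" by (auto simp: X_def Y_def)
  \<comment> \<open>A diagonal generator is i times a matrix unit, so its square has entry -1; an
    off-diagonal one squares to -1/2 on the two coordinates involved.\<close>
  define w :: real where "w = (if a = b then 1 else 1/2)"
  have w: "0 \<le> w" "w \<le> 1" by (auto simp: w_def)
  have pq: "(1 + \<i>) / 2 + (\<i> - 1) / 2 = \<i>" "(1 + \<i>) / 2 * ((\<i> - 1) / 2) = - 1 / 2" by (auto simp: complex_eq_iff)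
  have Yi: "Y $$ (i,j) = (if i = j \<and> (i = a \<or> i = b) then - complex_of_real w else 0)" if "i < D" "j < D" for i j
  proof -
    have "Y $$ (i,j) = (if i = a then (1 + \<i>) / 2 * X $$ (b,j) else 0) + (if i = b then (\<i> - 1) / 2 * X $$ (a,j) else 0)"
      unfolding Y_def X_def ab(1) by (rule gen_mult_left) (use ab that in auto)
    thus ?thesis using ab that by (auto simp: X_def gen_index w_def complex_eq_iff)
  qed
  have YX: "Y * X = - complex_of_real w \<cdot>\<^sub>m X"
  proof (rule eq_matI)
    fix i j assume "i < dim_row (- complex_of_real w \<cdot>\<^sub>m X)" "j < dim_col (- complex_of_real w \<cdot>\<^sub>m X)"
    hence ij: "i < D" "j < D" using X by auto
    have "(Y * X) $$ (i,j) = (\<Sum>l<D. Y $$ (i,l) * X $$ (l,j))"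
      using X ij by (auto simp: index_mult_mat_sum simp del: index_mult_mat(1))
    also have "\<dots> = (\<Sum>l<D. if l = i then (if i = a \<or> i = b then - complex_of_real w * X $$ (i,j) else 0) else 0)"
      using ij by (intro sum.cong refl) (auto simp: Yi)
    also have "\<dots> = (if i = a \<or> i = b then - complex_of_real w * X $$ (i,j) else 0)" using ij by simp
    also have "\<dots> = - complex_of_real w * X $$ (i,j)" using ij ab by (auto simp: X_def gen_index)
    finally show "(Y * X) $$ (i,j) = (- complex_of_real w \<cdot>\<^sub>m X) $$ (i,j)" using ij X by auto
  qed (use X in auto)
  have XY: "X * Y = - complex_of_real w \<cdot>\<^sub>m X"
    using YX X unfolding Y_def by (simp add: assoc_mult_mat[of _ D D _ D _ D])
  have YY: "Y * Y = - complex_of_real w \<cdot>\<^sub>m Y"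
  proof -
    have "Y * Y = (Y * X) * X" using X unfolding Y_def by (simp add: assoc_mult_mat[of _ D D _ D _ D])
    also have "\<dots> = - complex_of_real w \<cdot>\<^sub>m (X * X)" unfolding YX using X by (intro mult_smult_assoc_mat)
    finally show ?thesis unfolding Y_def .
  qed
  define s r :: real where "s = t / (1 + w * t\<^sup>2 / 4)" and "r = (t\<^sup>2 / 2) / (1 + w * t\<^sup>2 / 4)"
  have pos: "1 \<le> 1 + w * t\<^sup>2 / 4" using w by simp
  \<comment> \<open>This is unitarity of \<open>u\<close>: with X^4 = - w X^2, the coefficient of
    X^2 in u times its adjoint is 2 r - s^2 - w r^2.\<close>
  have sr: "2 * r = s\<^sup>2 + w * r\<^sup>2"
  proof -
    define z where "z = 1 + w * t\<^sup>2 / 4"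
    have "s\<^sup>2 + w * r\<^sup>2 = (t\<^sup>2 + w * (t\<^sup>2 / 2)\<^sup>2) / z\<^sup>2"
      by (simp add: s_def r_def z_def[symmetric] power_divide add_divide_distrib)
    also have "t\<^sup>2 + w * (t\<^sup>2 / 2)\<^sup>2 = t\<^sup>2 * z" by (simp add: z_def power2_eq_square algebra_simps)
    also have "t\<^sup>2 * z / z\<^sup>2 = 2 * (t\<^sup>2 / 2 / z)" using pos by (simp add: z_def[symmetric] power2_eq_square)
    also have "t\<^sup>2 / 2 / z = r" by (simp only: r_def z_def)
    finally show ?thesis by simp
  qed
  have rb: "\<bar>r\<bar> \<le> t\<^sup>2"
  proof -
    have "r \<le> (t\<^sup>2 / 2) / 1" unfolding r_def using pos by (intro divide_left_mono) auto
    moreover have "0 \<le> r" unfolding r_def using pos by simp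
    ultimately show ?thesis by simp
  qed
  have sb: "\<bar>s - t\<bar> \<le> t\<^sup>2"
  proof -
    have "t - s = (w * t / 2) * r" using pos by (simp add: s_def r_def field_simps power2_eq_square)
    moreover have r0: "0 \<le> r" unfolding r_def using pos by simp
    moreover have "0 \<le> (w * t / 2) * r" using w t r0 by simp
    moreover have "w * t \<le> 1 * 1" using w t by (intro mult_mono) auto
    moreover have "(w * t / 2) * r \<le> 1 * t\<^sup>2" using w t rb r0 \<open>w * t \<le> 1 * 1\<close> by (intro mult_mono) auto
    ultimately show ?thesis by simp
  qed
  define u where "u = 1\<^sub>m D + complex_of_real s \<cdot>\<^sub>m X + complex_of_real r \<cdot>\<^sub>m Y"
  define u' where "u' = 1\<^sub>m D + complex_of_real (- s) \<cdot>\<^sub>m X + complex_of_real r \<cdot>\<^sub>m Y"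
  have adj: "mat_adjoint u = u'"
  proof (rule eq_matI)
    fix i j assume "i < dim_row u'" "j < dim_col u'"
    hence ij: "i < D" "j < D" using X by (auto simp: u'_def)
    have "cnj (X $$ (j,i)) = - X $$ (i,j)" unfolding X_def by (rule gen_skew) (use ij in auto)
    moreover have "cnj (Y $$ (j,i)) = Y $$ (i,j)" using ij by (auto simp: Yi)
    ultimately show "mat_adjoint u $$ (i,j) = u' $$ (i,j)" using ij X by (auto simp: u_def u'_def)
  qed (use X in \<open>auto simp: u_def u'_def\<close>)
  have prod: "(1\<^sub>m D + complex_of_real s \<cdot>\<^sub>m X + complex_of_real r \<cdot>\<^sub>m Y) * (1\<^sub>m D + complex_of_real (- s) \<cdot>\<^sub>m X + complex_of_real r \<cdot>\<^sub>m Y) = 1\<^sub>m D"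
    if sr: "2 * r = s\<^sup>2 + w * r\<^sup>2" for s
  proof -
    have XX: "X * X = Y" by (simp add: Y_def)
    have c2: "2 * complex_of_real r = complex_of_real s * complex_of_real s + complex_of_real w * (complex_of_real r * complex_of_real r)"
      using arg_cong[OF sr, of complex_of_real] by (simp add: power2_eq_square)
    have "(1\<^sub>m D + complex_of_real s \<cdot>\<^sub>m X + complex_of_real r \<cdot>\<^sub>m Y) * (1\<^sub>m D + complex_of_real (- s) \<cdot>\<^sub>m X + complex_of_real r \<cdot>\<^sub>m Y)
      = 1\<^sub>m D + (2 * complex_of_real r - complex_of_real s * complex_of_real s - complex_of_real w * (complex_of_real r * complex_of_real r)) \<cdot>\<^sub>m Y"
    proof (rule eq_matI)
      fix i j assume "i < dim_row (1\<^sub>m D + (2 * complex_of_real r - complex_of_real s * complex_of_real s - complex_of_real w * (complex_of_real r * complex_of_real r)) \<cdot>\<^sub>m Y)"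
        "j < dim_col (1\<^sub>m D + (2 * complex_of_real r - complex_of_real s * complex_of_real s - complex_of_real w * (complex_of_real r * complex_of_real r)) \<cdot>\<^sub>m Y)"
      hence ij: "i < D" "j < D" using X by auto
      show "((1\<^sub>m D + complex_of_real s \<cdot>\<^sub>m X + complex_of_real r \<cdot>\<^sub>m Y) * (1\<^sub>m D + complex_of_real (- s) \<cdot>\<^sub>m X + complex_of_real r \<cdot>\<^sub>m Y)) $$ (i,j)
        = (1\<^sub>m D + (2 * complex_of_real r - complex_of_real s * complex_of_real s - complex_of_real w * (complex_of_real r * complex_of_real r)) \<cdot>\<^sub>m Y) $$ (i,j)"
        using X ij
        by (simp add: add_mult_distrib_mat[of _ D D _ _ D] mult_add_distrib_mat[of _ D D _ D] mult_smult_assoc_mat[of _ D D _ D] mult_smult_distrib[of _ D D _ D]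
          XX XY YX YY del: index_mult_mat(1)) (simp add: algebra_simps)
    qed (use X in auto)
    also have "\<dots> = 1\<^sub>m D + (0 :: complex) \<cdot>\<^sub>m Y" using c2 by simp
    also have "\<dots> = 1\<^sub>m D" using X by (intro eq_matI) auto
    finally show ?thesis .
  qed
  have uc: "u \<in> carrier_mat D D" using X by (auto simp: u_def)
  have "unitary_mat D u"
    unfolding unitary_mat_def adj using prod[OF sr] prod[of "-s"] sr uc by (simp add: u_def u'_def)
  moreover have "u $$ (i,j) = (if i = j then 1 else 0) + complex_of_real s * X $$ (i,j) + complex_of_real r * (X * X) $$ (i,j)"
    if "i < D" "j < D" for i j using that X unfolding u_def Y_def[symmetric] by simp
  ultimately show ?thesis using sb rb unfolding near_exp_def X_def by blast
qed


section \<open>Size of the commutators with the generators\<close>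

lemma reflection_isometry:
  assumes R: "R \<in> hermitian_reflections D"
  shows "(\<Sum>b<D. (cmod (\<Sum>j<D. cnj (R $$ (b,j)) * w j))\<^sup>2) = (\<Sum>j<D. (cmod (w j))\<^sup>2)"
proof -
  have c: "R \<in> carrier_mat D D" "R * R = 1\<^sub>m D" using R by (auto simp: hermitian_reflections_def)
  have o: "(\<Sum>b<D. cnj (R $$ (b,j)) * R $$ (b,l)) = (if j = l then 1 else 0)" if "j < D" "l < D" for j l
  proof -
    have "(\<Sum>b<D. cnj (R $$ (b,j)) * R $$ (b,l)) = (\<Sum>b<D. R $$ (j,b) * R $$ (b,l))"
      using that by (intro sum.cong refl) (simp add: hermitian_reflections_cnj[OF R])
    also have "\<dots> = (R * R) $$ (j,l)" using c(1) that by (auto simp: index_mult_mat_sum simp del: index_mult_mat(1))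
    finally show ?thesis unfolding c(2) using that by simp
  qed
  have "complex_of_real (\<Sum>b<D. (cmod (\<Sum>j<D. cnj (R $$ (b,j)) * w j))\<^sup>2) =
    (\<Sum>b<D. \<Sum>j<D. \<Sum>l<D. (cnj (R $$ (b,j)) * R $$ (b,l)) * (w j * cnj (w l)))"
    unfolding of_real_sum complex_norm_square cnj_sum sum_product by (simp add: mult_ac)
  also have "\<dots> = (\<Sum>j<D. \<Sum>l<D. \<Sum>b<D. (cnj (R $$ (b,j)) * R $$ (b,l)) * (w j * cnj (w l)))"
    by (rule trans[OF sum.swap], rule sum.cong[OF refl], rule sum.swap)
  also have "\<dots> = (\<Sum>j<D. \<Sum>l<D. (if j = l then 1 else 0) * (w j * cnj (w l)))"
    by (intro sum.cong refl) (simp only: sum_distrib_right[symmetric] o lessThan_iff)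
  also have "\<dots> = (\<Sum>j<D. w j * cnj (w j))"
    by (intro sum.cong refl) (simp add: if_distrib[of "\<lambda>x. x * _"] cong: if_cong)
  also have "\<dots> = complex_of_real (\<Sum>j<D. (cmod (w j))\<^sup>2)"
    unfolding of_real_sum complex_norm_square ..
  finally show ?thesis by (simp only: of_real_eq_iff)
qed

lemma reflection_isometry':
  assumes R: "R \<in> hermitian_reflections D"
  shows "(\<Sum>b<D. (cmod (\<Sum>j<D. cnj (R $$ (j,b)) * w j))\<^sup>2) = (\<Sum>j<D. (cmod (w j))\<^sup>2)"
proof -
  have "cmod (\<Sum>j<D. cnj (R $$ (j,b)) * w j) = cmod (\<Sum>j<D. cnj (R $$ (b,j)) * cnj (w j))" if "b < D" for b
  proof -
    have "(\<Sum>j<D. cnj (R $$ (b,j)) * cnj (w j)) = cnj (\<Sum>j<D. cnj (R $$ (j,b)) * w j)"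
      unfolding cnj_sum by (intro sum.cong refl) (simp add: that hermitian_reflections_cnj[OF R])
    thus ?thesis by (simp only: complex_mod_cnj)
  qed
  thus ?thesis using reflection_isometry[OF R, of "\<lambda>j. cnj (w j)"] by simp
qed

text \<open>Both coefficients have modulus 1 / sqrt 2, and the square of a sum of four terms is at
  most four times the sum of the squares.\<close>

lemma four_term_bound:
  fixes x y z v :: complex
  shows "(cmod ((1 + \<i>) / 2 * x + (\<i> - 1) / 2 * y - (1 + \<i>) / 2 * z - (\<i> - 1) / 2 * v))\<^sup>2
     \<le> 2 * ((cmod x)\<^sup>2 + (cmod y)\<^sup>2 + (cmod z)\<^sup>2 + (cmod v)\<^sup>2)"
proof -
  have p: "cmod ((1 + \<i>) / 2) = 1 / sqrt 2" "cmod ((\<i> - 1) / 2) = 1 / sqrt 2"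
    by (auto simp: cmod_def real_div_sqrt power2_eq_square field_simps)
      (auto simp: real_sqrt_divide real_sqrt_mult field_simps)
  have "cmod ((1 + \<i>) / 2 * x + (\<i> - 1) / 2 * y - (1 + \<i>) / 2 * z - (\<i> - 1) / 2 * v)
     \<le> cmod ((1 + \<i>) / 2 * x) + cmod ((\<i> - 1) / 2 * y) + cmod ((1 + \<i>) / 2 * z) + cmod ((\<i> - 1) / 2 * v)"
    by (intro order_trans[OF norm_triangle_ineq4] add_right_mono norm_triangle_ineq)
  also have "\<dots> = (cmod x + cmod y + cmod z + cmod v) / sqrt 2"
    unfolding norm_mult p by (simp add: field_simps)
  finally have "(cmod ((1 + \<i>) / 2 * x + (\<i> - 1) / 2 * y - (1 + \<i>) / 2 * z - (\<i> - 1) / 2 * v))\<^sup>2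
     \<le> ((cmod x + cmod y + cmod z + cmod v) / sqrt 2)\<^sup>2" by (intro power_mono) auto
  also have "\<dots> = (cmod x + cmod y + cmod z + cmod v)\<^sup>2 / 2" by (simp add: power_divide)
  also have "(cmod x + cmod y + cmod z + cmod v)\<^sup>2 \<le> 4 * ((cmod x)\<^sup>2 + (cmod y)\<^sup>2 + (cmod z)\<^sup>2 + (cmod v)\<^sup>2)"
  proof -
    have "4 * (a\<^sup>2 + b\<^sup>2 + c\<^sup>2 + d\<^sup>2) - (a + b + c + d)\<^sup>2
       = (a - b)\<^sup>2 + (a - c)\<^sup>2 + (a - d)\<^sup>2 + (b - c)\<^sup>2 + (b - d)\<^sup>2 + (c - d)\<^sup>2" for a b c d :: real
      by (simp add: power2_eq_square algebra_simps)
    thus ?thesis by (smt (verit) zero_le_power2)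
  qed
  finally show ?thesis by simp
qed

lemma four_term_bound_cnj:
  fixes x y z v :: complex
  shows "(cmod (cnj ((1 + \<i>) / 2) * x + cnj ((\<i> - 1) / 2) * y - cnj ((1 + \<i>) / 2) * z - cnj ((\<i> - 1) / 2) * v))\<^sup>2
     \<le> 2 * ((cmod x)\<^sup>2 + (cmod y)\<^sup>2 + (cmod z)\<^sup>2 + (cmod v)\<^sup>2)"
proof -
  have "cmod (cnj ((1 + \<i>) / 2) * x + cnj ((\<i> - 1) / 2) * y - cnj ((1 + \<i>) / 2) * z - cnj ((\<i> - 1) / 2) * v)
     = cmod ((1 + \<i>) / 2 * cnj x + (\<i> - 1) / 2 * cnj y - (1 + \<i>) / 2 * cnj z - (\<i> - 1) / 2 * cnj v)"
    by (subst complex_mod_cnj[symmetric]) simp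
  thus ?thesis using four_term_bound[of "cnj x" "cnj y" "cnj z" "cnj v"] by simp
qed

lemma sum_pairs: "(\<Sum>k\<in>A \<times> B. f k) = (\<Sum>a\<in>A. \<Sum>b\<in>B. f (a,b))"
  by (simp add: sum.cartesian_product case_prod_beta)

text \<open>The inner products of \<open>v\<close> with all commutators are combinations of the
  entries of v R^dagger and R^dagger v and of their transposes. These four families have the norm of
  \<open>v\<close>, as R is unitary; the factor 2 of \<open>four_term_bound\<close> then gives 8.
  That no power of D appears is what makes \<gamma> small.\<close>

lemma sum_comm_inner_le:
  assumes R: "R \<in> hermitian_reflections D"
  shows "(\<Sum>k\<in>{..<D} \<times> {..<D}. (cmod (\<Sum>i<D. \<Sum>j<D. cnj (comm (gen D k) R $$ (i,j)) * v i j))\<^sup>2)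
     \<le> 8 * (\<Sum>i<D. \<Sum>j<D. (cmod (v i j))\<^sup>2)"
proof -
  have c: "R \<in> carrier_mat D D" using R by (auto simp: hermitian_reflections_def)
  define P where "P = (\<lambda>a b. \<Sum>j<D. cnj (R $$ (b,j)) * v a j)"
  define Q where "Q = (\<lambda>a b. \<Sum>i<D. cnj (R $$ (i,a)) * v i b)"
  define N where "N = (\<Sum>i<D. \<Sum>j<D. (cmod (v i j))\<^sup>2)"
  have NP: "(\<Sum>a<D. \<Sum>b<D. (cmod (P a b))\<^sup>2) = N"
    unfolding P_def N_def by (intro sum.cong refl reflection_isometry R)
  have NQ: "(\<Sum>a<D. \<Sum>b<D. (cmod (Q a b))\<^sup>2) = N"
    unfolding Q_def N_def by (subst (1 2) sum.swap) (intro sum.cong refl reflection_isometry' R)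
  have e: "(\<Sum>i<D. \<Sum>j<D. cnj (comm (gen D (a,b)) R $$ (i,j)) * v i j) =
     cnj ((1 + \<i>) / 2) * P a b + cnj ((\<i> - 1) / 2) * P b a - cnj ((1 + \<i>) / 2) * Q a b - cnj ((\<i> - 1) / 2) * Q b a"
    if ab: "a < D" "b < D" for a b
  proof -
    define p q :: complex where "p = (1 + \<i>) / 2" and "q = (\<i> - 1) / 2"
    let ?p = "cnj p" and ?q = "cnj q"
    note ci = comm_gen_index[folded p_def q_def]
    have "(\<Sum>i<D. \<Sum>j<D. cnj (comm (gen D (a,b)) R $$ (i,j)) * v i j) =
      (\<Sum>i<D. \<Sum>j<D. (if i = a then ?p * (cnj (R $$ (b,j)) * v a j) else 0) + (if i = b then ?q * (cnj (R $$ (a,j)) * v b j) else 0)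
       - (if j = b then ?p * (cnj (R $$ (i,a)) * v i b) else 0) - (if j = a then ?q * (cnj (R $$ (i,b)) * v i a) else 0))"
      by (intro sum.cong refl) (use ab c in \<open>auto simp: ci algebra_simps\<close>)
    also have "\<dots> = (\<Sum>j<D. \<Sum>i<D. if i = a then ?p * (cnj (R $$ (b,j)) * v a j) else 0)
       + (\<Sum>j<D. \<Sum>i<D. if i = b then ?q * (cnj (R $$ (a,j)) * v b j) else 0)
       - (\<Sum>i<D. \<Sum>j<D. if j = b then ?p * (cnj (R $$ (i,a)) * v i b) else 0)
       - (\<Sum>i<D. \<Sum>j<D. if j = a then ?q * (cnj (R $$ (i,b)) * v i a) else 0)"
      unfolding sum.distrib sum_subtractf by (subst (1 2) sum.swap) simp
    also have "\<dots> = ?p * P a b + ?q * P b a - ?p * Q a b - ?q * Q b a"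
      using ab by (simp add: P_def Q_def sum_distrib_left)
    finally show ?thesis unfolding p_def q_def .
  qed
  have "(\<Sum>k\<in>{..<D} \<times> {..<D}. (cmod (\<Sum>i<D. \<Sum>j<D. cnj (comm (gen D k) R $$ (i,j)) * v i j))\<^sup>2)
    = (\<Sum>a<D. \<Sum>b<D. (cmod (\<Sum>i<D. \<Sum>j<D. cnj (comm (gen D (a,b)) R $$ (i,j)) * v i j))\<^sup>2)"
    by (rule sum_pairs)
  also have "\<dots> \<le> (\<Sum>a<D. \<Sum>b<D. 2 * ((cmod (P a b))\<^sup>2 + (cmod (P b a))\<^sup>2 + (cmod (Q a b))\<^sup>2 + (cmod (Q b a))\<^sup>2))"
    by (intro sum_mono) (simp only: e lessThan_iff four_term_bound_cnj)
  also have "\<dots> = 2 * (N + N + N + N)"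
    using NP NQ sum.swap[of "\<lambda>a b. (cmod (P b a))\<^sup>2" "{..<D}" "{..<D}"] sum.swap[of "\<lambda>a b. (cmod (Q b a))\<^sup>2" "{..<D}" "{..<D}"]
    by (simp only: sum_distrib_left[symmetric] sum.distrib)
  finally show ?thesis by (simp add: N_def)
qed

lemma reflection_frob:
  assumes R: "R \<in> hermitian_reflections D" and i: "i < D"
  shows "(\<Sum>j<D. (cmod (R $$ (i,j)))\<^sup>2) = 1"
proof -
  have "(\<Sum>j<D. (cmod (R $$ (i,j)))\<^sup>2) = (\<Sum>b<D. (cmod (\<Sum>j<D. cnj (R $$ (b,j)) * (if j = i then 1 else 0)))\<^sup>2)"
    using i by (intro sum.cong refl) (auto simp: if_distrib[of "\<lambda>x. _ * x"] hermitian_reflections_cnj[OF R] cong: if_cong)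
  also have "\<dots> = (\<Sum>j<D. (cmod (if j = i then 1 else 0))\<^sup>2)" by (rule reflection_isometry[OF R])
  also have "\<dots> = (\<Sum>j<D. if j = i then 1 else 0)" by (intro sum.cong refl) auto
  finally show ?thesis using i by simp
qed

text \<open>The commutator with one generator consists of two rows and two columns of R, all of unit
  length, so each of the D^2 pairs contributes at most 2 * 4.\<close>

lemma sum_comm_frob_le:
  assumes R: "R \<in> hermitian_reflections D"
  shows "(\<Sum>k\<in>{..<D} \<times> {..<D}. \<Sum>i<D. \<Sum>j<D. (cmod (comm (gen D k) R $$ (i,j)))\<^sup>2) \<le> 8 * (real D)\<^sup>2"
proof -
  have c: "R \<in> carrier_mat D D" using R by (auto simp: hermitian_reflections_def)
  define r where "r = (\<lambda>i j. (cmod (R $$ (i,j)))\<^sup>2)"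
  have r1: "(\<Sum>j<D. r i j) = 1" if "i < D" for i unfolding r_def by (rule reflection_frob[OF R that])
  have rsym: "r i j = r j i" if "i < D" "j < D" for i j
    using hermitian_reflections_cnj[OF R that] complex_mod_cnj[of "R $$ (i,j)"] by (simp add: r_def)
  have r2: "(\<Sum>i<D. r i j) = 1" if "j < D" for j using r1[OF that] rsym that by (simp cong: sum.cong_simp)
  have N: "(\<Sum>i<D. \<Sum>j<D. r i j) = real D" by (simp add: r1)
  have "(\<Sum>k\<in>{..<D} \<times> {..<D}. \<Sum>i<D. \<Sum>j<D. (cmod (comm (gen D k) R $$ (i,j)))\<^sup>2)
     = (\<Sum>a<D. \<Sum>b<D. \<Sum>i<D. \<Sum>j<D. (cmod (comm (gen D (a,b)) R $$ (i,j)))\<^sup>2)"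
    by (rule sum_pairs)
  also have "\<dots> \<le> (\<Sum>a<D. \<Sum>b<D. \<Sum>i<D. \<Sum>j<D. 2 * ((if i = a then r b j else 0) + (if i = b then r a j else 0)
      + (if j = b then r i a else 0) + (if j = a then r i b else 0)))"
  proof (intro sum_mono)
    fix a b i j assume "a \<in> {..<D}" "b \<in> {..<D}" "i \<in> {..<D}" "j \<in> {..<D}"
    hence "comm (gen D (a,b)) R $$ (i,j) = (1 + \<i>) / 2 * (if i = a then R $$ (b,j) else 0) + (\<i> - 1) / 2 * (if i = b then R $$ (a,j) else 0)
       - (1 + \<i>) / 2 * (if j = b then R $$ (i,a) else 0) - (\<i> - 1) / 2 * (if j = a then R $$ (i,b) else 0)"
      using c by (simp add: comm_gen_index)
    hence "(cmod (comm (gen D (a,b)) R $$ (i,j)))\<^sup>2 \<le> 2 * ((cmod (if i = a then R $$ (b,j) else 0))\<^sup>2 + (cmod (if i = b then R $$ (a,j) else 0))\<^sup>2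
       + (cmod (if j = b then R $$ (i,a) else 0))\<^sup>2 + (cmod (if j = a then R $$ (i,b) else 0))\<^sup>2)"
      by (simp only: four_term_bound)
    also have "\<dots> = 2 * ((if i = a then r b j else 0) + (if i = b then r a j else 0)
      + (if j = b then r i a else 0) + (if j = a then r i b else 0))"
      by (simp add: r_def)
    finally show "(cmod (comm (gen D (a,b)) R $$ (i,j)))\<^sup>2 \<le> 2 * ((if i = a then r b j else 0) + (if i = b then r a j else 0)
      + (if j = b then r i a else 0) + (if j = a then r i b else 0))" .
  qed
  also have "\<dots> = (\<Sum>a<D. \<Sum>b<D. 2 * (1 + 1 + 1 + 1))"
  proof (intro sum.cong refl)
    fix a b assume "a \<in> {..<D}" "b \<in> {..<D}"
    hence ab: "a < D" "b < D" by auto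
    have d: "(\<Sum>i<D. \<Sum>j<D. if i = c then f j else 0) = (\<Sum>j<D. f j)" if "c < D" for c and f :: "nat \<Rightarrow> real"
    proof -
      have "(\<Sum>j<D. if i = c then f j else 0) = (if i = c then \<Sum>j<D. f j else 0)" for i by simp
      thus ?thesis using that by simp
    qed
    show "(\<Sum>i<D. \<Sum>j<D. 2 * ((if i = a then r b j else 0) + (if i = b then r a j else 0)
      + (if j = b then r i a else 0) + (if j = a then r i b else 0))) = 2 * (1 + 1 + 1 + 1)"
      unfolding sum_distrib_left[symmetric] sum.distrib d[OF ab(1)] d[OF ab(2)] using ab by (simp add: r1 r2)
  qed
  also have "\<dots> = 8 * (real D)\<^sup>2" by (simp add: power2_eq_square)
  finally show ?thesis .
qed

section \<open>Oracle vectors\<close>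

text \<open>A D x D array becomes a vector on the bipartite register with index i * m + j, padded by
  zeros outside the corner.\<close>

definition emb :: "nat \<Rightarrow> nat \<Rightarrow> (nat \<Rightarrow> nat \<Rightarrow> 'a) \<Rightarrow> nat \<Rightarrow> 'a :: zero" where
  "emb m D f x = (if x div m < D \<and> x mod m < D then f (x div m) (x mod m) else 0)"

lemma sum_emb:
  fixes g :: "nat \<Rightarrow> nat \<Rightarrow> 'a :: comm_monoid_add"
  assumes "D \<le> d" "D \<le> m"
  shows "(\<Sum>x<d * m. emb m D g x) = (\<Sum>i<D. \<Sum>j<D. g i j)"
proof -
  have "(\<Sum>x<d * m. emb m D g x) = (\<Sum>x | x \<in> {..<d * m} \<and> (x div m < D \<and> x mod m < D). g (x div m) (x mod m))"
    unfolding emb_def by (rule sum.inter_filter[symmetric]) simp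
  also have "\<dots> = (\<Sum>p\<in>{..<D} \<times> {..<D}. g (fst p) (snd p))"
  proof (rule sum.reindex_bij_witness[of _ "\<lambda>p. fst p * m + snd p" "\<lambda>x. (x div m, x mod m)"])
    fix p assume "p \<in> {..<D} \<times> {..<D}"
    then obtain i j where p: "p = (i,j)" "i < D" "j < D" by auto
    have j: "j < m" using p assms by linarith
    have "i * m + j < Suc i * m" using j by simp
    also have "\<dots> \<le> d * m" using p assms by (intro mult_right_mono) auto
    finally have "i * m + j < d * m" .
    thus "fst p * m + snd p \<in> {x. x \<in> {..<d * m} \<and> (x div m < D \<and> x mod m < D)}"
      "((fst p * m + snd p) div m, (fst p * m + snd p) mod m) = p"
      using p j by auto
  qed auto
  finally show ?thesis by (simp add: sum_pairs)
qed

definition oracle_vec :: "nat \<Rightarrow> nat \<Rightarrow> real \<Rightarrow> complex \<Rightarrow> complex mat \<Rightarrow> nat \<Rightarrow> complex" where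
  "oracle_vec D m a c R = emb m D (\<lambda>i j. (a * (if i = j then 1 else 0) + c * R $$ (i,j)) / sqrt (real D))"

definition part_vec :: "nat \<Rightarrow> nat \<Rightarrow> complex \<Rightarrow> complex mat \<Rightarrow> nat \<Rightarrow> complex" where
  "part_vec D m c A = emb m D (\<lambda>i j. c * A $$ (i,j) / sqrt (real D))"

lemma part_vec_norm_sq: "D > 0 \<Longrightarrow> (cmod (part_vec D m c A x))\<^sup>2 = emb m D (\<lambda>i j. (cmod c)\<^sup>2 / D * (cmod (A $$ (i,j)))\<^sup>2) x"
  by (simp add: part_vec_def emb_def norm_mult norm_divide power_mult_distrib power_divide)

text \<open>The identity and R are orthogonal because R is traceless, and both have squared
  Frobenius norm D.\<close>

lemma oracle_vec_unit:
  assumes R: "R \<in> hermitian_reflections D" and D: "0 < D" "D \<le> d" "D \<le> m" and ab: "a\<^sup>2 + (cmod c)\<^sup>2 = 1"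
  shows "(\<Sum>x<d * m. cnj (oracle_vec D m a c R x) * oracle_vec D m a c R x) = 1"
proof -
  have tr: "(\<Sum>i<D. R $$ (i,i)) = 0" using R by (auto simp: hermitian_reflections_def)
  define e where "e = (\<lambda>i j. complex_of_real a * (if i = j then 1 else 0) + c * R $$ (i,j))"
  have "(\<Sum>x<d * m. cnj (oracle_vec D m a c R x) * oracle_vec D m a c R x) =
    (\<Sum>x<d * m. emb m D (\<lambda>i j. cnj (e i j) * e i j / D) x)"
    by (intro sum.cong refl) (simp add: oracle_vec_def emb_def e_def flip: of_real_mult)
  also have "\<dots> = (\<Sum>i<D. \<Sum>j<D. cnj (e i j) * e i j) / D"
    by (simp add: sum_emb D sum_divide_distrib)
  also have "(\<Sum>i<D. \<Sum>j<D. cnj (e i j) * e i j) = (\<Sum>i<D. \<Sum>j<D. (if i = j then complex_of_real (a\<^sup>2) else 0)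
      + (if i = j then a * c * R $$ (i,i) + a * cnj (c * R $$ (i,i)) else 0) + complex_of_real ((cmod c)\<^sup>2 * (cmod (R $$ (i,j)))\<^sup>2))"
  proof -
    have n: "complex_of_real ((cmod c)\<^sup>2 * (cmod r)\<^sup>2) = (c * cnj c) * (r * cnj r)" for r
      by (simp only: of_real_mult complex_norm_square)
    show ?thesis unfolding n
      by (intro sum.cong refl) (auto simp: e_def algebra_simps power2_eq_square)
  qed
  also have "\<dots> = (\<Sum>i<D. complex_of_real (a\<^sup>2) + (a * c * R $$ (i,i) + a * cnj (c * R $$ (i,i)))) + 
      complex_of_real ((cmod c)\<^sup>2 * (\<Sum>i<D. \<Sum>j<D. (cmod (R $$ (i,j)))\<^sup>2))"
    by (simp add: sum.distrib sum_distrib_left)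
  also have "(\<Sum>i<D. \<Sum>j<D. (cmod (R $$ (i,j)))\<^sup>2) = real D" by (simp add: reflection_frob[OF R])
  also have "(\<Sum>i<D. complex_of_real (a\<^sup>2) + (a * c * R $$ (i,i) + a * cnj (c * R $$ (i,i))))
     = of_nat D * complex_of_real (a\<^sup>2) + (a * c * (\<Sum>i<D. R $$ (i,i)) + a * cnj (c * (\<Sum>i<D. R $$ (i,i))))"
    by (simp add: sum.distrib sum_distrib_left cnj_sum mult_ac)
  also have "(\<dots> + complex_of_real ((cmod c)\<^sup>2 * real D)) / D = complex_of_real (a\<^sup>2 + (cmod c)\<^sup>2)"
    unfolding tr using D by (simp add: add_divide_distrib)
  finally show ?thesis unfolding ab by simp
qed

lemma hermitian_reflections_carrier: "R \<in> hermitian_reflections D \<Longrightarrow> R \<in> carrier_mat D D"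
  by (simp add: hermitian_reflections_def)

text \<open>Entry formulas for commutators need matrices of the right size, so functions are
  compared on reflections only. This suffices because conjugation by the unitaries of
  \<open>near_exp\<close> stays inside that set.\<close>

lemma jet_cong:
  assumes j: "jet D X f f'" and fg: "\<And>\<alpha> R. R \<in> hermitian_reflections D \<Longrightarrow> f \<alpha> R = g \<alpha> R"
    and fg': "\<And>\<alpha> R. R \<in> hermitian_reflections D \<Longrightarrow> f' \<alpha> R = g' \<alpha> R"
  shows "jet D X g g'"
proof -
  have "expect \<nu> (\<lambda>R. f \<alpha> R * h R) = expect \<nu> (\<lambda>R. g \<alpha> R * h R)" if "snd ` set \<nu> \<subseteq> hermitian_reflections D" for \<nu> \<alpha> h
    using that by (rule expect_cong) (simp add: fg)
  hence c: "controlled D g" using j unfolding jet_def controlled_def by simp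
  have "conj_by u R \<in> hermitian_reflections D" if "near_exp D X t u" "R \<in> hermitian_reflections D" for t u R
    using that by (auto simp: near_exp_def intro: conj_by_hermitian_reflections)
  thus ?thesis using j c fg fg' unfolding jet_def by (metis (no_types, lifting))
qed

lemma jet_comm_entry:
  assumes "i < D" "j < D"
  shows "jet D (gen D k) (\<lambda>\<alpha> R. R $$ (i,j)) (\<lambda>\<alpha> R. comm (gen D k) R $$ (i,j))"
  unfolding comm_def using jet_entry[OF gen_carrier(1) gen_skew assms] .

lemma jet_comm_comm_entry:
  assumes "i < D" "j < D"
  shows "jet D (gen D k) (\<lambda>\<alpha> R. comm (gen D k) R $$ (i,j)) (\<lambda>\<alpha> R. comm (gen D k) (comm (gen D k) R) $$ (i,j))"
proof (rule jet_cong)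
  show "jet D (gen D k) (\<lambda>\<alpha> R. \<Sum>l<D. gen D k $$ (i,l) * R $$ (l,j) - gen D k $$ (l,j) * R $$ (i,l))
    (\<lambda>\<alpha> R. \<Sum>l<D. gen D k $$ (i,l) * comm (gen D k) R $$ (l,j) - gen D k $$ (l,j) * comm (gen D k) R $$ (i,l))"
    using assms by (intro jet_sum jet_diff jet_cmult jet_comm_entry) auto
  fix R assume "R \<in> hermitian_reflections D"
  hence R: "R \<in> carrier_mat D D" by (rule hermitian_reflections_carrier)
  show "(\<Sum>l<D. gen D k $$ (i,l) * R $$ (l,j) - gen D k $$ (l,j) * R $$ (i,l)) = comm (gen D k) R $$ (i,j)"
    using assms by (simp add: comm_index[OF gen_carrier(1) R] mult.commute)
  show "(\<Sum>l<D. gen D k $$ (i,l) * comm (gen D k) R $$ (l,j) - gen D k $$ (l,j) * comm (gen D k) R $$ (i,l)) = comm (gen D k) (comm (gen D k) R) $$ (i,j)"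
    using assms by (subst comm_index[of _ D "comm (gen D k) R"]) (simp_all add: R mult.commute)
qed

lemma jet_part_vec:
  assumes "\<And>i j. i < D \<Longrightarrow> j < D \<Longrightarrow> jet D X (\<lambda>\<alpha> R. A R $$ (i,j)) (\<lambda>\<alpha> R. A' R $$ (i,j))"
    and "\<And>\<alpha>. cmod (c \<alpha>) \<le> B"
  shows "jet D X (\<lambda>\<alpha> R. part_vec D m (c \<alpha>) (A R) x) (\<lambda>\<alpha> R. part_vec D m (c \<alpha>) (A' R) x)"
proof (cases "x div m < D \<and> x mod m < D")
  case True
  have "jet D X (\<lambda>\<alpha> R. 1 / sqrt (real D) * (c \<alpha> * A R $$ (x div m, x mod m)))
     (\<lambda>\<alpha> R. 1 / sqrt (real D) * (0 * A R $$ (x div m, x mod m) + c \<alpha> * A' R $$ (x div m, x mod m)))"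
    by (intro jet_cmult jet_mult jet_const[of c B] assms) (use True in auto)
  thus ?thesis by (rule jet_eq) (use True in \<open>auto simp: part_vec_def emb_def\<close>)
next
  case False
  thus ?thesis using jet_const[of "\<lambda>_. 0" 0] unfolding part_vec_def emb_def by auto
qed

lemma jet_oracle_vec:
  assumes "\<And>\<alpha>. cmod (c \<alpha>) \<le> B"
  shows "jet D (gen D k) (\<lambda>\<alpha> R. oracle_vec D m a (c \<alpha>) R x) (\<lambda>\<alpha> R. part_vec D m (c \<alpha>) (comm (gen D k) R) x)"
proof -
  have 1: "jet D (gen D k) (\<lambda>\<alpha> R. emb m D (\<lambda>i j. complex_of_real a * (if i = j then 1 else 0) / sqrt (real D)) x) (\<lambda>\<alpha> R. 0)"
    by (rule jet_const[of "\<lambda>_. _" "cmod (emb m D (\<lambda>i j. complex_of_real a * (if i = j then 1 else 0) / sqrt (real D)) x)"]) simp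
  show ?thesis
    by (rule jet_eq[OF jet_add[OF 1 jet_part_vec[OF jet_comm_entry assms]]])
       (auto simp: oracle_vec_def part_vec_def emb_def add_divide_distrib)
qed

lemma oracle_vec_derivative:
  "((\<lambda>\<alpha>. oracle_vec D m a (b * cis \<alpha>) R x) has_vector_derivative \<i> * part_vec D m (b * cis \<alpha>) R x) (at \<alpha>)"
proof (cases "x div m < D \<and> x mod m < D")
  case True
  let ?z = "R $$ (x div m, x mod m)" and ?e = "complex_of_real a * (if x div m = x mod m then 1 else 0)"
  have "(cis has_vector_derivative \<i> * cis \<alpha>) (at \<alpha>)"
    unfolding has_vector_derivative_def by (rule has_derivative_cis[OF has_derivative_ident])
  hence "((\<lambda>\<alpha>. b * ?z / sqrt (real D) * cis \<alpha> + ?e / sqrt (real D)) has_vector_derivative b * ?z / sqrt (real D) * (\<i> * cis \<alpha>) + 0) (at \<alpha>)"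
    by (intro has_vector_derivative_add bounded_linear.has_vector_derivative[OF bounded_linear_mult_right] has_vector_derivative_const)
  thus ?thesis using True by (simp add: oracle_vec_def part_vec_def emb_def add_divide_distrib algebra_simps)
qed (auto simp: oracle_vec_def part_vec_def emb_def)

text \<open>The values of \<gamma> and \<Lambda> are the commutator bounds 8 and 8 D^2 rescaled by
  the squared prefactor b^2 / D of \<open>part_vec\<close>; 2 D is the Casimir eigenvalue. Their
  product is \<gamma> \<Lambda> = 8 b^2.\<close>

lemma oracle_field_reflections:
  assumes D: "0 < D" "D \<le> d" "D \<le> m" and ab: "a\<^sup>2 + b\<^sup>2 = 1" "0 \<le> b" and \<mu>: "min_seq D \<mu>"
  shows "oracle_field D (d * m) ({..<D} \<times> {..<D}) (gen D)
    (\<lambda>\<alpha> R. oracle_vec D m a (b * cis \<alpha>) R) (\<lambda>\<alpha> R. part_vec D m (b * cis \<alpha>) R)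
    (\<lambda>\<alpha> R k. part_vec D m (b * cis \<alpha>) (comm (gen D k) R))
    (\<lambda>\<alpha> R k. part_vec D m (b * cis \<alpha>) (comm (gen D k) (comm (gen D k) R)))
    (2 * real D) (b * sqrt (8 / real D)) (b * sqrt (8 * real D)) \<mu>"
proof (rule oracle_field.intro)
  have cb: "cmod (b * cis \<alpha>) = b" for \<alpha> using ab(2) by (simp add: norm_mult)
  hence cb': "cmod (b * cis \<alpha>) \<le> b" for \<alpha> by simp
  show "min_seq D \<mu>" by (rule \<mu>)
  show "\<exists>u. near_exp D (gen D k) t u" if "k \<in> {..<D} \<times> {..<D}" "0 < t" "t \<le> 1" for k t
    using that by (rule near_exp_gen)
  show "jet D (gen D k) (\<lambda>\<alpha> R. oracle_vec D m a (b * cis \<alpha>) R x) (\<lambda>\<alpha> R. part_vec D m (b * cis \<alpha>) (comm (gen D k) R) x)" for k x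
    by (rule jet_oracle_vec) (rule cb')
  show "jet D (gen D k) (\<lambda>\<alpha> R. part_vec D m (b * cis \<alpha>) (comm (gen D k) R) x)
     (\<lambda>\<alpha> R. part_vec D m (b * cis \<alpha>) (comm (gen D k) (comm (gen D k) R)) x)" for k x
    by (rule jet_part_vec[OF jet_comm_comm_entry]) (auto intro: cb')
  show "((\<lambda>\<alpha>. oracle_vec D m a (b * cis \<alpha>) R x) has_vector_derivative \<i> * part_vec D m (b * cis \<alpha>) R x) (at \<alpha>)" for \<alpha> R x
    by (rule oracle_vec_derivative)
  fix \<alpha> R assume R: "R \<in> hermitian_reflections D"
  hence Rc: "R \<in> carrier_mat D D" "(\<Sum>i<D. R $$ (i,i)) = 0" by (auto simp: hermitian_reflections_def)
  define c where "c = b * cis \<alpha>"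
  have c: "cmod c = b" by (simp add: c_def cb)
  show "oracle_point (d * m) ({..<D} \<times> {..<D}) (oracle_vec D m a (b * cis \<alpha>) R) (part_vec D m (b * cis \<alpha>) R)
    (\<lambda>k. part_vec D m (b * cis \<alpha>) (comm (gen D k) R)) (\<lambda>k. part_vec D m (b * cis \<alpha>) (comm (gen D k) (comm (gen D k) R)))
    (2 * real D) (b * sqrt (8 / real D)) (b * sqrt (8 * real D))"
    unfolding c_def[symmetric]
  proof
    show "finite ({..<D} \<times> {..<D})" by simp
    show "(\<Sum>x<d * m. cnj (oracle_vec D m a c R x) * oracle_vec D m a c R x) = 1"
      by (rule oracle_vec_unit[OF R D]) (simp add: c ab)
    show "(\<Sum>k\<in>{..<D} \<times> {..<D}. part_vec D m c (comm (gen D k) (comm (gen D k) R)) x) = - complex_of_real (2 * real D) * part_vec D m c R x" for x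
    proof (cases "x div m < D \<and> x mod m < D")
      case True
      have "(\<Sum>k\<in>{..<D} \<times> {..<D}. part_vec D m c (comm (gen D k) (comm (gen D k) R)) x) =
        c * (\<Sum>k\<in>{..<D} \<times> {..<D}. comm (gen D k) (comm (gen D k) R) $$ (x div m, x mod m)) / sqrt (real D)"
        using True by (simp add: part_vec_def emb_def sum_divide_distrib sum_distrib_left)
      also have "(\<Sum>k\<in>{..<D} \<times> {..<D}. comm (gen D k) (comm (gen D k) R) $$ (x div m, x mod m)) = - (2 * of_nat D) * R $$ (x div m, x mod m)"
        by (rule casimir[OF Rc]) (use True in auto)
      finally show ?thesis using True by (simp add: part_vec_def emb_def)
    next
      case False
      hence "part_vec D m c A x = 0" for A by (auto simp: part_vec_def emb_def)
      thus ?thesis by simp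
    qed
    show "0 \<le> b * sqrt (8 / real D)" "0 \<le> b * sqrt (8 * real D)" "0 < 2 * real D" using ab D by auto
    have sq: "(b * sqrt (8 / real D))\<^sup>2 = b\<^sup>2 * (8 / real D)" "(b * sqrt (8 * real D))\<^sup>2 = b\<^sup>2 * (8 * real D)"
      by (simp_all add: power_mult_distrib)
    show "(\<Sum>k\<in>{..<D} \<times> {..<D}. \<Sum>x<d * m. (cmod (part_vec D m c (comm (gen D k) R) x))\<^sup>2) \<le> (b * sqrt (8 * real D))\<^sup>2"
    proof -
      have "(\<Sum>k\<in>{..<D} \<times> {..<D}. \<Sum>x<d * m. (cmod (part_vec D m c (comm (gen D k) R) x))\<^sup>2)
        = b\<^sup>2 / D * (\<Sum>k\<in>{..<D} \<times> {..<D}. \<Sum>i<D. \<Sum>j<D. (cmod (comm (gen D k) R $$ (i,j)))\<^sup>2)"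
        using D by (simp add: part_vec_norm_sq sum_emb c sum_distrib_left)
      also have "\<dots> \<le> b\<^sup>2 / D * (8 * (real D)\<^sup>2)" by (intro mult_left_mono sum_comm_frob_le R) auto
      also have "\<dots> = b\<^sup>2 * (8 * real D)" using D by (simp add: power2_eq_square)
      finally show ?thesis unfolding sq .
    qed
    show "(\<Sum>k\<in>{..<D} \<times> {..<D}. (cmod (\<Sum>x<d * m. cnj (part_vec D m c (comm (gen D k) R) x) * v x))\<^sup>2)
       \<le> (b * sqrt (8 / real D))\<^sup>2 * (\<Sum>x<d * m. (cmod (v x))\<^sup>2)" for v
    proof -
      let ?v = "\<lambda>i j. v (i * m + j)"
      have e: "(\<Sum>x<d * m. cnj (part_vec D m c A x) * v x) = cnj c / sqrt (real D) * (\<Sum>i<D. \<Sum>j<D. cnj (A $$ (i,j)) * ?v i j)" for A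
      proof -
        have "(\<Sum>x<d * m. cnj (part_vec D m c A x) * v x) = (\<Sum>x<d * m. emb m D (\<lambda>i j. cnj c / sqrt (real D) * (cnj (A $$ (i,j)) * ?v i j)) x)"
          by (intro sum.cong refl) (simp add: part_vec_def emb_def)
        thus ?thesis using D by (simp add: sum_emb sum_distrib_left)
      qed
      have "(\<Sum>k\<in>{..<D} \<times> {..<D}. (cmod (\<Sum>x<d * m. cnj (part_vec D m c (comm (gen D k) R) x) * v x))\<^sup>2)
        = b\<^sup>2 / D * (\<Sum>k\<in>{..<D} \<times> {..<D}. (cmod (\<Sum>i<D. \<Sum>j<D. cnj (comm (gen D k) R $$ (i,j)) * ?v i j))\<^sup>2)"
      proof -
        have n: "(cmod (cnj c / sqrt (real D) * z))\<^sup>2 = b\<^sup>2 / D * (cmod z)\<^sup>2" for z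
          by (simp add: norm_mult norm_divide power_mult_distrib power_divide c)
        show ?thesis unfolding e n by (rule sum_distrib_left[symmetric])
      qed
      also have "\<dots> \<le> b\<^sup>2 / D * (8 * (\<Sum>i<D. \<Sum>j<D. (cmod (?v i j))\<^sup>2))"
        by (intro mult_left_mono sum_comm_inner_le R) auto
      also have "\<dots> \<le> b\<^sup>2 / D * (8 * (\<Sum>x<d * m. (cmod (v x))\<^sup>2))"
      proof -
        have "(\<Sum>i<D. \<Sum>j<D. (cmod (?v i j))\<^sup>2) = (\<Sum>x<d * m. emb m D (\<lambda>i j. (cmod (?v i j))\<^sup>2) x)"
          using D by (simp add: sum_emb)
        also have "\<dots> \<le> (\<Sum>x<d * m. (cmod (v x))\<^sup>2)" by (intro sum_mono) (simp add: emb_def)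
        finally show ?thesis by (intro mult_left_mono) auto
      qed
      also have "\<dots> = (b * sqrt (8 / real D))\<^sup>2 * (\<Sum>x<d * m. (cmod (v x))\<^sup>2)" unfolding sq by simp
      finally show ?thesis .
    qed
  qed
qed

text \<open>Signs alternating along the diagonal are balanced when the size is even.\<close>

lemma hermitian_reflections_nonempty:
  assumes "even D"
  shows "\<exists>R. R \<in> hermitian_reflections D"
proof
  let ?R = "mat D D (\<lambda>(i,j). if i = j then (-1) ^ i else 0 :: complex)"
  have "?R * ?R = 1\<^sub>m D"
  proof (rule eq_matI)
    fix i j assume "i < dim_row (1\<^sub>m D :: complex mat)" "j < dim_col (1\<^sub>m D :: complex mat)"
    hence ij: "i < D" "j < D" by auto
    have "(?R * ?R) $$ (i,j) = (\<Sum>k<D. ?R $$ (i,k) * ?R $$ (k,j))"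
      using ij by (simp add: index_mult_mat_sum del: index_mult_mat(1))
    also have "\<dots> = (\<Sum>k<D. if k = i then (if i = j then 1 else 0) else 0)"
      using ij by (intro sum.cong refl) (auto simp: power_mult_distrib[symmetric])
    finally show "(?R * ?R) $$ (i,j) = 1\<^sub>m D $$ (i,j)" using ij by simp
  qed auto
  moreover have "mat_adjoint ?R = ?R" by (rule eq_matI) auto
  moreover have "(\<Sum>i<D. ?R $$ (i,i)) = 0"
  proof -
    obtain h where h: "D = 2 * h" using assms by blast
    have "(\<Sum>i<2 * h. (-1) ^ i) = (0 :: complex)" by (induct h) auto
    thus ?thesis by (simp add: h)
  qed
  ultimately show "?R \<in> hermitian_reflections D" by (simp add: hermitian_reflections_def)
qed

section \<open>Query algorithms as step lists\<close>

text \<open>Control qubit \<open>c\<close> and workspace \<open>y\<close>, on which the oracle does not act, are merged into a block index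
  \<open>j = c * w + y\<close>; \<open>site\<close> is the position of \<open>(j, x)\<close> in the register \<open>C \<otimes> AB \<otimes> W\<close>.\<close>
definition site :: "nat \<Rightarrow> nat \<Rightarrow> nat \<times> nat \<Rightarrow> nat" where
  "site n w q = ((fst q div w) * n + snd q) * w + fst q mod w"

lemma site_bij:
  assumes "0 < n" "0 < w"
  shows "bij_betw (site n w) ({..<2 * w} \<times> {..<n}) {..<2 * n * w}"
proof (rule bij_betw_byWitness[where f' = "\<lambda>i. (((i div w) div n) * w + i mod w, (i div w) mod n)"])
  show "\<forall>q\<in>{..<2 * w} \<times> {..<n}. (((site n w q div w) div n) * w + site n w q mod w, (site n w q div w) mod n) = q"
    using assms by (auto simp: site_def)
  show "\<forall>i\<in>{..<2 * n * w}. site n w (((i div w) div n) * w + i mod w, (i div w) mod n) = i"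
    using assms by (auto simp: site_def)
  show "site n w ` ({..<2 * w} \<times> {..<n}) \<subseteq> {..<2 * n * w}"
  proof
    fix i assume "i \<in> site n w ` ({..<2 * w} \<times> {..<n})"
    then obtain j x where i: "i = (j div w * n + x) * w + j mod w" "j < 2 * w" "x < n" by (auto simp: site_def)
    have "j div w < 2" using i(2) by (simp add: less_mult_imp_div_less)
    hence "j div w * n + x < 2 * n" using i(3) by (cases "j div w") auto
    hence "Suc (j div w * n + x) * w \<le> 2 * n * w" by (intro mult_right_mono) auto
    moreover have "j mod w < w" using assms by simp
    ultimately show "i \<in> {..<2 * n * w}" by (simp add: i(1))
  qed
  show "(\<lambda>i. (((i div w) div n) * w + i mod w, (i div w) mod n)) ` {..<2 * n * w} \<subseteq> {..<2 * w} \<times> {..<n}"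
  proof
    fix q assume "q \<in> (\<lambda>i. (((i div w) div n) * w + i mod w, (i div w) mod n)) ` {..<2 * n * w}"
    then obtain i where i: "i < 2 * n * w" "q = (((i div w) div n) * w + i mod w, (i div w) mod n)" by auto
    have "i div w < 2 * n" using i(1) by (simp add: less_mult_imp_div_less)
    hence "(i div w) div n < 2" by (simp add: less_mult_imp_div_less)
    hence "(i div w) div n * w \<le> 1 * w" by (intro mult_right_mono) auto
    moreover have "i mod w < w" using assms by simp
    ultimately have "(i div w) div n * w + i mod w < 2 * w" by linarith
    thus "q \<in> {..<2 * w} \<times> {..<n}" using assms i(2) by simp
  qed
qed

lemma sum_site:
  assumes "0 < n" "0 < w"
  shows "(\<Sum>q\<in>{..<2 * w} \<times> {..<n}. f (site n w q)) = (\<Sum>i<2 * n * w. f i)"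
  using sum.reindex_bij_betw[OF site_bij[OF assms]] .

lemma site_less:
  assumes "0 < n" "0 < w" "q \<in> {..<2 * w} \<times> {..<n}"
  shows "site n w q < 2 * n * w"
  using bij_betw_apply[OF site_bij[OF assms(1,2)] assms(3)] by simp

lemma site_eq_iff:
  assumes "0 < n" "0 < w" "q \<in> {..<2 * w} \<times> {..<n}" "r \<in> {..<2 * w} \<times> {..<n}"
  shows "site n w q = site n w r \<longleftrightarrow> q = r"
  using inj_on_eq_iff[OF bij_betw_imp_inj_on[OF site_bij[OF assms(1,2)]] assms(3,4)] .

definition mat_kernel :: "nat \<Rightarrow> nat \<Rightarrow> complex mat \<Rightarrow> nat \<times> nat \<Rightarrow> nat \<times> nat \<Rightarrow> complex" where
  "mat_kernel n w V q r = V $$ (site n w q, site n w r)"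

definition lift_kernel :: "nat set \<Rightarrow> complex mat \<Rightarrow> nat \<times> nat \<Rightarrow> nat \<times> nat \<Rightarrow> complex" where
  "lift_kernel S U q r = (if fst q = fst r then (if fst q \<in> S then U $$ (snd q, snd r) else if snd q = snd r then 1 else 0) else 0)"

lemma unitary_mat_adjoint: "unitary_mat n U \<Longrightarrow> unitary_mat n (mat_adjoint U)"
proof -
  assume U: "unitary_mat n U"
  hence c: "U \<in> carrier_mat n n" by (simp add: unitary_mat_def)
  hence "mat_adjoint (mat_adjoint U) = U" by (intro eq_matI) auto
  thus ?thesis using U by (auto simp: unitary_mat_def)
qed

lemma isometry_mat_kernel:
  assumes V: "unitary_mat (2 * n * w) V" and nw: "0 < n" "0 < w"
  shows "isometry_kernel (2 * w) n (mat_kernel n w V)"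
  unfolding isometry_kernel_def
proof (intro ballI)
  fix r r' assume r: "r \<in> {..<2 * w} \<times> {..<n}" "r' \<in> {..<2 * w} \<times> {..<n}"
  have "(\<Sum>q\<in>{..<2 * w} \<times> {..<n}. cnj (mat_kernel n w V q r) * mat_kernel n w V q r') =
    (\<Sum>i<2 * n * w. cnj (V $$ (i, site n w r)) * V $$ (i, site n w r'))"
    unfolding mat_kernel_def by (rule sum_site[OF nw])
  also have "\<dots> = (if site n w r = site n w r' then 1 else 0)"
    by (rule unitary_mat_col[OF V]) (intro site_less nw r)+
  finally show "(\<Sum>q\<in>{..<2 * w} \<times> {..<n}. cnj (mat_kernel n w V q r) * mat_kernel n w V q r') = (if r = r' then 1 else 0)"
    by (simp add: site_eq_iff nw r)
qed

lemma isometry_lift_kernel: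
  assumes U: "unitary_mat n U"
  shows "isometry_kernel B n (lift_kernel S U)"
  unfolding isometry_kernel_def
proof (intro ballI)
  fix r r' assume r: "r \<in> {..<B} \<times> {..<n}" "r' \<in> {..<B} \<times> {..<n}"
  obtain j x j' x' where rr: "r = (j,x)" "r' = (j',x')" by force
  have b: "j < B" "x < n" "j' < B" "x' < n" using r rr by auto
  have "(\<Sum>q\<in>{..<B} \<times> {..<n}. cnj (lift_kernel S U q r) * lift_kernel S U q r') =
    (\<Sum>l<B. \<Sum>y<n. cnj (lift_kernel S U (l,y) r) * lift_kernel S U (l,y) r')"
    by (rule sum_pairs)
  also have "\<dots> = (\<Sum>l<B. if l = j then (if j = j' then (if x = x' then 1 else 0) else 0) else 0)"
  proof (intro sum.cong refl)
    fix l assume "l \<in> {..<B}"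
    show "(\<Sum>y<n. cnj (lift_kernel S U (l,y) r) * lift_kernel S U (l,y) r') = (if l = j then (if j = j' then (if x = x' then 1 else 0) else 0) else 0)"
    proof (cases "l = j \<and> j = j'")
      case True
      show ?thesis
      proof (cases "j \<in> S")
        case False
        have "(\<Sum>y<n. cnj (if y = x then 1 else 0) * (if y = x' then 1 else 0)) = (if x = x' then 1 else (0::complex))"
          using b by (simp add: if_distrib[of cnj] if_distrib[of "\<lambda>z. z * _"] cong: if_cong)
        thus ?thesis using True False by (simp add: lift_kernel_def rr)
      qed (use True unitary_mat_col[OF U b(2,4)] in \<open>simp add: lift_kernel_def rr\<close>)
    qed (auto simp: lift_kernel_def rr)
  qed
  finally show "(\<Sum>q\<in>{..<B} \<times> {..<n}. cnj (lift_kernel S U q r) * lift_kernel S U q r') = (if r = r' then 1 else 0)"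
    using b by (auto simp: rr)
qed

lemma isometry_kernel_cong:
  assumes "\<And>q r. q \<in> {..<B} \<times> {..<n} \<Longrightarrow> r \<in> {..<B} \<times> {..<n} \<Longrightarrow> A q r = A' q r" "isometry_kernel B n A"
  shows "isometry_kernel B n A'"
  using assms unfolding isometry_kernel_def by simp

lemma valid_mat_kernel:
  assumes V: "unitary_mat (2 * n * w) V" and nw: "0 < n" "0 < w"
  shows "valid_step (2 * w) n (Fixed (mat_kernel n w V))"
proof -
  have "isometry_kernel (2 * w) n (adj_kernel (mat_kernel n w V))"
  proof (rule isometry_kernel_cong[OF _ isometry_mat_kernel[OF unitary_mat_adjoint[OF V] nw]])
    fix q r assume "q \<in> {..<2 * w} \<times> {..<n}" "r \<in> {..<2 * w} \<times> {..<n}"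
    thus "mat_kernel n w (mat_adjoint V) q r = adj_kernel (mat_kernel n w V) q r"
      using V site_less[OF nw] by (auto simp: mat_kernel_def adj_kernel_def unitary_mat_def)
  qed
  thus ?thesis using isometry_mat_kernel[OF V nw] by simp
qed

lemma valid_lift_kernel:
  assumes U: "unitary_mat n U"
  shows "valid_step B n (Fixed (lift_kernel S U))"
proof -
  have "isometry_kernel B n (adj_kernel (lift_kernel S U))"
  proof (rule isometry_kernel_cong[OF _ isometry_lift_kernel[OF unitary_mat_adjoint[OF U]]])
    fix q r assume "q \<in> {..<B} \<times> {..<n}" "r \<in> {..<B} \<times> {..<n}"
    thus "lift_kernel S (mat_adjoint U) q r = adj_kernel (lift_kernel S U) q r"
      using U by (auto simp: lift_kernel_def adj_kernel_def unitary_mat_def)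
  qed
  thus ?thesis using isometry_lift_kernel[OF U] by simp
qed

lemma apply_mat_kernel:
  assumes V: "V \<in> carrier_mat (2 * n * w) (2 * n * w)" and \<psi>: "\<psi> \<in> carrier_vec (2 * n * w)" and nw: "0 < n" "0 < w"
    and q: "q \<in> {..<2 * w} \<times> {..<n}" and u: "\<And>r. r \<in> {..<2 * w} \<times> {..<n} \<Longrightarrow> u r = \<psi> $ site n w r"
  shows "apply_kernel (2 * w) n (mat_kernel n w V) u q = (V *\<^sub>v \<psi>) $ site n w q"
proof -
  have "apply_kernel (2 * w) n (mat_kernel n w V) u q = (\<Sum>r\<in>{..<2 * w} \<times> {..<n}. V $$ (site n w q, site n w r) * \<psi> $ site n w r)"
    unfolding apply_kernel_def mat_kernel_def by (intro sum.cong refl) (simp add: u)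
  also have "\<dots> = (\<Sum>i<2 * n * w. V $$ (site n w q, i) * \<psi> $ i)" by (rule sum_site[OF nw])
  also have "\<dots> = (V *\<^sub>v \<psi>) $ site n w q"
    using V \<psi> site_less[OF nw q] by (auto simp: scalar_prod_def lessThan_atLeast0 intro!: sum.cong)
  finally show ?thesis .
qed

lemma apply_lift_kernel:
  assumes "j < B" "x < n"
  shows "apply_kernel B n (lift_kernel S U) u (j,x) = (if j \<in> S then \<Sum>y<n. U $$ (x,y) * u (j,y) else u (j,x))"
proof -
  have "apply_kernel B n (lift_kernel S U) u (j,x) = (\<Sum>l<B. \<Sum>y<n. lift_kernel S U (j,x) (l,y) * u (l,y))"
    unfolding apply_kernel_def by (rule sum_pairs)
  also have "\<dots> = (\<Sum>l<B. if l = j then (if j \<in> S then \<Sum>y<n. U $$ (x,y) * u (j,y) else u (j,x)) else 0)"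
    using assms by (intro sum.cong refl) (auto simp: lift_kernel_def if_distrib[of "\<lambda>z. z * _"] cong: if_cong)
  finally show ?thesis using assms by simp
qed

text \<open>The control qubit is the leading digit of the block index c * w + y, so control value 1
  means j \<ge> w; an uncontrolled query acts in every block.\<close>

fun query_blocks :: "nat \<Rightarrow> query \<Rightarrow> nat set" where
  "query_blocks w Q_U = UNIV"
| "query_blocks w Q_Uadj = UNIV"
| "query_blocks w Q_ctrl_U = {w..}"
| "query_blocks w Q_ctrl_Uadj = {w..}"

fun query_mat :: "complex mat \<Rightarrow> query \<Rightarrow> complex mat" where
  "query_mat U Q_U = U"
| "query_mat U Q_Uadj = mat_adjoint U"
| "query_mat U Q_ctrl_U = U"
| "query_mat U Q_ctrl_Uadj = mat_adjoint U"

lemma kron_dim [simp]: "dim_row (kron A B) = dim_row A * dim_row B" "dim_col (kron A B) = dim_col A * dim_col B"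
  by (auto simp: kron_def)

lemma kron_index:
  "i < dim_row A * dim_row B \<Longrightarrow> j < dim_col A * dim_col B \<Longrightarrow>
   kron A B $$ (i,j) = A $$ (i div dim_row B, j div dim_col B) * B $$ (i mod dim_row B, j mod dim_col B)"
  by (simp add: kron_def)

lemma site_div_mod:
  assumes "0 < w" "snd q < n"
  shows "site n w q div w = fst q div w * n + snd q" "site n w q mod w = fst q mod w"
    "site n w q div w div n = fst q div w" "site n w q div w mod n = snd q"
  using assms by (auto simp: site_def)

lemma query_op_dim:
  assumes "U \<in> carrier_mat n n"
  shows "query_op n w U q \<in> carrier_mat (2 * n * w) (2 * n * w)"
  using assms by (cases q) (auto simp: ctrl_def)

lemma query_op_index:
  assumes U: "U \<in> carrier_mat n n" and nw: "0 < n" "0 < w"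
    and q: "q \<in> {..<2 * w} \<times> {..<n}" and r: "r \<in> {..<2 * w} \<times> {..<n}"
  shows "query_op n w U Q $$ (site n w q, site n w r) = lift_kernel (query_blocks w Q) (query_mat U Q) q r"
proof -
  obtain j x where qq: "q = (j,x)" "j < 2 * w" "x < n" using q by auto
  obtain l y where rr: "r = (l,y)" "l < 2 * w" "y < n" using r by auto
  note sd = site_div_mod[OF nw(2), of q n] site_div_mod[OF nw(2), of r n]
  have s: "site n w q < 2 * n * w" "site n w r < 2 * n * w" by (intro site_less nw q r)+
  have s': "site n w q div w < 2 * n" "site n w r div w < 2 * n" using s by (simp_all add: less_mult_imp_div_less)
  have c: "j div w < 2" "l div w < 2" using qq rr by (simp_all add: less_mult_imp_div_less)
  have jl: "j = l \<longleftrightarrow> j div w = l div w \<and> j mod w = l mod w" by (metis div_mult_mod_eq)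
  have m: "j mod w < w" "l mod w < w" using nw by auto
  have plain: "kron (kron (1\<^sub>m 2) V) (1\<^sub>m w) $$ (site n w q, site n w r) = lift_kernel UNIV V q r"
    if V: "V \<in> carrier_mat n n" for V
    using s s' V sd qq rr c m jl by (simp add: kron_index lift_kernel_def)
  have controlled: "kron (ctrl n V) (1\<^sub>m w) $$ (site n w q, site n w r) = lift_kernel {w..} V q r"
    if V: "V \<in> carrier_mat n n" for V
  proof -
    have d: "dim_row (ctrl n V) = 2 * n" "dim_col (ctrl n V) = 2 * n" using V by (auto simp: ctrl_def)
    have "kron (ctrl n V) (1\<^sub>m w) $$ (site n w q, site n w r) =
      ctrl n V $$ (j div w * n + x, l div w * n + y) * (if j mod w = l mod w then 1 else 0)"
      using s sd qq rr m by (simp add: kron_index d)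
    also have "ctrl n V $$ (j div w * n + x, l div w * n + y) =
      (if j div w = l div w then (if j div w = 1 then V $$ (x,y) else if x = y then 1 else 0) else 0)"
    proof -
      have "j div w = 0 \<or> j div w = 1" "l div w = 0 \<or> l div w = 1" using c by auto
      thus ?thesis using V qq rr unfolding ctrl_def by (elim disjE) auto
    qed
    finally have e: "kron (ctrl n V) (1\<^sub>m w) $$ (site n w q, site n w r) =
      (if j div w = l div w then (if j div w = 1 then V $$ (x,y) else if x = y then 1 else 0) else 0) * (if j mod w = l mod w then 1 else 0)" .
    have "w \<le> j \<longleftrightarrow> j div w = 1" using c(1) nw div_greater_zero_iff[of j w] by auto
    thus ?thesis unfolding e by (simp add: lift_kernel_def qq rr jl)
  qed
  have "mat_adjoint U \<in> carrier_mat n n" using U by auto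
  thus ?thesis using plain controlled U by (cases Q) simp_all
qed

section \<open>Reflections as matrices and the translation of queries\<close>

definition refl_mat :: "nat \<Rightarrow> (nat \<Rightarrow> complex) \<Rightarrow> complex mat" where
  "refl_mat n h = mat n n (\<lambda>(x,y). 2 * (h x * cnj (h y)) - (if x = y then 1 else 0))"

lemma refl_mat_carrier [simp]: "refl_mat n h \<in> carrier_mat n n" "dim_row (refl_mat n h) = n" "dim_col (refl_mat n h) = n"
  by (auto simp: refl_mat_def)

lemma refl_mat_adjoint: "mat_adjoint (refl_mat n h) = refl_mat n h"
  by (rule eq_matI) (auto simp: refl_mat_def)

lemma refl_mat_apply:
  assumes "x < n"
  shows "(\<Sum>y<n. refl_mat n h $$ (x,y) * v y) = 2 * (h x * (\<Sum>y<n. cnj (h y) * v y)) - v x"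
proof -
  have "(\<Sum>y<n. refl_mat n h $$ (x,y) * v y) = (\<Sum>y<n. 2 * h x * (cnj (h y) * v y) - (if y = x then v x else 0))"
    using assms by (intro sum.cong refl) (auto simp: refl_mat_def algebra_simps)
  also have "\<dots> = 2 * h x * (\<Sum>y<n. cnj (h y) * v y) - v x"
    using assms by (simp only: sum_subtractf sum_distrib_left[symmetric]) simp
  finally show ?thesis by simp
qed

lemma refl_mat_unitary:
  assumes "(\<Sum>x<n. cnj (h x) * h x) = 1"
  shows "unitary_mat n (refl_mat n h)"
proof -
  have "refl_mat n h * refl_mat n h = 1\<^sub>m n"
  proof (rule eq_matI)
    fix x y assume "x < dim_row (1\<^sub>m n :: complex mat)" "y < dim_col (1\<^sub>m n :: complex mat)"
    hence xy: "x < n" "y < n" by auto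
    have "(refl_mat n h * refl_mat n h) $$ (x,y) = (\<Sum>z<n. refl_mat n h $$ (x,z) * refl_mat n h $$ (z,y))"
      using xy by (simp add: index_mult_mat_sum del: index_mult_mat(1))
    also have "\<dots> = 2 * (h x * (\<Sum>z<n. cnj (h z) * refl_mat n h $$ (z,y))) - refl_mat n h $$ (x,y)"
      by (rule refl_mat_apply) (rule xy)
    also have "(\<Sum>z<n. cnj (h z) * refl_mat n h $$ (z,y)) = (\<Sum>z<n. cnj (h z) * h z * (2 * cnj (h y)) - (if z = y then cnj (h y) else 0))"
      using xy by (intro sum.cong refl) (auto simp: refl_mat_def algebra_simps)
    also have "\<dots> = cnj (h y)" using xy assms by (simp add: sum_subtractf sum_distrib_right[symmetric])
    finally show "(refl_mat n h * refl_mat n h) $$ (x,y) = 1\<^sub>m n $$ (x,y)" using xy by (simp add: refl_mat_def)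
  qed auto
  thus ?thesis by (simp add: unitary_mat_def refl_mat_adjoint)
qed

lemma apply_lift_refl_mat:
  assumes "q \<in> {..<B} \<times> {..<n}"
  shows "apply_kernel B n (lift_kernel S (refl_mat n h)) u q = refl_op n S h u q"
proof -
  obtain j x where q: "q = (j,x)" "j < B" "x < n" using assms by auto
  show ?thesis unfolding q(1) apply_lift_kernel[OF q(2,3)] refl_mat_apply[OF q(3)]
    by (simp add: refl_op_def bra_def)
qed

lemma apply_lift_mult:
  assumes "q \<in> {..<B} \<times> {..<n}" "U \<in> carrier_mat n n" "V \<in> carrier_mat n n"
  shows "apply_kernel B n (lift_kernel S (U * V)) u q = apply_kernel B n (lift_kernel S U) (apply_kernel B n (lift_kernel S V) u) q"
proof -
  obtain j x where q: "q = (j,x)" "j < B" "x < n" using assms by auto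
  have "(\<Sum>y<n. (U * V) $$ (x,y) * u (j,y)) = (\<Sum>y<n. \<Sum>z<n. U $$ (x,z) * (V $$ (z,y) * u (j,y)))"
    using assms(2,3) q by (intro sum.cong refl) (auto simp: index_mult_mat_sum sum_distrib_left sum_distrib_right mult_ac simp del: index_mult_mat(1))
  also have "\<dots> = (\<Sum>z<n. U $$ (x,z) * (\<Sum>y<n. V $$ (z,y) * u (j,y)))"
    by (subst sum.swap) (simp add: sum_distrib_left)
  finally show ?thesis using q by (simp add: apply_lift_kernel)
qed

text \<open>The oracle is a hidden reflection after the known unitary \<open>U0\<close>. The
  reflection being self-adjoint, the adjoint oracle uses the same \<open>Oracle\<close> step,
  followed by the adjoint of \<open>U0\<close>.\<close>

fun query_steps :: "nat \<Rightarrow> complex mat \<Rightarrow> query \<Rightarrow> step list" where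
  "query_steps w U0 Q_U = [Fixed (lift_kernel UNIV U0), Oracle UNIV]"
| "query_steps w U0 Q_Uadj = [Oracle UNIV, Fixed (lift_kernel UNIV (mat_adjoint U0))]"
| "query_steps w U0 Q_ctrl_U = [Fixed (lift_kernel {w..} U0), Oracle {w..}]"
| "query_steps w U0 Q_ctrl_Uadj = [Oracle {w..}, Fixed (lift_kernel {w..} (mat_adjoint U0))]"

definition algorithm_steps :: "nat \<Rightarrow> nat \<Rightarrow> complex mat \<Rightarrow> complex mat list \<Rightarrow> query list \<Rightarrow> step list" where
  "algorithm_steps n w U0 Vs qs = Fixed (mat_kernel n w (hd Vs)) #
     concat (map (\<lambda>(q,V). query_steps w U0 q @ [Fixed (mat_kernel n w V)]) (zip qs (tl Vs)))"

lemma mat_adjoint_mult: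
  fixes A B :: "complex mat"
  assumes "A \<in> carrier_mat n n" "B \<in> carrier_mat n n"
  shows "mat_adjoint (A * B) = mat_adjoint B * mat_adjoint A"
proof (rule eq_matI)
  have d: "dim_row A = n" "dim_col A = n" "dim_row B = n" "dim_col B = n" using assms by auto
  show "dim_row (mat_adjoint (A * B)) = dim_row (mat_adjoint B * mat_adjoint A)"
    "dim_col (mat_adjoint (A * B)) = dim_col (mat_adjoint B * mat_adjoint A)" by (simp_all add: d)
  fix i j assume "i < dim_row (mat_adjoint B * mat_adjoint A)" "j < dim_col (mat_adjoint B * mat_adjoint A)"
  hence ij: "i < n" "j < n" by (simp_all add: d)
  have "(A * B) $$ (j,i) = (\<Sum>k<n. A $$ (j,k) * B $$ (k,i))"
    using ij by (subst index_mult_mat_sum) (simp_all add: d)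
  moreover have "(mat_adjoint B * mat_adjoint A) $$ (i,j) = (\<Sum>k<n. cnj (B $$ (k,i)) * cnj (A $$ (j,k)))"
    using ij by (subst index_mult_mat_sum) (simp_all add: d)
  moreover have "mat_adjoint (A * B) $$ (i,j) = cnj ((A * B) $$ (j,i))"
    using ij by (intro mat_adjoint_index) (simp_all add: d)
  ultimately show "mat_adjoint (A * B) $$ (i,j) = (mat_adjoint B * mat_adjoint A) $$ (i,j)"
    by (simp add: mult.commute)
qed

lemma apply_kernel_cong:
  "(\<And>r. r \<in> {..<B} \<times> {..<n} \<Longrightarrow> A q r = A' q r) \<Longrightarrow> (\<And>r. r \<in> {..<B} \<times> {..<n} \<Longrightarrow> u r = u' r) \<Longrightarrow>
   apply_kernel B n A u q = apply_kernel B n A' u' q"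
  unfolding apply_kernel_def by (intro sum.cong refl) simp

lemma query_steps_correct:
  assumes U0: "unitary_mat n U0" and nw: "0 < n" "0 < w" and \<psi>: "\<psi> \<in> carrier_vec (2 * n * w)"
    and u: "\<And>r. r \<in> {..<2 * w} \<times> {..<n} \<Longrightarrow> fst J r = \<psi> $ site n w r"
    and q: "q \<in> {..<2 * w} \<times> {..<n}"
  shows "fst (fold (jet_step (2 * w) n h \<kappa> \<delta>) (query_steps w U0 Q) J) q = (query_op n w (refl_mat n h * U0) Q *\<^sub>v \<psi>) $ site n w q"
proof -
  let ?A = "apply_kernel (2 * w) n"
  have c: "U0 \<in> carrier_mat n n" "mat_adjoint U0 \<in> carrier_mat n n" "refl_mat n h * U0 \<in> carrier_mat n n"
    using U0 by (auto simp: unitary_mat_def)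
  have "(query_op n w (refl_mat n h * U0) Q *\<^sub>v \<psi>) $ site n w q = ?A (mat_kernel n w (query_op n w (refl_mat n h * U0) Q)) (fst J) q"
    by (rule apply_mat_kernel[symmetric]) (use query_op_dim[OF c(3)] \<psi> nw q u in auto)
  also have "\<dots> = ?A (lift_kernel (query_blocks w Q) (query_mat (refl_mat n h * U0) Q)) (fst J) q"
    by (rule apply_kernel_cong) (simp_all add: mat_kernel_def query_op_index[OF c(3) nw q])
  finally have e: "(query_op n w (refl_mat n h * U0) Q *\<^sub>v \<psi>) $ site n w q = \<dots>" .
  have 1: "?A (lift_kernel S (refl_mat n h * U0)) v q = refl_op n S h (?A (lift_kernel S U0) v) q" for S v
    using q c by (simp add: apply_lift_mult apply_lift_refl_mat)
  have 2: "?A (lift_kernel S (mat_adjoint (refl_mat n h * U0))) v q = ?A (lift_kernel S (mat_adjoint U0)) (refl_op n S h v) q" for S v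
  proof -
    have "?A (lift_kernel S (mat_adjoint (refl_mat n h * U0))) v q = ?A (lift_kernel S (mat_adjoint U0)) (?A (lift_kernel S (refl_mat n h)) v) q"
      using q c by (simp add: mat_adjoint_mult[of _ n] refl_mat_adjoint apply_lift_mult)
    also have "\<dots> = ?A (lift_kernel S (mat_adjoint U0)) (refl_op n S h v) q"
      by (rule apply_kernel_cong) (simp_all add: apply_lift_refl_mat)
    finally show ?thesis .
  qed
  obtain v d a where J: "J = (v,d,a)" by (cases J)
  show ?thesis unfolding e by (cases Q) (simp_all add: J 1 2)
qed

lemma algorithm_steps_correct:
  assumes U0: "unitary_mat n U0" and nw: "0 < n" and alg: "valid_algorithm n w T Vs qs"
    and u: "\<And>r. r \<in> {..<2 * w} \<times> {..<n} \<Longrightarrow> fst J r = unit_vec (2 * n * w) 0 $ site n w r"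
    and q: "q \<in> {..<2 * w} \<times> {..<n}"
  shows "fst (fold (jet_step (2 * w) n h \<kappa> \<delta>) (algorithm_steps n w U0 Vs qs) J) q = alg_final_state n w Vs qs (refl_mat n h * U0) $ site n w q"
proof -
  have w: "0 < w" and len: "length Vs = T + 1" and Vs: "\<And>V. V \<in> set Vs \<Longrightarrow> V \<in> carrier_mat (2 * n * w) (2 * n * w)"
    using alg by (auto simp: valid_algorithm_def unitary_mat_def)
  have ne: "Vs \<noteq> []" using len by auto
  let ?U = "refl_mat n h * U0"
  have c: "?U \<in> carrier_mat n n" using U0 by (auto simp: unitary_mat_def)
  \<comment> \<open>The rounds are handled for an arbitrary vector that agrees with the jet on the
    register, so that the induction can pass on the intermediate state.\<close>
  have loop: "fst (fold (jet_step (2 * w) n h \<kappa> \<delta>) (concat (map (\<lambda>(q,V). query_steps w U0 q @ [Fixed (mat_kernel n w V)]) ps)) J) q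
      = foldl (\<lambda>\<psi> (q, V). V *\<^sub>v (query_op n w ?U q *\<^sub>v \<psi>)) \<psi> ps $ site n w q"
    if "\<And>Q V. (Q,V) \<in> set ps \<Longrightarrow> V \<in> carrier_mat (2 * n * w) (2 * n * w)" "\<psi> \<in> carrier_vec (2 * n * w)"
       "\<And>r. r \<in> {..<2 * w} \<times> {..<n} \<Longrightarrow> fst J r = \<psi> $ site n w r"
    for ps \<psi> J
    using that
  proof (induct ps arbitrary: J \<psi>)
    case Nil thus ?case using q by simp
  next
    case (Cons p ps)
    obtain Q V where p: "p = (Q,V)" by force
    have V: "V \<in> carrier_mat (2 * n * w) (2 * n * w)" using Cons(2) p by auto
    define J' where "J' = fold (jet_step (2 * w) n h \<kappa> \<delta>) (query_steps w U0 Q) J"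
    have J': "fst J' r = (query_op n w ?U Q *\<^sub>v \<psi>) $ site n w r" if "r \<in> {..<2 * w} \<times> {..<n}" for r
      unfolding J'_def by (rule query_steps_correct[OF U0 nw w Cons(3) Cons(4) that])
    have \<psi>': "query_op n w ?U Q *\<^sub>v \<psi> \<in> carrier_vec (2 * n * w)" using query_op_dim[OF c, of w Q] Cons(3) by auto
    have "fst (jet_step (2 * w) n h \<kappa> \<delta> (Fixed (mat_kernel n w V)) J') r = (V *\<^sub>v (query_op n w ?U Q *\<^sub>v \<psi>)) $ site n w r"
      if "r \<in> {..<2 * w} \<times> {..<n}" for r
      unfolding jet_step_proj by (rule apply_mat_kernel[OF V \<psi>' nw w that J'])
    from Cons(1)[OF _ _ this] Cons(2) V \<psi>' show ?case by (auto simp: p J'_def)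
  qed
  have hd: "hd Vs \<in> carrier_mat (2 * n * w) (2 * n * w)" using Vs ne by auto
  have "fst (jet_step (2 * w) n h \<kappa> \<delta> (Fixed (mat_kernel n w (hd Vs))) J) r = (hd Vs *\<^sub>v unit_vec (2 * n * w) 0) $ site n w r"
    if "r \<in> {..<2 * w} \<times> {..<n}" for r
    unfolding jet_step_proj by (rule apply_mat_kernel[OF hd _ nw w that u]) auto
  from loop[OF _ _ this, of "zip qs (tl Vs)"] show ?thesis
    using hd Vs by (auto simp: algorithm_steps_def alg_final_state_def dest!: set_zip_rightD dest: list.set_sel(2)[OF ne])
qed

lemma algorithm_steps_valid:
  assumes U0: "unitary_mat n U0" and nw: "0 < n" and alg: "valid_algorithm n w T Vs qs"
  shows "\<forall>s\<in>set (algorithm_steps n w U0 Vs qs). valid_step (2 * w) n s"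
proof -
  have w: "0 < w" and len: "length Vs = T + 1" and Vs: "\<And>V. V \<in> set Vs \<Longrightarrow> unitary_mat (2 * n * w) V"
    using alg by (auto simp: valid_algorithm_def)
  have ne: "Vs \<noteq> []" using len by auto
  have 1: "valid_step (2 * w) n s" if "s \<in> set (query_steps w U0 Q)" for s Q
    using that valid_lift_kernel[OF U0] valid_lift_kernel[OF unitary_mat_adjoint[OF U0]] by (cases Q) auto
  have 2: "valid_step (2 * w) n (Fixed (mat_kernel n w V))" if "V \<in> set Vs" for V
    by (rule valid_mat_kernel[OF Vs[OF that] nw w])
  show ?thesis
    using 1 2 ne by (auto simp: algorithm_steps_def simp del: valid_step.simps dest!: set_zip_rightD dest: list.set_sel(2)[OF ne])
qed

lemma algorithm_steps_count:
  assumes alg: "valid_algorithm n w T Vs qs"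
  shows "oracle_count (algorithm_steps n w U0 Vs qs) = T"
proof -
  have 1: "oracle_count (query_steps w U0 Q) = 1" for Q by (cases Q) auto
  have "oracle_count (concat (map (\<lambda>(q,V). query_steps w U0 q @ [Fixed (mat_kernel n w V)]) ps)) = length ps" for ps
    by (induct ps) (auto simp: oracle_count_append 1)
  thus ?thesis using alg by (simp add: algorithm_steps_def valid_algorithm_def)
qed

lemma accept_prob_sites:
  assumes "0 < n" "0 < w"
  shows "accept_prob n w Vs qs S U = (\<Sum>q\<in>{..<2 * w} \<times> {..<n}.
     if site n w q \<in> S then (cmod (alg_final_state n w Vs qs U $ site n w q))\<^sup>2 else 0)"
proof -
  have "accept_prob n w Vs qs S U = (\<Sum>i<2 * n * w. if i \<in> S then (cmod (alg_final_state n w Vs qs U $ i))\<^sup>2 else 0)"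
    unfolding accept_prob_def by (subst Int_commute) (rule sum.inter_restrict, simp)
  thus ?thesis using sum_site[OF assms, of "\<lambda>i. if i \<in> S then (cmod (alg_final_state n w Vs qs U $ i))\<^sup>2 else 0"] by simp
qed

section \<open>The encoded state and the lower bound\<close>

definition diag_vec :: "nat \<Rightarrow> nat \<Rightarrow> nat \<Rightarrow> complex" where
  "diag_vec m d = emb m d (\<lambda>i j. if i = j then 1 / sqrt (real d) else 0)"

text \<open>A Householder-like construction: the reflection about the normalised bisector of two
  unit vectors with real inner product exchanges them, here the zero basis vector and
  \<open>diag_vec\<close>. Their inner product is 1 / sqrt d, so the sum has squared norm 2 + 2 /
  sqrt d.\<close>

definition base_mat :: "nat \<Rightarrow> nat \<Rightarrow> complex mat" where
  "base_mat m d = refl_mat (d * m) (\<lambda>x. ((if x = 0 then 1 else 0) + diag_vec m d x) / sqrt (2 + 2 / sqrt (real d)))"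

lemma diag_vec_cnj: "cnj (diag_vec m d x) = diag_vec m d x"
  by (simp add: diag_vec_def emb_def)

lemma base_mat:
  assumes d: "0 < d" "d \<le> m"
  shows "unitary_mat (d * m) (base_mat m d)" and "\<And>y. y < d * m \<Longrightarrow> base_mat m d $$ (y,0) = diag_vec m d y"
proof -
  let ?f = "diag_vec m d" and ?s = "2 + 2 / sqrt (real d)"
  let ?e = "\<lambda>x::nat. if x = 0 then 1 else (0::complex)"
  have pos: "0 < d * m" using d by simp
  have s: "0 < ?s" using d by (simp add: add_pos_nonneg)
  have f0: "?f 0 = 1 / sqrt (real d)" using d by (simp add: diag_vec_def emb_def)
  have nf: "(\<Sum>x<d * m. ?f x * ?f x) = 1"
  proof -
    have "(\<Sum>x<d * m. ?f x * ?f x) = (\<Sum>x<d * m. emb m d (\<lambda>i j. if i = j then 1 / complex_of_real (real d) else 0) x)"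
      by (intro sum.cong refl) (simp add: diag_vec_def emb_def flip: of_real_mult)
    thus ?thesis using d by (simp add: sum_emb)
  qed
  have "(\<Sum>x<d * m. (?e x + ?f x) * (?e x + ?f x)) = (\<Sum>x<d * m. (if x = 0 then 1 + 2 * ?f 0 else 0) + ?f x * ?f x)"
    by (intro sum.cong refl) (auto simp: algebra_simps)
  also have "\<dots> = complex_of_real ?s" using pos by (simp add: sum.distrib nf f0)
  finally have 1: "(\<Sum>x<d * m. (?e x + ?f x) * (?e x + ?f x)) = complex_of_real ?s" .
  have ss: "complex_of_real (sqrt ?s) * complex_of_real (sqrt ?s) = complex_of_real ?s"
    using s by (simp only: of_real_mult[symmetric]) simp
  have "(\<Sum>x<d * m. cnj ((?e x + ?f x) / sqrt ?s) * ((?e x + ?f x) / sqrt ?s)) =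
    (\<Sum>x<d * m. (?e x + ?f x) * (?e x + ?f x) / ?s)"
    by (intro sum.cong refl) (simp only: complex_cnj_divide complex_cnj_complex_of_real times_divide_times_eq ss complex_cnj_add diag_vec_cnj if_distrib[of cnj] complex_cnj_one complex_cnj_zero)
  also have "\<dots> = 1" unfolding sum_divide_distrib[symmetric] 1 using s by (simp only: divide_self_if of_real_eq_0_iff) simp
  finally show "unitary_mat (d * m) (base_mat m d)" unfolding base_mat_def by (rule refl_mat_unitary)
  fix y assume y: "y < d * m"
  have "base_mat m d $$ (y,0) = 2 * (((?e y + ?f y) / sqrt ?s) * cnj ((1 + ?f 0) / sqrt ?s)) - ?e y"
    using y pos by (simp add: base_mat_def refl_mat_def)
  also have "\<dots> = (?e y + ?f y) * (2 * (1 + ?f 0) / (complex_of_real (sqrt ?s) * complex_of_real (sqrt ?s))) - ?e y"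
    by (simp add: diag_vec_cnj)
  also have "2 * (1 + ?f 0) = complex_of_real ?s" by (simp add: f0 algebra_simps)
  finally show "base_mat m d $$ (y,0) = ?f y" unfolding ss using s by (simp only: divide_self_if of_real_eq_0_iff) simp
qed

text \<open>Only the first column of \<open>U\<close> matters: reshaped into a d x m matrix M, it
  encodes the state M M^dagger.\<close>

lemma encoded_state_index:
  assumes U: "U \<in> carrier_mat (d * m) (d * m)" and ij: "i < d" "j < d" and m: "0 < m"
  shows "encoded_state d m U $$ (i,j) = (\<Sum>k<m. U $$ (i * m + k, 0) * cnj (U $$ (j * m + k, 0)))"
proof -
  have lt: "i * m + k < d * m" if "i < d" "k < m" for i k
  proof -
    have "i * m + k < Suc i * m" using that by simp
    also have "\<dots> \<le> d * m" using that by (intro mult_right_mono) auto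
    finally show ?thesis .
  qed
  have pos: "0 < d * m" using ij m by simp
  have P: "proj0 (d * m) \<in> carrier_mat (d * m) (d * m)" by (simp add: proj0_def)
  have 1: "(U * proj0 (d * m)) $$ (r,l) = (if l = 0 then U $$ (r,0) else 0)" if "r < d * m" "l < d * m" for r l
  proof -
    have "(U * proj0 (d * m)) $$ (r,l) = (\<Sum>k<d * m. U $$ (r,k) * proj0 (d * m) $$ (k,l))"
      using U P that by (subst index_mult_mat_sum) auto
    also have "\<dots> = (\<Sum>k<d * m. if k = 0 then (if l = 0 then U $$ (r,0) else 0) else 0)"
      using that by (intro sum.cong refl) (auto simp: proj0_def)
    finally show ?thesis using pos by simp
  qed
  have "(U * proj0 (d * m) * mat_adjoint U) $$ (r,s) = U $$ (r,0) * cnj (U $$ (s,0))" if "r < d * m" "s < d * m" for r s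
  proof -
    have "(U * proj0 (d * m) * mat_adjoint U) $$ (r,s) = (\<Sum>k<d * m. (U * proj0 (d * m)) $$ (r,k) * mat_adjoint U $$ (k,s))"
      using U P that by (subst index_mult_mat_sum) auto
    also have "\<dots> = (\<Sum>k<d * m. if k = 0 then U $$ (r,0) * cnj (U $$ (s,0)) else 0)"
      using U that by (intro sum.cong refl) (auto simp: 1)
    finally show ?thesis using pos by simp
  qed
  thus ?thesis using ij lt unfolding encoded_state_def ptrace_B_def by simp
qed

lemma encoded_state_carrier: "encoded_state d m U \<in> carrier_mat d d"
  by (simp add: encoded_state_def ptrace_B_def)

text \<open>The first column is the reflection of \<open>diag_vec\<close> about \<eta>. Their inner
  product is a sqrt (D / d), since the trace of R vanishes. Outside the corner \<eta> is zero and
  only the sign of \<open>diag_vec\<close> changes.\<close>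

lemma oracle_column:
  assumes R: "R \<in> hermitian_reflections D" and D: "0 < D" "D \<le> d" "d \<le> m" and x: "x < d * m"
  shows "(refl_mat (d * m) (oracle_vec D m a c R) * base_mat m d) $$ (x,0) =
    (if x div m < D \<and> x mod m < D then ((2 * a\<^sup>2 - 1) * (if x div m = x mod m then 1 else 0) + 2 * a * c * R $$ (x div m, x mod m)) / sqrt (real d)
     else - diag_vec m d x)"
proof -
  let ?\<eta> = "oracle_vec D m a c R"
  have d: "0 < d" "d \<le> m" using D by auto
  have tr: "(\<Sum>i<D. R $$ (i,i)) = 0" using R by (auto simp: hermitian_reflections_def)
  have bc: "base_mat m d \<in> carrier_mat (d * m) (d * m)" by (simp add: base_mat_def)
  have "(refl_mat (d * m) ?\<eta> * base_mat m d) $$ (x,0) = (\<Sum>y<d * m. refl_mat (d * m) ?\<eta> $$ (x,y) * base_mat m d $$ (y,0))"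
    using bc x d by (subst index_mult_mat_sum) auto
  also have "\<dots> = (\<Sum>y<d * m. refl_mat (d * m) ?\<eta> $$ (x,y) * diag_vec m d y)"
    by (intro sum.cong refl) (simp add: base_mat(2)[OF d])
  also have "\<dots> = 2 * (?\<eta> x * (\<Sum>y<d * m. cnj (?\<eta> y) * diag_vec m d y)) - diag_vec m d x"
    by (rule refl_mat_apply[OF x])
  also have "(\<Sum>y<d * m. cnj (?\<eta> y) * diag_vec m d y) = 
     (\<Sum>y<d * m. emb m D (\<lambda>i j. if i = j then (a + cnj c * cnj (R $$ (i,i))) / (sqrt (real D) * sqrt (real d)) else 0) y)"
    using D by (intro sum.cong refl) (auto simp: oracle_vec_def diag_vec_def emb_def)
  also have "\<dots> = (\<Sum>i<D. (a + cnj c * cnj (R $$ (i,i))) / (sqrt (real D) * sqrt (real d)))"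
    using D by (simp add: sum_emb)
  also have "\<dots> = (of_nat D * a + cnj c * cnj (\<Sum>i<D. R $$ (i,i))) / (sqrt (real D) * sqrt (real d))"
    by (simp add: sum_divide_distrib[symmetric] sum.distrib sum_distrib_left cnj_sum)
  finally have e: "(refl_mat (d * m) ?\<eta> * base_mat m d) $$ (x,0) = 2 * (?\<eta> x * (of_nat D * a / (sqrt (real D) * sqrt (real d)))) - diag_vec m d x"
    unfolding tr by simp
  have sD: "complex_of_nat D = complex_of_real (sqrt (real D)) * complex_of_real (sqrt (real D))"
    by (simp only: of_real_mult[symmetric]) simp
  show ?thesis
  proof (cases "x div m < D \<and> x mod m < D")
    case True
    have nz: "complex_of_real (sqrt (real D)) \<noteq> 0" "complex_of_real (sqrt (real d)) \<noteq> 0" using D by auto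
    have dv: "diag_vec m d x = (if x div m = x mod m then 1 else 0) / complex_of_real (sqrt (real d))"
      using True D by (auto simp: diag_vec_def emb_def)
    define p where "p = complex_of_real a * (if x div m = x mod m then 1 else 0) + c * R $$ (x div m, x mod m)"
    have \<eta>x: "?\<eta> x = p / sqrt (real D)" using True by (simp add: oracle_vec_def emb_def p_def)
    have gen1: "p / s * (s * s * a / (s * t)) = p * a / t" if "s \<noteq> 0" "t \<noteq> 0" for p s t a :: complex
      using that by (simp add: field_simps)
    have gen2: "2 * ((a * \<delta> + c * r) * a / t) - \<delta> / t = ((2 * a\<^sup>2 - 1) * \<delta> + 2 * a * c * r) / t" if "t \<noteq> 0" for a \<delta> c r t :: complex
      using that by (simp add: field_simps power2_eq_square)
    have "(refl_mat (d * m) ?\<eta> * base_mat m d) $$ (x,0) = 2 * (p * a / sqrt (real d)) - diag_vec m d x"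
      by (simp only: e \<eta>x of_real_mult of_real_divide of_real_of_nat_eq sD gen1[OF nz])
    also have "\<dots> = ((2 * (complex_of_real a)\<^sup>2 - 1) * (if x div m = x mod m then 1 else 0) + 2 * complex_of_real a * c * R $$ (x div m, x mod m)) / sqrt (real d)"
      unfolding dv p_def by (rule gen2[OF nz(2)])
    finally show ?thesis using True by (simp del: index_mult_mat(1))
  next
    case False
    hence "?\<eta> x = 0" by (auto simp: oracle_vec_def emb_def)
    thus ?thesis unfolding e if_not_P[OF False] by simp
  qed
qed

text \<open>On the corner the reshaped column is (A + B R) / sqrt d with A = 2 a^2 - 1 and B = 2 a
  c. From R^2 = 1 its product with its adjoint is (|A|^2 + |B|^2) + 2 A Re B R, up to 1 / d, where
  |A|^2 + |B|^2 = 1. All trace of R therefore disappears when c is purely imaginary.\<close>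

lemma encoded_state_oracle:
  assumes R: "R \<in> hermitian_reflections D" and D: "0 < D" "D \<le> d" "d \<le> m" and ab: "a\<^sup>2 + (cmod c)\<^sup>2 = 1"
    and ij: "i < d" "j < d"
  shows "encoded_state d m (refl_mat (d * m) (oracle_vec D m a c R) * base_mat m d) $$ (i,j) =
    ((if i = j then 1 else 0) + (if i < D \<and> j < D then 4 * a * (2 * a\<^sup>2 - 1) * Re c * R $$ (i,j) else 0)) / of_nat d"
proof -
  let ?U = "refl_mat (d * m) (oracle_vec D m a c R) * base_mat m d"
  have Uc: "?U \<in> carrier_mat (d * m) (d * m)" by (auto simp: base_mat_def)
  have m: "0 < m" using D by simp
  define A B where "A = complex_of_real (2 * a\<^sup>2 - 1)" and "B = 2 * a * c"
  define M where "M = (\<lambda>i k. ?U $$ (i * m + k, 0))"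
  have M: "M i k = (if i < D \<and> k < D then A * (if i = k then 1 else 0) + B * R $$ (i,k) else if i = k then - 1 else 0) / sqrt (real d)"
    if "i < d" "k < m" for i k
  proof -
    have "i * m + k < Suc i * m" using that by simp
    also have "\<dots> \<le> d * m" using that by (intro mult_right_mono) auto
    finally have "i * m + k < d * m" .
    thus ?thesis unfolding M_def oracle_column[OF R D \<open>i * m + k < d * m\<close>]
      using that by (auto simp: A_def B_def diag_vec_def emb_def)
  qed
  have sd: "complex_of_real (sqrt (real d)) * complex_of_real (sqrt (real d)) = of_nat d"
    by (simp only: of_real_mult[symmetric]) simp
  define N where "N = (\<lambda>i k. if i < D \<and> k < D then A * (if i = k then 1 else 0) + B * R $$ (i,k) else if i = k then - 1 else 0)"
  have "encoded_state d m ?U $$ (i,j) = (\<Sum>k<m. M i k * cnj (M j k))"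
    unfolding M_def by (rule encoded_state_index[OF Uc ij m])
  also have "\<dots> = (\<Sum>k<m. N i k * cnj (N j k) / of_nat d)"
  proof (intro sum.cong refl)
    fix k assume "k \<in> {..<m}"
    hence "M i k = N i k / sqrt (real d)" "M j k = N j k / sqrt (real d)" using ij by (simp_all only: M N_def lessThan_iff)
    thus "M i k * cnj (M j k) = N i k * cnj (N j k) / of_nat d"
      by (simp only: complex_cnj_divide complex_cnj_complex_of_real times_divide_times_eq sd)
  qed
  also have "\<dots> = (\<Sum>k<m. N i k * cnj (N j k)) / of_nat d" by (simp add: sum_divide_distrib)
  also have "(\<Sum>k<m. N i k * cnj (N j k)) = (if i = j then 1 else 0) + (if i < D \<and> j < D then 4 * a * (2 * a\<^sup>2 - 1) * Re c * R $$ (i,j) else 0)"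
  proof (cases "i < D \<and> j < D")
    case True
    have rr: "(\<Sum>k<D. R $$ (i,k) * cnj (R $$ (j,k))) = (if i = j then 1 else 0)"
    proof -
      have "(\<Sum>k<D. R $$ (i,k) * cnj (R $$ (j,k))) = (\<Sum>k<D. R $$ (i,k) * R $$ (k,j))"
        using True by (intro sum.cong refl) (simp add: hermitian_reflections_cnj[OF R])
      also have "\<dots> = (R * R) $$ (i,j)" using True hermitian_reflections_carrier[OF R] by (subst index_mult_mat_sum) auto
      finally show ?thesis using R True by (simp add: hermitian_reflections_def)
    qed
    have rij: "cnj (R $$ (j,i)) = R $$ (i,j)" using True by (simp add: hermitian_reflections_cnj[OF R])
    have "(\<Sum>k<m. N i k * cnj (N j k)) = (\<Sum>k<D. N i k * cnj (N j k))"
      using True D by (intro sum.mono_neutral_right) (auto simp: N_def)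
    also have "\<dots> = (\<Sum>k<D. (if k = i then (if i = j then A * cnj A else 0) else 0) + (if k = i then A * cnj B * cnj (R $$ (j,i)) else 0)
       + (if k = j then B * cnj A * R $$ (i,j) else 0) + B * cnj B * (R $$ (i,k) * cnj (R $$ (j,k))))"
      using True by (intro sum.cong refl) (auto simp: N_def algebra_simps)
    also have "\<dots> = (if i = j then A * cnj A else 0) + A * cnj B * cnj (R $$ (j,i)) + B * cnj A * R $$ (i,j) + B * cnj B * (if i = j then 1 else 0)"
      unfolding sum.distrib sum_distrib_left[symmetric] rr using True by simp
    also have "\<dots> = (if i = j then A * cnj A + B * cnj B else 0) + (A * cnj B + B * cnj A) * R $$ (i,j)"
      unfolding rij by (simp add: algebra_simps)
    also have "A * cnj A + B * cnj B = 1"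
    proof -
      have "A * cnj A = complex_of_real ((2 * a\<^sup>2 - 1)\<^sup>2)" by (simp add: A_def power2_eq_square)
      moreover have "B * cnj B = complex_of_real (4 * a\<^sup>2) * (c * cnj c)" by (simp add: B_def power2_eq_square mult_ac)
      ultimately have "A * cnj A + B * cnj B = complex_of_real ((2 * a\<^sup>2 - 1)\<^sup>2 + 4 * a\<^sup>2 * (cmod c)\<^sup>2)"
        by (simp only: complex_norm_square[symmetric] of_real_add of_real_mult)
      also have "(cmod c)\<^sup>2 = 1 - a\<^sup>2" using ab by simp
      also have "(2 * a\<^sup>2 - 1)\<^sup>2 + 4 * a\<^sup>2 * (1 - a\<^sup>2) = 1" by (simp add: power2_eq_square algebra_simps)
      finally show ?thesis by simp
    qed
    also have "A * cnj B + B * cnj A = 4 * a * (2 * a\<^sup>2 - 1) * Re c"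
    proof -
      have "A * cnj B + B * cnj A = A * (2 * a) * (c + cnj c)" unfolding A_def B_def by (simp add: algebra_simps)
      thus ?thesis unfolding complex_add_cnj A_def by simp
    qed
    finally show ?thesis using True by simp
  next
    case False
    have "(\<Sum>k<m. N i k * cnj (N j k)) = (\<Sum>k<m. if k = i then (if i = j then 1 else 0) else 0)"
      using False by (intro sum.cong refl) (auto simp: N_def)
    thus ?thesis using False ij D by auto
  qed
  finally show ?thesis .
qed

section \<open>Trace norm of a scaled reflection\<close>

lemma trace_norm_diagonal:
  assumes X: "X \<in> carrier_mat d d" and r: "mat_adjoint X * X = mat d d (\<lambda>(i,j). if i = j then complex_of_real (r i) else 0)"
  shows "trace_norm X = (\<Sum>i<d. sqrt (r i))"
proof -
  let ?M = "mat d d (\<lambda>(i,j). if i = j then complex_of_real (r i) else 0)"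
  have M: "?M \<in> carrier_mat d d" by simp
  have "upper_triangular ?M" by (auto simp: upper_triangular_def)
  from char_poly_upper_triangular[OF M this]
  have cp: "char_poly ?M = (\<Prod>a\<leftarrow>diag_mat ?M. [:- a, 1:])" .
  define as where "as = (SOME as. char_poly (mat_adjoint X * X) = (\<Prod>a\<leftarrow>as. [:- a, 1:]))"
  have as: "char_poly ?M = (\<Prod>a\<leftarrow>as. [:- a, 1:])"
    unfolding as_def r using someI[of "\<lambda>as. char_poly ?M = (\<Prod>a\<leftarrow>as. [:- a, 1:])", OF cp] .
  \<comment> \<open>The choice in \<open>trace_norm\<close> may return the eigenvalues in any order;
    the multiset of roots determines the sum.\<close>
  have roots: "proots (\<Prod>a\<leftarrow>xs. [:- a, 1:]) = mset xs" for xs :: "complex list"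
  proof (induct xs)
    case (Cons x xs)
    have "(\<Prod>a\<leftarrow>xs. [:- a, 1:]) \<noteq> 0" by (auto simp: prod_list_zero_iff)
    hence "proots ([:- x, 1:] * (\<Prod>a\<leftarrow>xs. [:- a, 1:])) = proots [:- x, 1:] + proots (\<Prod>a\<leftarrow>xs. [:- a, 1:])"
      by (intro proots_mult) auto
    thus ?case using Cons by simp
  qed simp
  have "mset as = mset (diag_mat ?M)" using roots[of as] roots[of "diag_mat ?M"] as cp by simp
  hence "sum_mset (image_mset (\<lambda>a. sqrt (Re a)) (mset as)) = sum_mset (image_mset (\<lambda>a. sqrt (Re a)) (mset (diag_mat ?M)))" by simp
  hence "(\<Sum>a\<leftarrow>as. sqrt (Re a)) = (\<Sum>a\<leftarrow>diag_mat ?M. sqrt (Re a))"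
    by (simp add: sum_mset_sum_list flip: mset_map)
  also have "\<dots> = (\<Sum>i\<leftarrow>[0..<d]. sqrt (r i))"
    unfolding diag_mat_def map_map o_def by (intro arg_cong[where f = sum_list] map_cong) auto
  also have "\<dots> = (\<Sum>i<d. sqrt (r i))" by (simp add: interv_sum_list_conv_sum_set_nat lessThan_atLeast0)
  finally show ?thesis by (simp add: trace_norm_def as_def[symmetric])
qed

text \<open>From R^2 = 1 there are D singular values |k|, and all others vanish.\<close>

lemma trace_norm_reflection:
  assumes R: "R \<in> hermitian_reflections D" and D: "D \<le> d" and X: "X \<in> carrier_mat d d"
    and Xij: "\<And>i j. i < d \<Longrightarrow> j < d \<Longrightarrow> X $$ (i,j) = (if i < D \<and> j < D then complex_of_real k * R $$ (i,j) else 0)"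
  shows "trace_norm X = real D * \<bar>k\<bar>"
proof -
  have "mat_adjoint X * X = mat d d (\<lambda>(i,j). if i = j then complex_of_real (if i < D then k\<^sup>2 else 0) else 0)"
  proof (rule eq_matI)
    fix i j assume "i < dim_row (mat d d (\<lambda>(i,j). if i = j then complex_of_real (if i < D then k\<^sup>2 else 0) else 0))"
      "j < dim_col (mat d d (\<lambda>(i,j). if i = j then complex_of_real (if i < D then k\<^sup>2 else 0) else 0))"
    hence ij: "i < d" "j < d" by auto
    have "(mat_adjoint X * X) $$ (i,j) = (\<Sum>l<d. cnj (X $$ (l,i)) * X $$ (l,j))"
      using X ij by (subst index_mult_mat_sum) auto
    also have "\<dots> = (if i < D \<and> j < D then complex_of_real (k\<^sup>2) * (if i = j then 1 else 0) else 0)"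
    proof (cases "i < D \<and> j < D")
      case True
      have "(\<Sum>l<d. cnj (X $$ (l,i)) * X $$ (l,j)) = (\<Sum>l<D. cnj (X $$ (l,i)) * X $$ (l,j))"
        using D ij by (intro sum.mono_neutral_right) (auto simp: Xij)
      also have "\<dots> = (\<Sum>l<D. complex_of_real (k\<^sup>2) * (R $$ (i,l) * R $$ (l,j)))"
        using D ij True by (intro sum.cong refl) (simp add: Xij hermitian_reflections_cnj[OF R] power2_eq_square)
      also have "\<dots> = complex_of_real (k\<^sup>2) * (R * R) $$ (i,j)"
        unfolding sum_distrib_left[symmetric]
        using True hermitian_reflections_carrier[OF R] by (subst index_mult_mat_sum) auto
      finally show ?thesis using True R by (simp add: hermitian_reflections_def)
    next
      case False
      have "(\<Sum>l<d. cnj (X $$ (l,i)) * X $$ (l,j)) = 0"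
        by (rule sum.neutral) (use False ij in \<open>auto simp: Xij\<close>)
      thus ?thesis by (simp only: False if_False)
    qed
    finally show "(mat_adjoint X * X) $$ (i,j) = mat d d (\<lambda>(i,j). if i = j then complex_of_real (if i < D then k\<^sup>2 else 0) else 0) $$ (i,j)"
      using ij by auto
  qed (use X in auto)
  hence "trace_norm X = (\<Sum>i<d. sqrt (if i < D then k\<^sup>2 else 0))" by (rule trace_norm_diagonal[OF X])
  also have "\<dots> = (\<Sum>i<D. \<bar>k\<bar>)"
    using D by (intro sum.mono_neutral_cong_right) auto
  finally show ?thesis by simp
qed

lemma unitary_mat_mult:
  assumes A: "unitary_mat n A" and B: "unitary_mat n B"
  shows "unitary_mat n (A * B)"
proof -
  have c: "A \<in> carrier_mat n n" "B \<in> carrier_mat n n" "mat_adjoint A \<in> carrier_mat n n" "mat_adjoint B \<in> carrier_mat n n"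
    using A B by (auto simp: unitary_mat_def)
  have u: "mat_adjoint A * A = 1\<^sub>m n" "A * mat_adjoint A = 1\<^sub>m n" "mat_adjoint B * B = 1\<^sub>m n" "B * mat_adjoint B = 1\<^sub>m n"
    using A B by (auto simp: unitary_mat_def)
  have "mat_adjoint (A * B) * (A * B) = mat_adjoint B * ((mat_adjoint A * A) * B)"
    unfolding mat_adjoint_mult[OF c(1,2)] using c by (simp add: assoc_mult_mat[of _ n n _ n _ n])
  moreover have "(A * B) * mat_adjoint (A * B) = A * ((B * mat_adjoint B) * mat_adjoint A)"
    unfolding mat_adjoint_mult[OF c(1,2)] using c mult_carrier_mat[OF c(4,3)] by (simp add: assoc_mult_mat[of _ n n _ n _ n])
  ultimately show ?thesis unfolding unitary_mat_def u using c u by simp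
qed

text \<open>The condition m \<ge> d gives the purifying system room for the maximally entangled
  vector and for the D x D corner.\<close>

lemma mixedness_query_bound:
  assumes d: "2 \<le> d" "d \<le> m" and e: "0 < \<epsilon>" "\<epsilon> \<le> 1/2"
    and alg: "valid_algorithm (d * m) w T Vs qs" and sol: "solves_mixedness d m \<epsilon> w Vs qs S"
  shows "real T \<ge> (1/25) * sqrt (real d) / \<epsilon>"
proof -
  define n where "n = d * m"
  define D where "D = 2 * (d div 2)"
  define b where "b = \<epsilon> / 2"
  define a where "a = sqrt (1 - b\<^sup>2)"
  have D: "2 \<le> D" "D \<le> d" "d \<le> D + 1" "even D" using d by (auto simp: D_def)
  have D0: "0 < D" using D by simp
  \<comment> \<open>The worst case of rounding down to an even number is d = 3, D = 2.\<close>
  have dD: "2 * real d \<le> 3 * real D" using D by linarith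
  have n: "0 < n" "0 < w" using d alg by (auto simp: n_def valid_algorithm_def)
  have b: "0 < b" "b \<le> 1/4" using e by (auto simp: b_def)
  have b2: "b\<^sup>2 \<le> 1/16" using power_mono[OF b(2), of 2] b by (simp add: power2_eq_square)
  have a2: "a\<^sup>2 = 1 - b\<^sup>2" using b2 by (simp add: a_def)
  have a0: "0 \<le> a" "a \<le> 1" using b2 by (auto simp: a_def)
  \<comment> \<open>As a \<le> 1, a is at least a^2 = 1 - b^2, and b \<le> 1/4.\<close>
  have a1: "15/16 \<le> a"
    using a2 b2 mult_left_mono[OF a0(2) a0(1)] by (simp add: power2_eq_square)
  have ab: "a\<^sup>2 + b\<^sup>2 = 1" by (simp add: a2)
  obtain R0 where "R0 \<in> hermitian_reflections D" using hermitian_reflections_nonempty[OF D(4)] by blast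
  then obtain \<mu> where \<mu>: "min_seq D \<mu>" using min_seq_exists by blast
  define U0 where "U0 = base_mat m d"
  have U0: "unitary_mat n U0" unfolding n_def U0_def using d by (intro base_mat) auto
  define U where "U = (\<lambda>\<alpha> R. refl_mat n (oracle_vec D m a (b * cis \<alpha>) R) * U0)"
  have ac: "a\<^sup>2 + (cmod (b * cis \<alpha>))\<^sup>2 = 1" for \<alpha> using ab by (simp add: norm_mult)
  have Uu: "unitary_mat n (U \<alpha> R)" if R: "R \<in> hermitian_reflections D" for \<alpha> R
  proof -
    have "unitary_mat n (refl_mat n (oracle_vec D m a (b * cis \<alpha>) R))" unfolding n_def
      by (intro refl_mat_unitary oracle_vec_unit[OF R D0 D(2) _ ac]) (use D d in auto)
    thus ?thesis unfolding U_def by (rule unitary_mat_mult[OF _ U0])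
  qed
  have enc: "encoded_state d m (U \<alpha> R) $$ (i,j) =
    ((if i = j then 1 else 0) + (if i < D \<and> j < D then 4 * a * (2 * a\<^sup>2 - 1) * Re (b * cis \<alpha>) * R $$ (i,j) else 0)) / of_nat d"
    if "R \<in> hermitian_reflections D" "i < d" "j < d" for \<alpha> R i j
    unfolding U_def n_def U0_def by (rule encoded_state_oracle[OF that(1) D0 D(2) d(2) ac that(2,3)])
  have null: "encoded_state d m (U (pi / 2) R) = maximally_mixed d" if R: "R \<in> hermitian_reflections D" for R
  proof (rule eq_matI)
    fix i j assume "i < dim_row (maximally_mixed d)" "j < dim_col (maximally_mixed d)"
    hence ij: "i < d" "j < d" by (auto simp: maximally_mixed_def)
    show "encoded_state d m (U (pi / 2) R) $$ (i,j) = maximally_mixed d $$ (i,j)"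
      unfolding enc[OF R ij] using ij by (simp add: maximally_mixed_def)
  qed (use encoded_state_carrier[of d m] in \<open>auto simp: maximally_mixed_def\<close>)
  have far: "trace_norm (encoded_state d m (U 0 R) - maximally_mixed d) \<ge> \<epsilon>" if R: "R \<in> hermitian_reflections D" for R
  proof -
    define k where "k = 4 * a * (2 * a\<^sup>2 - 1) * b / real d"
    have "trace_norm (encoded_state d m (U 0 R) - maximally_mixed d) = real D * \<bar>k\<bar>"
    proof (rule trace_norm_reflection[OF R D(2)])
      show "encoded_state d m (U 0 R) - maximally_mixed d \<in> carrier_mat d d"
        by (auto simp: maximally_mixed_def)
      fix i j assume ij: "i < d" "j < d"
      show "(encoded_state d m (U 0 R) - maximally_mixed d) $$ (i,j) = (if i < D \<and> j < D then complex_of_real k * R $$ (i,j) else 0)"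
        using ij encoded_state_carrier[of d m "U 0 R"] enc[OF R ij, of 0]
        by (simp add: maximally_mixed_def k_def diff_divide_distrib add_divide_distrib)
    qed
    moreover have "\<epsilon> \<le> real D * \<bar>k\<bar>"
    proof -
      \<comment> \<open>With a^2 \<ge> 15/16 the factor 2 a^2 - 1 is at least 7/8, and 4 * (15/16) *
        (7/8) exceeds 3. The margin from 2 to 3 absorbs the factor D / d \<ge> 2/3, so that 2 b =
        \<epsilon> is reached.\<close>
      have "3 * b \<le> 4 * a * (2 * a\<^sup>2 - 1) * b"
      proof -
        have "(15/16) * (7/8) \<le> a * (2 * a\<^sup>2 - 1)" using a1 a2 b2 by (intro mult_mono) auto
        hence "3 \<le> 4 * a * (2 * a\<^sup>2 - 1)" by simp
        thus ?thesis using b by (intro mult_right_mono) auto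
      qed
      hence "3 * b / real d \<le> k" unfolding k_def using d by (intro divide_right_mono) auto
      hence "real D * (3 * b / real d) \<le> real D * \<bar>k\<bar>" by (intro mult_left_mono) auto
      moreover have "2 * b \<le> real D * (3 * b / real d)"
      proof -
        have "2 * real d * b \<le> 3 * real D * b" using dD b by (intro mult_right_mono) auto
        thus ?thesis using d by (simp add: field_simps)
      qed
      ultimately show ?thesis by (simp add: b_def)
    qed
    ultimately show ?thesis by simp
  qed
  interpret oracle_field D n "{..<D} \<times> {..<D}" "gen D"
    "\<lambda>\<alpha> R. oracle_vec D m a (b * cis \<alpha>) R" "\<lambda>\<alpha> R. part_vec D m (b * cis \<alpha>) R"
    "\<lambda>\<alpha> R k. part_vec D m (b * cis \<alpha>) (comm (gen D k) R)"
    "\<lambda>\<alpha> R k. part_vec D m (b * cis \<alpha>) (comm (gen D k) (comm (gen D k) R))"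
    "2 * real D" "b * sqrt (8 / real D)" "b * sqrt (8 * real D)" \<mu>
    unfolding n_def by (rule oracle_field_reflections[OF D0 D(2) _ ab _ \<mu>]) (use D d b in auto)
  define ss where "ss = algorithm_steps n w U0 Vs qs"
  define u0 :: state where "u0 = (\<lambda>q. if site n w q = 0 then 1 else 0)"
  define Acc where "Acc = {q. site n w q \<in> S}"
  define P where "P = (\<lambda>\<alpha> R. \<Sum>q\<in>{..<2 * w} \<times> {..<n}. if q \<in> Acc then
     (cmod (fst (fold (field_step (2 * w) \<alpha> R) ss (u0, \<lambda>_ _. 0, \<lambda>_. 0)) q))\<^sup>2 else 0)"
  have alg': "valid_algorithm n w T Vs qs" using alg by (simp add: n_def)
  have P: "P \<alpha> R = accept_prob n w Vs qs S (U \<alpha> R)" for \<alpha> R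
    unfolding P_def accept_prob_sites[OF n]
  proof (intro sum.cong refl)
    fix q assume q: "q \<in> {..<2 * w} \<times> {..<n}"
    have "fst (fold (field_step (2 * w) \<alpha> R) ss (u0, \<lambda>_ _. 0, \<lambda>_. 0)) q = alg_final_state n w Vs qs (U \<alpha> R) $ site n w q"
      unfolding ss_def U_def
      by (rule algorithm_steps_correct[OF U0 n(1) alg' _ q]) (use site_less[OF n] in \<open>auto simp: u0_def\<close>)
    thus "(if q \<in> Acc then (cmod (fst (fold (field_step (2 * w) \<alpha> R) ss (u0, \<lambda>_ _. 0, \<lambda>_. 0)) q))\<^sup>2 else 0) =
      (if site n w q \<in> S then (cmod (alg_final_state n w Vs qs (U \<alpha> R) $ site n w q))\<^sup>2 else 0)"
      by (simp add: Acc_def)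
  qed
  have u0: "state_norm (2 * w) n u0 \<le> 1"
  proof -
    have "(\<Sum>q\<in>{..<2 * w} \<times> {..<n}. (cmod (u0 q))\<^sup>2) = (\<Sum>i<2 * n * w. (cmod (if i = 0 then 1 else 0))\<^sup>2)"
      unfolding u0_def by (rule sum_site[OF n])
    also have "\<dots> = (\<Sum>i<2 * n * w. if i = 0 then 1 else 0)" by (intro sum.cong refl) auto
    finally show ?thesis using n by (simp add: state_norm_def L2_set_def)
  qed
  define E where "E = (\<lambda>j \<alpha>. Re (expect (\<mu> j) (\<lambda>R. complex_of_real (P \<alpha> R))))"
  define g where "g = pi * (16 * (b * sqrt (8 / real D)) * (b * sqrt (8 * real D) + b * sqrt (8 / real D)) * (real T)\<^sup>2 / (2 * real D))"
  \<comment> \<open>The guarantees hold for each reflection, hence for the average over any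
    probability list: at least 2/3 at pi / 2 and at most 1/3 at 0.\<close>
  have gap: "1/3 \<le> \<bar>E j (pi / 2) - E j 0\<bar>" for j
  proof -
    have prob: "prob_list (hermitian_reflections D) (\<mu> j)" using \<mu> by (auto simp: min_seq_def)
    have mono: "Re (expect \<nu> f) \<le> c * Re (expect \<nu> (\<lambda>_. 1))"
      if "\<forall>(a,R)\<in>set \<nu>. a \<in> \<real> \<and> 0 \<le> Re a \<and> R \<in> hermitian_reflections D" "\<And>R. R \<in> hermitian_reflections D \<Longrightarrow> Re (f R) \<le> c"
      for \<nu> :: "(complex \<times> complex mat) list" and f c
      using that(1)
    proof (induct \<nu>)
      case (Cons x \<nu>)
      obtain z R where x: "x = (z,R)" by force
      have "Re z * Re (f R) \<le> Re z * c" using Cons(2) x that(2) by (intro mult_left_mono) auto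
      thus ?case using Cons x by (auto simp: complex_is_Real_iff algebra_simps)
    qed simp
    have acc: "2/3 \<le> P (pi / 2) R" "P 0 R \<le> 1/3" if R: "R \<in> hermitian_reflections D" for R
      using sol Uu[OF R] null[OF R] far[OF R] unfolding solves_mixedness_def P n_def[symmetric] by blast+
    have "E j 0 \<le> 1/3" unfolding E_def
      using mono[of "\<mu> j" "\<lambda>R. complex_of_real (P 0 R)" "1/3"] acc(2) prob by (simp add: prob_list_def)
    moreover have "- E j (pi / 2) \<le> - (2/3)" unfolding E_def
      using mono[of "\<mu> j" "\<lambda>R. - complex_of_real (P (pi / 2) R)" "- (2/3)"] acc(1) prob
        expect_cmult[of "\<mu> j" "-1" "\<lambda>R. complex_of_real (P (pi / 2) R)"] by (simp add: prob_list_def)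
    ultimately show ?thesis by linarith
  qed
  \<comment> \<open>The index \<open>j\<close> depends on \<open>e'\<close>, but the gap holds for
    every \<open>j\<close>, so \<open>e'\<close> can be sent to zero.\<close>
  have "1/3 \<le> g + e'" if e': "0 < e'" for e'
  proof -
    have "\<exists>j. \<bar>E j (pi / 2) - E j 0\<bar> \<le> g + e'"
      using acceptance_variation[of ss "2 * w" u0 e' Acc] algorithm_steps_valid[OF U0 n(1) alg'] u0 e' b D0
      unfolding E_def P_def g_def ss_def algorithm_steps_count[OF alg'] by simp
    thus ?thesis using gap by (meson order_trans)
  qed
  hence g: "1/3 \<le> g" by (rule field_le_epsilon)
  \<comment> \<open>This gives \<gamma> \<le> \<Lambda>, so \<gamma> (\<Lambda> + \<gamma>) is at
    most 2 \<gamma> \<Lambda> = 16 b^2 and D survives only through the eigenvalue.\<close>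
  have "1 \<le> real D * real D" using mult_mono[of 1 "real D" 1 "real D"] D by simp
  hence "sqrt (8 / real D) \<le> sqrt (8 * real D)" using D by (simp add: field_simps)
  hence "b * sqrt (8 * real D) + b * sqrt (8 / real D) \<le> 2 * (b * sqrt (8 * real D))" using b by simp
  hence "g \<le> pi * (16 * (b * sqrt (8 / real D)) * (2 * (b * sqrt (8 * real D))) * (real T)\<^sup>2 / (2 * real D))"
    unfolding g_def using b D0 by (intro mult_left_mono divide_right_mono mult_right_mono) auto
  also have "\<dots> = pi * (128 * b\<^sup>2 * (real T)\<^sup>2 / real D)"
  proof -
    have "sqrt (8 / real D) * sqrt (8 * real D) = 8"
      using D0 by (simp add: real_sqrt_mult[symmetric])
    hence "16 * (b * sqrt (8 / real D)) * (2 * (b * sqrt (8 * real D))) = 256 * b\<^sup>2" by (simp add: power2_eq_square mult_ac)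
    thus ?thesis by simp
  qed
  also have "\<dots> \<le> 4 * (128 * b\<^sup>2 * (real T)\<^sup>2 / real D)"
    using pi_less_4 by (intro mult_right_mono) auto
  finally have "1/3 \<le> 4 * (128 * b\<^sup>2 * (real T)\<^sup>2 / real D)" using g by linarith
  hence "real D \<le> 1536 * (b\<^sup>2 * (real T)\<^sup>2)" using D0 by (simp add: field_simps)
  hence "2 * real d \<le> 3 * 1536 * (b\<^sup>2 * (real T)\<^sup>2)" using dD by linarith
  hence "real d \<le> 576 * (real T * \<epsilon>)\<^sup>2" by (simp add: b_def power_mult_distrib power_divide mult_ac)
  \<comment> \<open>Rounding 576 = 24^2 up to 625 = 25^2 yields the constant 1/25.\<close>
  hence "real d \<le> 625 * (real T * \<epsilon>)\<^sup>2" using zero_le_power2[of "real T * \<epsilon>"] by linarith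
  hence "sqrt (real d) \<le> sqrt ((25 * (real T * \<epsilon>))\<^sup>2)" by (intro real_sqrt_le_mono) (simp add: power2_eq_square mult_ac)
  also have "\<dots> = 25 * (real T * \<epsilon>)" using e by (intro real_sqrt_unique) auto
  finally have "sqrt (real d) \<le> 25 * (real T * \<epsilon>)" .
  thus ?thesis using e by (simp add: field_simps)
qed

theorem theorem2p20:
  shows "\<exists>c > 0. \<exists>\<epsilon>0 > 0. \<forall>(d::nat) (m::nat) (\<epsilon>::real) (T::nat) (w::nat) Vs qs S.
           d \<ge> 2 \<longrightarrow> m \<ge> d \<longrightarrow> 0 < \<epsilon> \<longrightarrow> \<epsilon> \<le> \<epsilon>0 \<longrightarrow>
           valid_algorithm (d * m) w T Vs qs \<longrightarrow> solves_mixedness d m \<epsilon> w Vs qs S \<longrightarrow>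
           real T \<ge> c * sqrt (real d) / \<epsilon>"
  using mixedness_query_bound by (intro exI[of _ "1/25"] conjI exI[of _ "1/2"]) auto

end
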